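(* Let $G$ and $H$ be non-metrizable punctiform $\mathcal{M}_\omega$-groups. Then $G$ and $H$ are homeomorphic (as topological spaces) if and only if $d(G)=d(H)$ and $r(G)=r(H)$.
   Context: A topological group $G$ is an $\mathcal{M}_\omega$-group if its underlying topological space is an $\mathcal{M}_\omega$-space. A topological space $X$ is an $\mathcal{M}_\omega$-space if it admits a countable cover $\mathcal{K}$ by closed metrizable subspaces of $X$ such that a subset $U\subset X$ is open in $X$ if and only if $U\cap K$ is open in $K$ for every $K\in\mathcal{K}$. A topological space is punctiform if it contains no connected compact subspace having more than one point. $d(X)$ denotes the density of a topological space $X$ (the least cardinality of a dense subset). A topological space $X$ is scattered if every non-empty subset of $X$ has an isolated point (in the subspace topology). Derived sets are defined by transfinite induction: $X^{(0)}=X$; $X^{(1)}$ is the set of all non-isolated points of $X$; $X^{(\beta+1)}=(X^{(\beta)})^{(1)}$; and $X^{(\beta)}=\bigcap_{\gamma<\beta}X^{(\gamma)}$ for a limit ordinal $\beta$. For a scattered space $X$, its scatteredness index $i(X)$ is the smallest ordinal $\alpha$ such that $X^{(\alpha)}$ is finite. The compact scatteredness rank of a topological space $X$ is the ordinal $r(X)=\sup\{i(K): K \text{ is a compact scattered subset of } X\}$. *)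

theory Defs
  imports "HOL-Analysis.Analysis" "HOL-Algebra.Group"
begin

unbundle cardinal_syntax

no_notation elt_set_eq (infix \<open>=o\<close> 50)
no_notation eq_closure_of (\<open>closure'_of\<index>\<close>)

section \<open>Topological groups and \<open>\<M>\<^sub>\<omega>\<close>-groups\<close>

definition topological_group :: "('a, 'm) monoid_scheme \<Rightarrow> 'a topology \<Rightarrow> bool" where
  "topological_group G T \<longleftrightarrow>
     group G \<and> topspace T = carrier G \<and>
     continuous_map (prod_topology T T) T (\<lambda>(x, y). x \<otimes>\<^bsub>G\<^esub> y) \<and>
     continuous_map T T (\<lambda>x. inv\<^bsub>G\<^esub> x)"

definition M_omega_space :: "'a topology \<Rightarrow> bool" where
  "M_omega_space X \<longleftrightarrow>
     (\<exists>\<K>. countable \<K> \<and> \<Union>\<K> = topspace X \<and>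
          (\<forall>K\<in>\<K>. closedin X K \<and> metrizable_space (subtopology X K)) \<and>
          (\<forall>U. U \<subseteq> topspace X \<longrightarrow>
               (openin X U \<longleftrightarrow> (\<forall>K\<in>\<K>. openin (subtopology X K) (U \<inter> K)))))"

definition M_omega_group :: "('a, 'm) monoid_scheme \<Rightarrow> 'a topology \<Rightarrow> bool" where
  "M_omega_group G T \<longleftrightarrow> topological_group G T \<and> M_omega_space T"

definition punctiform_space :: "'a topology \<Rightarrow> bool" where
  "punctiform_space X \<longleftrightarrow>
     \<not> (\<exists>C. compactin X C \<and> connectedin X C \<and> (\<exists>x\<in>C. \<exists>y\<in>C. x \<noteq> y))"

section \<open>Density\<close>

definition dense_in :: "'a topology \<Rightarrow> 'a set \<Rightarrow> bool" where
  "dense_in X D \<longleftrightarrow> D \<subseteq> topspace X \<and> X closure_of D = topspace X"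

text \<open>
  Cardinals and ordinals are represented, as in the library, by well-order relations, taken up
  to order isomorphism \<open>=o\<close>, which also compares cardinals and ordinals over different types.
\<close>

definition space_density :: "'a topology \<Rightarrow> 'a rel" where
  "space_density X = |SOME D. dense_in X D \<and> (\<forall>E. dense_in X E \<longrightarrow> |D| \<le>o |E| )|"

lemma space_density:
  obtains D where "dense_in X D" "space_density X = |D|" "\<And>E. dense_in X E \<Longrightarrow> space_density X \<le>o |E|"
proof -
  let ?R = "card_of ` {D. dense_in X D}"
  have "dense_in X (topspace X)"
    by (simp add: dense_in_def closure_of_topspace)
  then have "\<exists>r\<in>?R. \<forall>r'\<in>?R. r \<le>o r'"
    by (intro exists_minim_Well_order) (auto simp: card_of_Well_order)
  then have "\<exists>D. dense_in X D \<and> (\<forall>E. dense_in X E \<longrightarrow> |D| \<le>o |E| )"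
    by auto
  from someI_ex[OF this] show ?thesis
    using that unfolding space_density_def by blast
qed

section \<open>Iterated derived sets\<close>

definition isolated_point :: "'a topology \<Rightarrow> 'a set \<Rightarrow> 'a \<Rightarrow> bool" where
  "isolated_point X A a \<longleftrightarrow> openin (subtopology X A) {a}"

definition nonisolated_points :: "'a topology \<Rightarrow> 'a set \<Rightarrow> 'a set" where
  "nonisolated_points X A = {a \<in> A. \<not> isolated_point X A a}"

definition scattered_space :: "'a topology \<Rightarrow> bool" where
  "scattered_space X \<longleftrightarrow>
     (\<forall>A. A \<subseteq> topspace X \<and> A \<noteq> {} \<longrightarrow> (\<exists>a\<in>A. isolated_point X A a))"

text \<open>
  \<open>ord_covers s r\<close>: the order type of \<open>r\<close> is the ordinal successor of the order type of \<open>s\<close>.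
  It suffices to let \<open>t\<close> range over the same type, since every ordinal below \<open>r\<close> is the order
  type of an initial segment of \<open>r\<close>.
\<close>

definition ord_covers :: "'b rel \<Rightarrow> 'b rel \<Rightarrow> bool" where
  "ord_covers s r \<longleftrightarrow> s <o r \<and> \<not> (\<exists>t :: 'b rel. s <o t \<and> t <o r)"

text \<open>
  \<open>iter_derived X r\<close> is \<open>X\<^sup>(\<^sup>\<beta>\<^sup>)\<close>, where \<open>\<beta>\<close> is the order type of the well-order \<open>r\<close>; the
  empty relation is the ordinal \<open>0\<close>. The choice of the predecessor is immaterial
  (lemma \<open>iter_derived_succ\<close>).
\<close>

definition iter_derived :: "'a topology \<Rightarrow> 'b rel \<Rightarrow> 'a set" where
  "iter_derived X = wfrec ordLess (\<lambda>D r.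
     if r = {} then topspace X
     else if \<exists>s. ord_covers s r then nonisolated_points X (D (SOME s. ord_covers s r))
     else (\<Inter>s\<in>{s. s <o r}. D s))"

lemma iter_derived_unfold:
  fixes X :: "'a topology" and r :: "'b rel"
  shows "iter_derived X r =
     (if r = {} then topspace X
      else if \<exists>s. ord_covers s r
        then nonisolated_points X (iter_derived X (SOME s. ord_covers s r))
      else (\<Inter>s\<in>{s :: 'b rel. s <o r}. iter_derived X s))"
proof -
  define F where "F = (\<lambda>(D :: 'b rel \<Rightarrow> 'a set) (r :: 'b rel).
     if r = {} then topspace X
     else if \<exists>s. ord_covers s r then nonisolated_points X (D (SOME s. ord_covers s r))
     else (\<Inter>s\<in>{s. s <o r}. D s))"
  have F: "iter_derived X = wfrec ordLess F"
    by (simp add: iter_derived_def F_def)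
  have "iter_derived X r = F (cut (iter_derived X) ordLess r) r"
    unfolding F by (rule wfrec[OF wf_ordLess])
  also have "\<dots> = F (iter_derived X) r"
  proof -
    have "(SOME s. ord_covers s r) <o r" if "\<exists>s. ord_covers s r"
      using someI_ex[OF that] unfolding ord_covers_def by (rule conjunct1)
    then show ?thesis
      unfolding F_def by (simp add: cut_apply cong: if_cong)
  qed
  finally show ?thesis
    unfolding F_def .
qed

lemma iter_derived_zero: "iter_derived X {} = topspace X"
  by (subst iter_derived_unfold) simp

lemma ordLess_imp_nonempty:
  assumes "s <o r"
  shows "r \<noteq> {}"
  using iffD1[OF internalize_ordLess assms] by auto

lemma ordIso_imp_empty_iff:
  assumes "r =o r'"
  shows "r = {} \<longleftrightarrow> r' = {}"
proof -
  obtain f where "bij_betw f (Field r) (Field r')"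
    using assms by (auto simp: ordIso_def BNF_Wellorder_Embedding.iso_def)
  then have "Field r = {} \<longleftrightarrow> Field r' = {}"
    using bij_betw_empty1 bij_betw_empty2 by metis
  then show ?thesis
    by (auto simp: Field_def)
qed

lemma iter_derived_ordIso:
  fixes r r' :: "'b rel"
  assumes "r =o r'"
  shows "iter_derived X r = iter_derived X r'"
proof -
  have less: "s <o r \<longleftrightarrow> s <o r'" for s :: "'b rel"
    using assms ordIso_symmetric ordLess_ordIso_trans by blast
  then have covers: "ord_covers s r \<longleftrightarrow> ord_covers s r'" for s
    by (simp add: ord_covers_def)
  have "r = {} \<longleftrightarrow> r' = {}"
    using assms by (rule ordIso_imp_empty_iff)
  with less covers show ?thesis
    by (simp add: iter_derived_unfold[of X r] iter_derived_unfold[of X r'])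
qed

lemma ord_cases:
  fixes s t :: "'b rel"
  assumes "Well_order s" "Well_order t"
  obtains "s <o t" | "s =o t" | "t <o s"
  using assms ordLess_or_ordLeq ordLeq_iff_ordLess_or_ordIso by metis

lemma iter_derived_succ:
  fixes r s :: "'b rel"
  assumes "ord_covers s r"
  shows "iter_derived X r = nonisolated_points X (iter_derived X s)"
proof -
  define p where "p = (SOME p. ord_covers p r)"
  have p: "ord_covers p r"
    unfolding p_def using assms by (rule someI)
  have "Well_order p" "Well_order s"
    using p assms by (auto simp: ord_covers_def ordLess_def)
  then have "p =o s"
    using assms p by (cases rule: ord_cases) (auto simp: ord_covers_def)
  moreover have "r \<noteq> {}"
    using assms ordLess_imp_nonempty by (auto simp: ord_covers_def)
  moreover have "iter_derived X r = nonisolated_points X (iter_derived X p)"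
    using assms \<open>r \<noteq> {}\<close> unfolding p_def by (subst iter_derived_unfold) auto
  ultimately show ?thesis
    using iter_derived_ordIso by metis
qed

lemma iter_derived_limit:
  fixes r :: "'b rel"
  assumes "r \<noteq> {}" "\<nexists>s. ord_covers s r"
  shows "iter_derived X r = (\<Inter>s\<in>{s :: 'b rel. s <o r}. iter_derived X s)"
  by (subst iter_derived_unfold) (simp only: assms if_False)

lemma iter_derived_less:
  fixes r s :: "'b rel"
  assumes "s <o r"
  shows "iter_derived X r \<subseteq> nonisolated_points X (iter_derived X s)"
  using assms
proof (induction r rule: wf_induct_rule[OF wf_ordLess])
  case (1 r)
  show ?case
  proof (cases "\<exists>p. ord_covers p r")
    case True
    then obtain p where p: "ord_covers p r" by blast
    then have r: "iter_derived X r = nonisolated_points X (iter_derived X p)"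
      by (rule iter_derived_succ)
    have "Well_order s" "Well_order p"
      using p 1(2) by (auto simp: ord_covers_def ordLess_def)
    then consider "s <o p" | "s =o p" | "p <o s"
      by (rule ord_cases)
    then show ?thesis
    proof cases
      case 1
      then show ?thesis
        using "1.IH"[of p] p r by (auto simp: ord_covers_def nonisolated_points_def)
    next
      case 2
      then show ?thesis using r iter_derived_ordIso[OF 2, of X] by simp
    next
      case 3
      then show ?thesis using p 1(2) by (auto simp: ord_covers_def)
    qed
  next
    case False
    then obtain t :: "'b rel" where t: "s <o t" "t <o r"
      using 1(2) unfolding ord_covers_def by blast
    have "iter_derived X r \<subseteq> iter_derived X t"
      unfolding iter_derived_limit[OF ordLess_imp_nonempty[OF t(2)] False]
      using t(2) by blast
    then show ?thesis
      using "1.IH"[OF t(2) t(1)] by blast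
  qed
qed

lemma iter_derived_subset:
  fixes r :: "'b rel"
  assumes "Well_order r"
  shows "iter_derived X r \<subseteq> topspace X"
proof (cases "r = {}")
  case False
  have "Well_order ({} :: 'b rel)"
    by (simp add: order_on_defs refl_on_def trans_def antisym_def total_on_def wf_def Field_def)
  then have "({} :: 'b rel) <o r"
    using assms
  proof (rule ord_cases)
    assume "({} :: 'b rel) =o r"
    then show ?thesis using False ordIso_imp_empty_iff by blast
  next
    assume "r <o ({} :: 'b rel)"
    then show ?thesis using ordLess_imp_nonempty by blast
  qed
  then have "iter_derived X r \<subseteq> nonisolated_points X (iter_derived X ({} :: 'b rel))"
    by (rule iter_derived_less)
  then show ?thesis
    unfolding iter_derived_zero nonisolated_points_def by blast
qed (simp add: iter_derived_zero)

section \<open>Scatteredness index and compact scatteredness rank\<close>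

text \<open>
  Ordinals are represented here by well-orders on \<open>'a set\<close>. This type is large enough: if
  \<open>X\<close> is scattered, choosing an isolated point of \<open>X\<^sup>(\<^sup>\<beta>\<^sup>)\<close> for every \<open>\<beta> < i(X)\<close> shows that the
  ordinal \<open>i(X)\<close> has cardinality at most \<open>|UNIV :: 'a set|\<close>; hence \<open>i(X)\<close> and \<open>r(X)\<close> do not
  exceed \<open>|UNIV :: 'a set set|\<close>. The lemmas \<open>scatteredness_index\<close> and
  \<open>compact_scatteredness_rank\<close> show that the choices
  are well defined.
\<close>

definition scatteredness_index :: "'a topology \<Rightarrow> 'a set rel" where
  "scatteredness_index X = (SOME r. Well_order r \<and> finite (iter_derived X r) \<and>
     (\<forall>s :: 'a set rel. Well_order s \<and> finite (iter_derived X s) \<longrightarrow> r \<le>o s))"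

definition compact_scatteredness_rank :: "'a topology \<Rightarrow> 'a set rel" where
  "compact_scatteredness_rank X = (SOME r. Well_order r \<and>
     (\<forall>K. compactin X K \<and> scattered_space (subtopology X K) \<longrightarrow>
          scatteredness_index (subtopology X K) \<le>o r) \<and>
     (\<forall>s :: 'a set rel. Well_order s \<and>
          (\<forall>K. compactin X K \<and> scattered_space (subtopology X K) \<longrightarrow>
               scatteredness_index (subtopology X K) \<le>o s) \<longrightarrow> r \<le>o s))"

lemma card_of_Field_le_of_infinite_iter_derived:
  fixes X :: "'a topology" and r :: "'b rel"
  assumes "scattered_space X" "Well_order r"
    and inf: "\<And>s :: 'b rel. s <o r \<Longrightarrow> infinite (iter_derived X s)"
  shows "|Field r| \<le>o |UNIV :: 'a set|"
proof -
  define seg where "seg u = Restr r (underS r u)" for u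
  have seg_less: "seg u <o r" if "u \<in> Field r" for u
    unfolding seg_def using that by (intro underS_Restr_ordLess[OF assms(2)]) auto
  have seg_mono: "seg u <o seg v" if "u \<in> underS r v" "v \<in> Field r" for u v
  proof -
    have "u \<in> Field r" "(u, v) \<in> r" "u \<noteq> v"
      using that by (auto simp: underS_def Field_def)
    moreover have "Linear_order r"
      using assms(2) by (simp add: well_order_on_def)
    moreover have "(v, u) \<notin> r"
      using \<open>Linear_order r\<close> \<open>(u, v) \<in> r\<close> \<open>u \<noteq> v\<close>
      by (auto simp: order_on_defs antisym_def)
    ultimately have "underS r u \<subset> underS r v"
      using that underS_incl_iff[of r u v] underS_incl_iff[of r v u] by blast
    then show ?thesis
      unfolding seg_def using assms(2)
      by (subst ofilter_subset_ordLess[symmetric]) (auto intro: wo_rel.underS_ofilter simp: wo_rel_def)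
  qed
  have "\<exists>x. x \<in> iter_derived X (seg u) \<and> isolated_point X (iter_derived X (seg u)) x"
    if "u \<in> Field r" for u
  proof -
    have "iter_derived X (seg u) \<noteq> {}"
      using inf[OF seg_less[OF that]] by auto
    then show ?thesis
      using assms(1) iter_derived_subset[of "seg u" X] seg_less[OF that]
      unfolding ordLess_def scattered_space_def by blast
  qed
  then obtain p where p: "\<And>u. u \<in> Field r \<Longrightarrow> p u \<in> iter_derived X (seg u)"
    "\<And>u. u \<in> Field r \<Longrightarrow> isolated_point X (iter_derived X (seg u)) (p u)"
    by metis
  have neq: "p u \<noteq> p v" if "u \<in> underS r v" "v \<in> Field r" for u v
  proof -
    have "u \<in> Field r"
      using that(1) by (auto simp: underS_def Field_def)
    have "p v \<in> nonisolated_points X (iter_derived X (seg u))"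
      using iter_derived_less[OF seg_mono[OF that], of X] p(1)[OF that(2)] by blast
    then show ?thesis
      using p(2)[OF \<open>u \<in> Field r\<close>] by (auto simp: nonisolated_points_def)
  qed
  have "inj_on p (Field r)"
  proof (rule inj_onI, rule ccontr)
    fix u v assume uv: "u \<in> Field r" "v \<in> Field r" "p u = p v" "u \<noteq> v"
    then have "u \<in> underS r v \<or> v \<in> underS r u"
      using assms(2) wo_rel.TOTALS[of r] by (auto simp: underS_def wo_rel_def)
    then show False
      using neq uv by metis
  qed
  then show ?thesis
    by (auto simp flip: card_of_ordLeq)
qed

lemma scatteredness_index:
  fixes X :: "'a topology"
  assumes "scattered_space X"
  shows "Well_order (scatteredness_index X)"
    and "finite (iter_derived X (scatteredness_index X))"
    and "\<And>s :: 'a set rel. Well_order s \<Longrightarrow> finite (iter_derived X s) \<Longrightarrow> scatteredness_index X \<le>o s"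
    and "scatteredness_index X \<le>o |UNIV :: 'a set set|"
proof -
  let ?R = "{r :: 'a set rel. Well_order r \<and> finite (iter_derived X r)}"
  let ?U = "|UNIV :: 'a set set|"
  have U: "\<exists>s :: 'a set rel. s \<le>o ?U \<and> s \<in> ?R"
  proof (rule ccontr)
    assume "\<not> ?thesis"
    then have inf: "infinite (iter_derived X s)" if "s <o ?U" for s :: "'a set rel"
      using that ordLess_imp_ordLeq by (auto simp: ordLess_def)
    have "|Field ?U| \<le>o |UNIV :: 'a set|"
      using inf by (rule card_of_Field_le_of_infinite_iter_derived[OF assms card_of_Well_order])
    then show False
      using card_of_Pow[of "UNIV :: 'a set"] not_ordLess_ordLeq by (auto simp: Field_card_of)
  qed
  then have "\<exists>r\<in>?R. \<forall>s\<in>?R. r \<le>o s"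
    by (intro exists_minim_Well_order) auto
  then have "\<exists>r :: 'a set rel. Well_order r \<and> finite (iter_derived X r) \<and>
     (\<forall>s :: 'a set rel. Well_order s \<and> finite (iter_derived X s) \<longrightarrow> r \<le>o s)"
    by auto
  from someI_ex[OF this, folded scatteredness_index_def]
  show "Well_order (scatteredness_index X)"
    and "finite (iter_derived X (scatteredness_index X))"
    and least: "\<And>s :: 'a set rel. Well_order s \<Longrightarrow> finite (iter_derived X s) \<Longrightarrow> scatteredness_index X \<le>o s"
    by auto
  from U least show "scatteredness_index X \<le>o ?U"
    using ordLeq_transitive by blast
qed

lemma compact_scatteredness_rank:
  fixes X :: "'a topology"
  shows "Well_order (compact_scatteredness_rank X)"
    and "\<And>K. compactin X K \<Longrightarrow> scattered_space (subtopology X K) \<Longrightarrow>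
           scatteredness_index (subtopology X K) \<le>o compact_scatteredness_rank X"
    and "\<And>s :: 'a set rel. Well_order s \<Longrightarrow>
           (\<And>K. compactin X K \<Longrightarrow> scattered_space (subtopology X K) \<Longrightarrow>
             scatteredness_index (subtopology X K) \<le>o s) \<Longrightarrow>
           compact_scatteredness_rank X \<le>o s"
proof -
  let ?ub = "\<lambda>s :: 'a set rel. \<forall>K. compactin X K \<and> scattered_space (subtopology X K) \<longrightarrow>
          scatteredness_index (subtopology X K) \<le>o s"
  have "?ub |UNIV|"
    using scatteredness_index(4) by blast
  then have "{s. Well_order s \<and> ?ub s} \<noteq> {}"
    using card_of_Well_order by blast
  then have "\<exists>r\<in>{s. Well_order s \<and> ?ub s}. \<forall>s\<in>{s. Well_order s \<and> ?ub s}. r \<le>o s"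
    by (rule exists_minim_Well_order) simp
  then have "\<exists>r. Well_order r \<and> ?ub r \<and> (\<forall>s. Well_order s \<and> ?ub s \<longrightarrow> r \<le>o s)"
    by blast
  note rank = someI_ex[OF this, folded compact_scatteredness_rank_def]
  note * = conjunct1[OF rank] conjunct1[OF conjunct2[OF rank]] conjunct2[OF conjunct2[OF rank]]
  show "Well_order (compact_scatteredness_rank X)"
    by (rule *)
  show "scatteredness_index (subtopology X K) \<le>o compact_scatteredness_rank X"
    if "compactin X K" "scattered_space (subtopology X K)" for K
    using *(2) that by simp
  show "compact_scatteredness_rank X \<le>o s"
    if "Well_order s" and "\<And>K. compactin X K \<Longrightarrow> scattered_space (subtopology X K) \<Longrightarrow>
             scatteredness_index (subtopology X K) \<le>o s" for s :: "'a set rel"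
    using *(3) that by simp
qed

end

theory Submission
  imports Defs
begin

text \<open>
  If no compact set absorbs a neighbourhood of the unit, then every compact set is avoided by a
  sequence converging to the unit; otherwise the group is first countable and hence metrizable
  (Birkhoff-Kakutani). A group with such sequences in which a member of the metrizable cover failed
  to be locally compact would not be sequential. So the group has an open \<open>\<sigma>\<close>-compact subgroup \<open>H\<close>
  whose topology is determined by countably many compact sets, all of them zero-dimensional and
  metrizable, and the group is homeomorphic to the product of \<open>H\<close> with a discrete space whose size
  is controlled by the density.

  For two such subgroups a back-and-forth argument reduces the theorem to extending an embedding
  \<open>f : A \<rightarrow> H'\<close> to a compact \<open>B \<supseteq> A\<close>. Cut \<open>B - A\<close> into clopen pieces shrinking towards points
  \<open>a\<close> of \<open>A\<close> and put each piece into a small set \<open>f a \<otimes> t \<otimes> V\<close>, with \<open>t\<close> close to the unit but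
  avoiding a compact set, so that the images stay disjoint. The pieces embed into \<open>V\<close> either because
  \<open>H'\<close> contains a Cantor set, or because all compact sets are scattered and a compact set of index
  \<open>\<alpha>\<close> with one top point embeds near every point of the \<open>\<alpha>\<close>-th derived set. The same extension
  argument shows that the rank is never attained, and that groups with and without perfect compact
  subsets have different ranks.
\<close>

text \<open>Extending an embedding beyond \<open>A\<close> needs room: translates
  \<open>f a \<otimes> t \<otimes> V\<close> must miss the image of \<open>A\<close> although
  \<open>t\<close> is close to the unit. It suffices that \<open>t\<close> avoids the compact set of
  all quotients \<open>inv (f a) \<otimes> f b\<close>, and sequences that tend to the unit outside
  a given compact set are what non-metrizability supplies. In the scattered case the target must
  also hold a model for \<open>B\<close>: a compact set whose derived set at the index of
  \<open>B\<close> is nonempty. This is why the rank has to exceed every index strictly; equal ranks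
  then put a model into the other group. Strictness comes from embedding countably many copies of a
  compact set that converge to a point. Such sums are formed in the Cantor space, a type common to
  both groups. The ranks of the two groups are ordinals over different types, so derived sets are
  indexed by well-orders over arbitrary types. Separable groups need a case of their own, because
  there the density does not determine the number of cosets of an open subgroup.\<close>

lemma continuous_map_subtopology_pointwiseI:
  assumes "A \<subseteq> topspace X"
    and "\<And>x. x \<in> A \<Longrightarrow> f x \<in> topspace Y"
    and "\<And>x V. x \<in> A \<Longrightarrow> openin Y V \<Longrightarrow> f x \<in> V \<Longrightarrow>
           \<exists>W. openin X W \<and> x \<in> W \<and> (\<forall>y\<in>A. y \<in> W \<longrightarrow> f y \<in> V)"
  shows "continuous_map (subtopology X A) Y f"
proof -
  have top: "topspace (subtopology X A) = A"
    using assms(1) by auto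
  have "openin (subtopology X A) {x \<in> A. f x \<in> V}" if V: "openin Y V" for V
  proof (subst openin_subopen, clarify)
    fix x assume x: "x \<in> A" "f x \<in> V"
    then obtain W where W: "openin X W" "x \<in> W" "\<forall>y\<in>A. y \<in> W \<longrightarrow> f y \<in> V"
      using assms(3)[OF x(1) V x(2)] by blast
    have "openin (subtopology X A) (A \<inter> W)"
      using W(1) by (rule openin_subtopology_Int2)
    then show "\<exists>U. openin (subtopology X A) U \<and> x \<in> U \<and> U \<subseteq> {x \<in> A. f x \<in> V}"
      using W x by (intro exI[of _ "A \<inter> W"]) auto
  qed
  then show ?thesis
    using assms(2) unfolding continuous_map top by auto
qed

lemma continuous_map_subtopology_nbhd:
  assumes "continuous_map (subtopology X A) Y f" "A \<subseteq> topspace X" "x \<in> A" "openin Y V" "f x \<in> V"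
  obtains W where "openin X W" "x \<in> W" "\<And>y. y \<in> A \<Longrightarrow> y \<in> W \<Longrightarrow> f y \<in> V"
proof -
  have "topspace (subtopology X A) = A"
    using assms(2) by auto
  then have "openin (subtopology X A) {y \<in> A. f y \<in> V}"
    using assms(1,4) unfolding continuous_map by simp
  then obtain W where "openin X W" "{y \<in> A. f y \<in> V} = W \<inter> A"
    unfolding openin_subtopology by auto
  then show ?thesis
    using that[of W] assms(3,5) by blast
qed

section \<open>Metrization of first countable groups\<close>

text \<open>Cut the chain at the last index \<open>m\<close> whose initial part carries at most half
  of the total. The part after \<open>Suc m\<close> then also carries at most half, so by induction
  \<open>f\<close> between the ends of either part is at most the total, as is the single edge
  between the parts; the three-term inequality costs the factor 2.\<close>

lemma frink_chain:
  fixes f :: "'a \<Rightarrow> 'a \<Rightarrow> real"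
  assumes p: "\<And>k. p k \<in> S"
    and nonneg: "\<And>x y. x \<in> S \<Longrightarrow> y \<in> S \<Longrightarrow> 0 \<le> f x y"
    and refl: "\<And>x. x \<in> S \<Longrightarrow> f x x = 0"
    and tri: "\<And>x y z w. x \<in> S \<Longrightarrow> y \<in> S \<Longrightarrow> z \<in> S \<Longrightarrow> w \<in> S \<Longrightarrow>
                f x w \<le> 2 * max (f x y) (max (f y z) (f z w))"
  shows "i \<le> j \<Longrightarrow> f (p i) (p j) \<le> 2 * (\<Sum>k=i..<j. f (p k) (p (Suc k)))"
proof (induction "j - i" arbitrary: i j rule: less_induct)
  case less
  define s where "s i j = (\<Sum>k=i..<j. f (p k) (p (Suc k)))" for i j
  have s_nonneg: "0 \<le> s i j" for i j
    unfolding s_def using nonneg p by (intro sum_nonneg) auto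
  have s_split: "s i j = s i m + s m j" if "i \<le> m" "m \<le> j" for i m j
    unfolding s_def using that by (simp add: sum.atLeastLessThan_concat)
  show ?case
  proof (cases "i = j")
    case True
    then show ?thesis using refl p by simp
  next
    case False
    then have "i < j" using less.prems by simp
    let ?P = "\<lambda>m. i \<le> m \<and> m < j \<and> s i m \<le> s i j / 2"
    have "?P i"
      using \<open>i < j\<close> s_nonneg[of i j] by (simp add: s_def)
    moreover have "\<And>m. ?P m \<Longrightarrow> m \<le> j" by simp
    ultimately obtain m where m: "?P m" and greatest: "\<And>m'. ?P m' \<Longrightarrow> m' \<le> m"
      using GreatestI_nat[of ?P i j] Greatest_le_nat[of ?P _ j] by blast
    have tail: "s (Suc m) j \<le> s i j / 2"
    proof (cases "Suc m = j")
      case True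
      then show ?thesis using s_nonneg by (simp add: s_def)
    next
      case False
      then have "\<not> ?P (Suc m)" using greatest[of "Suc m"] by auto
      then have "s i (Suc m) > s i j / 2"
        using m False by auto
      moreover have "s i j = s i (Suc m) + s (Suc m) j"
        using m by (intro s_split) auto
      ultimately show ?thesis by simp
    qed
    have "s m (Suc m) = f (p m) (p (Suc m))"
      by (simp add: s_def)
    moreover have "s i j = s i m + s m (Suc m) + s (Suc m) j"
      using m s_split[of i m j] s_split[of m "Suc m" j] by simp
    ultimately have edge: "f (p m) (p (Suc m)) \<le> s i j"
      using s_nonneg[of i m] s_nonneg[of "Suc m" j] by simp
    have "m - i < j - i" "j - Suc m < j - i"
      using m by linarith+
    then have "f (p i) (p m) \<le> 2 * s i m" "f (p (Suc m)) (p j) \<le> 2 * s (Suc m) j"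
      using less.hyps[of m i] less.hyps[of j "Suc m"] m by (simp_all add: s_def)
    then have "max (f (p i) (p m)) (max (f (p m) (p (Suc m))) (f (p (Suc m)) (p j))) \<le> s i j"
      using m tail edge by auto
    then have "f (p i) (p j) \<le> 2 * s i j"
      using tri[OF p p p p, of i j m "Suc m"] by linarith
    then show ?thesis by (simp add: s_def)
  qed
qed

text \<open>\<open>d\<close> is the infimum of the sums of \<open>f\<close> along chains, which
  forces the triangle inequality. The chain estimate bounds it below by half of \<open>f\<close>, so
  it still separates points and has the same balls up to a factor 2.\<close>

lemma frink_metric:
  fixes f :: "'a \<Rightarrow> 'a \<Rightarrow> real"
  assumes nonneg: "\<And>x y. x \<in> S \<Longrightarrow> y \<in> S \<Longrightarrow> 0 \<le> f x y"
    and zero: "\<And>x y. x \<in> S \<Longrightarrow> y \<in> S \<Longrightarrow> f x y = 0 \<longleftrightarrow> x = y"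
    and sym: "\<And>x y. x \<in> S \<Longrightarrow> y \<in> S \<Longrightarrow> f x y = f y x"
    and tri: "\<And>x y z w. x \<in> S \<Longrightarrow> y \<in> S \<Longrightarrow> z \<in> S \<Longrightarrow> w \<in> S \<Longrightarrow>
                f x w \<le> 2 * max (f x y) (max (f y z) (f z w))"
  obtains d where "Metric_space S d"
    and "\<And>x y. x \<in> S \<Longrightarrow> y \<in> S \<Longrightarrow> d x y \<le> f x y"
    and "\<And>x y. x \<in> S \<Longrightarrow> y \<in> S \<Longrightarrow> f x y \<le> 2 * d x y"
proof -
  define C where "C x y = {(\<Sum>k<n. f (p k) (p (Suc k))) | p n. (\<forall>k. p k \<in> S) \<and> p 0 = x \<and> p n = y}" for x y
  \<comment> \<open>The value 0 off \<open>S\<close> serves those axioms of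
    \<open>Metric_space\<close> that range over all points.\<close>
  define d where "d x y = (if x \<in> S \<and> y \<in> S then Inf (C x y) else 0)" for x y
  have C_nonneg: "0 \<le> c" if "c \<in> C x y" for c x y
    using that nonneg unfolding C_def by (auto intro!: sum_nonneg)
  have bdd: "bdd_below (C x y)" for x y
    using C_nonneg by (intro bdd_belowI[of _ 0])
  have edge: "f x y \<in> C x y" if "x \<in> S" "y \<in> S" for x y
    unfolding C_def using that
    by (intro CollectI exI[of _ "\<lambda>k. if k = 0 then x else y"] exI[of _ "1::nat"]) auto
  have half: "f x y / 2 \<le> c" if c: "c \<in> C x y" for c x y
  proof -
    obtain p n where "\<forall>k. p k \<in> S" "p 0 = x" "p n = y" "c = (\<Sum>k<n. f (p k) (p (Suc k)))"
      using c unfolding C_def by blast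
    moreover have "f (p 0) (p n) \<le> 2 * (\<Sum>k=0..<n. f (p k) (p (Suc k)))"
      using calculation nonneg zero tri by (intro frink_chain) auto
    ultimately show ?thesis by (simp add: atLeast0LessThan)
  qed
  have rev: "c \<in> C y x" if c: "c \<in> C x y" for c x y
  proof -
    obtain p n where p: "\<forall>k. p k \<in> S" "p 0 = x" "p n = y" "c = (\<Sum>k<n. f (p k) (p (Suc k)))"
      using c unfolding C_def by blast
    have "c = (\<Sum>k<n. f (p (n - k)) (p (n - Suc k)))"
      unfolding p(4)
      by (rule sum.reindex_bij_witness[of _ "\<lambda>k. n - Suc k" "\<lambda>k. n - Suc k"])
         (auto simp: sym p(1) Suc_diff_Suc)
    then show ?thesis
      unfolding C_def using p by (intro CollectI exI[of _ "\<lambda>k. p (n - k)"] exI[of _ n]) auto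
  qed
  have cat: "a + b \<in> C x z" if a: "a \<in> C x y" and b: "b \<in> C y z" for a b x y z
  proof -
    obtain p n where p: "\<forall>k. p k \<in> S" "p 0 = x" "p n = y" "a = (\<Sum>k<n. f (p k) (p (Suc k)))"
      using a unfolding C_def by blast
    obtain q m where q: "\<forall>k. q k \<in> S" "q 0 = y" "q m = z" "b = (\<Sum>k<m. f (q k) (q (Suc k)))"
      using b unfolding C_def by blast
    define r where "r k = (if k < n then p k else q (k - n))" for k
    have "(\<Sum>k<n+m. f (r k) (r (Suc k))) = (\<Sum>k<n. f (r k) (r (Suc k))) + (\<Sum>k=n..<n+m. f (r k) (r (Suc k)))"
      by (simp add: lessThan_atLeast0 sum.atLeastLessThan_concat)
    also have "(\<Sum>k<n. f (r k) (r (Suc k))) = a"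
    proof -
      have "r (Suc k) = p (Suc k)" if "k < n" for k
        using that p(3) q(2) by (cases "Suc k = n") (auto simp: r_def)
      then show ?thesis
        unfolding p(4) by (intro sum.cong) (auto simp: r_def)
    qed
    also have "(\<Sum>k=n..<n+m. f (r k) (r (Suc k))) = (\<Sum>k<m. f (r (k + n)) (r (Suc (k + n))))"
      using sum.shift_bounds_nat_ivl[of "\<lambda>k. f (r k) (r (Suc k))" 0 n m]
      by (simp add: atLeast0LessThan add.commute)
    also have "\<dots> = b"
      unfolding q(4) by (intro sum.cong) (auto simp: r_def Suc_diff_le)
    finally have "a + b = (\<Sum>k<n+m. f (r k) (r (Suc k)))" by simp
    moreover have "r 0 = x" "r (n+m) = z" "\<And>k. r k \<in> S"
      using p q by (auto simp: r_def)
    ultimately show ?thesis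
      unfolding C_def by blast
  qed
  have d_le: "d x y \<le> f x y" and f_le: "f x y \<le> 2 * d x y" if "x \<in> S" "y \<in> S" for x y
  proof -
    show "d x y \<le> f x y"
      using that edge[OF that] bdd by (simp add: d_def cInf_lower)
    have "f x y / 2 \<le> Inf (C x y)"
      using edge[OF that] half by (intro cInf_greatest) auto
    then show "f x y \<le> 2 * d x y"
      using that by (simp add: d_def)
  qed
  have "Metric_space S d"
  proof
    show "0 \<le> d x y" for x y
    proof (cases "x \<in> S \<and> y \<in> S")
      case True
      then have "C x y \<noteq> {}" using edge by blast
      then show ?thesis using True C_nonneg by (simp add: d_def cInf_greatest)
    qed (auto simp: d_def)
    have "C x y = C y x" for x y
      using rev by (intro equalityI subsetI)
    then show "d x y = d y x" for x y by (simp add: d_def)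
    show "d x y = 0 \<longleftrightarrow> x = y" if "x \<in> S" "y \<in> S" for x y
      using d_le[OF that] f_le[OF that] zero[OF that] nonneg[OF that] \<open>0 \<le> d x y\<close> by auto
    show "d x z \<le> d x y + d y z" if "x \<in> S" and y: "y \<in> S" and "z \<in> S" for x y z
    proof (rule field_le_epsilon)
      fix e :: real assume "0 < e"
      have "Inf (C x y) < d x y + e/2" "Inf (C y z) < d y z + e/2"
        using that \<open>0 < e\<close> by (simp_all add: d_def)
      moreover have "C x y \<noteq> {}" "C y z \<noteq> {}"
        using edge[of x y] edge[of y z] that by blast+
      ultimately obtain a b where "a \<in> C x y" "a < d x y + e/2" "b \<in> C y z" "b < d y z + e/2"
        by (meson cInf_lessD)
      moreover have "d x z \<le> a + b"
        using that bdd cat[OF \<open>a \<in> C x y\<close> \<open>b \<in> C y z\<close>] by (simp add: d_def cInf_lower)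
      ultimately show "d x z \<le> d x y + d y z + e" by simp
    qed
  qed
  then show ?thesis
    using d_le f_le by (rule that)
qed

lemma frink_metrizable:
  fixes f :: "'a \<Rightarrow> 'a \<Rightarrow> real"
  assumes nonneg: "\<And>x y. x \<in> S \<Longrightarrow> y \<in> S \<Longrightarrow> 0 \<le> f x y"
    and zero: "\<And>x y. x \<in> S \<Longrightarrow> y \<in> S \<Longrightarrow> f x y = 0 \<longleftrightarrow> x = y"
    and sym: "\<And>x y. x \<in> S \<Longrightarrow> y \<in> S \<Longrightarrow> f x y = f y x"
    and tri: "\<And>x y z w. x \<in> S \<Longrightarrow> y \<in> S \<Longrightarrow> z \<in> S \<Longrightarrow> w \<in> S \<Longrightarrow>
                f x w \<le> 2 * max (f x y) (max (f y z) (f z w))"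
    and openin: "\<And>U. openin T U \<longleftrightarrow> U \<subseteq> S \<and> (\<forall>x\<in>U. \<exists>r>0. \<forall>y\<in>S. f x y < r \<longrightarrow> y \<in> U)"
  shows "metrizable_space T"
proof (rule frink_metric[of S f])
  fix d
  assume ms: "Metric_space S d"
    and d_le: "\<And>x y. x \<in> S \<Longrightarrow> y \<in> S \<Longrightarrow> d x y \<le> f x y"
    and f_le: "\<And>x y. x \<in> S \<Longrightarrow> y \<in> S \<Longrightarrow> f x y \<le> 2 * d x y"
  have eq: "(\<exists>r>0. \<forall>y\<in>S. f x y < r \<longrightarrow> y \<in> U) \<longleftrightarrow> (\<exists>r>0. \<forall>y\<in>S. d x y < r \<longrightarrow> y \<in> U)"
    if x: "x \<in> S" for x U
  proof
    assume "\<exists>r>0. \<forall>y\<in>S. f x y < r \<longrightarrow> y \<in> U"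
    then obtain r where r: "r > 0" "\<forall>y\<in>S. f x y < r \<longrightarrow> y \<in> U" by blast
    have "y \<in> U" if "y \<in> S" "d x y < r / 2" for y
      using r that f_le[OF x that(1)] by auto
    then show "\<exists>r>0. \<forall>y\<in>S. d x y < r \<longrightarrow> y \<in> U"
      using r(1) half_gt_zero by blast
  next
    assume "\<exists>r>0. \<forall>y\<in>S. d x y < r \<longrightarrow> y \<in> U"
    then obtain r where r: "r > 0" "\<forall>y\<in>S. d x y < r \<longrightarrow> y \<in> U" by blast
    have "y \<in> U" if "y \<in> S" "f x y < r" for y
      using r that d_le[OF x that(1)] by auto
    then show "\<exists>r>0. \<forall>y\<in>S. f x y < r \<longrightarrow> y \<in> U"
      using r(1) by blast
  qed
  have "openin T U \<longleftrightarrow> openin (Metric_space.mtopology S d) U" for U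
  proof -
    have "openin (Metric_space.mtopology S d) U \<longleftrightarrow> U \<subseteq> S \<and> (\<forall>x\<in>U. \<exists>r>0. \<forall>y\<in>S. d x y < r \<longrightarrow> y \<in> U)"
      unfolding Metric_space.openin_mtopology[OF ms] Metric_space.mball_def[OF ms] by blast
    moreover have "(\<forall>x\<in>U. \<exists>r>0. \<forall>y\<in>S. f x y < r \<longrightarrow> y \<in> U) \<longleftrightarrow> (\<forall>x\<in>U. \<exists>r>0. \<forall>y\<in>S. d x y < r \<longrightarrow> y \<in> U)"
      if "U \<subseteq> S"
      using that by (intro ball_cong refl eq) blast
    ultimately show ?thesis
      using openin[of U] by blast
  qed
  then have "T = Metric_space.mtopology S d"
    by (simp add: topology_eq)
  then show ?thesis
    using Metric_space.metrizable_space_mtopology[OF ms] by simp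
qed (rule nonneg zero sym tri; assumption)+

section \<open>Topological groups with closed points\<close>

text \<open>Closed points are what a cover by closed metrizable subspaces gives at once; the
  Hausdorff property is derived afterwards from the group structure.\<close>

locale t1_group = group G for G :: "('a, 'm) monoid_scheme" (structure) +
  fixes T :: "'a topology"
  assumes topspace_eq [simp]: "topspace T = carrier G"
    and continuous_mult: "continuous_map (prod_topology T T) T (\<lambda>(x, y). x \<otimes> y)"
    and continuous_inv: "continuous_map T T (\<lambda>x. inv x)"
    and t1: "t1_space T"
begin

lemma inv_mult_cancel [simp]:
  assumes "x \<in> carrier G" "y \<in> carrier G"
  shows "inv x \<otimes> (x \<otimes> y) = y" "x \<otimes> (inv x \<otimes> y) = y"
  using assms by (simp_all flip: m_assoc)

lemma continuous_map_mult:
  assumes "continuous_map X T f" "continuous_map X T g"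
  shows "continuous_map X T (\<lambda>x. f x \<otimes> g x)"
  using continuous_map_compose[OF continuous_map_pairedI[OF assms] continuous_mult]
  by (simp add: o_def)

lemma continuous_map_inv:
  assumes "continuous_map X T f"
  shows "continuous_map X T (\<lambda>x. inv (f x))"
  using continuous_map_compose[OF assms continuous_inv] by (simp add: o_def)

lemma continuous_map_constI: "c \<in> carrier G \<Longrightarrow> continuous_map X T (\<lambda>x. c)"
  by simp

lemma limitin_mult:
  assumes "limitin T f a F" "limitin T g b F"
  shows "limitin T (\<lambda>x. f x \<otimes> g x) (a \<otimes> b) F"
proof -
  have "limitin (prod_topology T T) (\<lambda>x. (f x, g x)) (a, b) F"
    using assms by (simp add: limitin_pairwise o_def)
  from continuous_map_limit[OF continuous_mult this] show ?thesis
    by (simp add: o_def)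
qed

lemma limitin_inv:
  assumes "limitin T f a F"
  shows "limitin T (\<lambda>x. inv (f x)) (inv a) F"
  using continuous_map_limit[OF continuous_inv assms] by (simp add: o_def)

lemma mult_nbhd:
  assumes "openin T U" "x \<otimes> y \<in> U" "x \<in> carrier G" "y \<in> carrier G"
  obtains V W where "openin T V" "openin T W" "x \<in> V" "y \<in> W" "\<And>v w. v \<in> V \<Longrightarrow> w \<in> W \<Longrightarrow> v \<otimes> w \<in> U"
proof -
  let ?P = "{z \<in> topspace (prod_topology T T). (\<lambda>(x, y). x \<otimes> y) z \<in> U}"
  have P: "openin (prod_topology T T) ?P"
    using continuous_mult assms(1) unfolding continuous_map by blast
  have xy: "(x, y) \<in> ?P"
    using assms by simp
  from P[unfolded openin_prod_topology_alt, rule_format, OF xy]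
  obtain V W where VW: "openin T V" "openin T W" "x \<in> V" "y \<in> W" "V \<times> W \<subseteq> ?P"
    by (elim exE conjE)
  have "v \<otimes> w \<in> U" if "v \<in> V" "w \<in> W" for v w
    using subsetD[OF VW(5), of "(v, w)"] that by simp
  then show ?thesis
    by (rule that[OF VW(1-4)])
qed

lemma openin_translate_preimage:
  assumes "openin T U" "a \<in> carrier G"
  shows "openin T {x \<in> carrier G. a \<otimes> x \<in> U}"
  using continuous_map_mult[OF continuous_map_constI[OF assms(2)] continuous_map_id] assms(1)
  unfolding continuous_map by simp

lemma openin_right_translate_preimage:
  assumes "openin T U" "a \<in> carrier G"
  shows "openin T {x \<in> carrier G. x \<otimes> a \<in> U}"
  using continuous_map_mult[OF continuous_map_id continuous_map_constI[OF assms(2)]] assms(1)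
  unfolding continuous_map by simp

lemma openin_inv_preimage:
  assumes "openin T U"
  shows "openin T {x \<in> carrier G. inv x \<in> U}"
  using continuous_inv assms(1) unfolding continuous_map by simp

text \<open>If the product of the neighbourhoods \<open>V\<close> and \<open>W\<close> of the unit
  misses \<open>x \<otimes> inv y\<close>, then the translate of the inverse of \<open>V\<close> by
  \<open>x\<close> and that of \<open>W\<close> by \<open>y\<close> are disjoint: a common point
  \<open>z\<close> would give \<open>inv (z \<otimes> inv x) \<otimes> (z \<otimes> inv y) = x
  \<otimes> inv y\<close>.\<close>

lemma Hausdorff: "Hausdorff_space T"
  unfolding Hausdorff_space_def
proof (intro allI impI)
  fix x y assume "x \<in> topspace T \<and> y \<in> topspace T \<and> x \<noteq> y"
  then have xy: "x \<in> carrier G" "y \<in> carrier G" "x \<noteq> y" by auto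
  let ?q = "x \<otimes> inv y"
  have q: "?q \<noteq> \<one>"
    using xy by (metis inv_closed inv_equality inv_inv)
  have "openin T (carrier G - {?q})"
    using t1 xy by (metis t1_space_openin_delete_alt topspace_eq openin_topspace)
  moreover have "\<one> \<otimes> \<one> \<in> carrier G - {?q}"
    using q by simp
  ultimately obtain V W where VW: "openin T V" "openin T W" "\<one> \<in> V" "\<one> \<in> W"
      "\<And>v w. v \<in> V \<Longrightarrow> w \<in> W \<Longrightarrow> v \<otimes> w \<in> carrier G - {?q}"
    by (rule mult_nbhd) auto
  let ?A = "{z \<in> carrier G. z \<otimes> inv x \<in> {z \<in> carrier G. inv z \<in> V}}"
  let ?B = "{z \<in> carrier G. z \<otimes> inv y \<in> W}"
  have "openin T ?A" "openin T ?B"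
    using VW xy by (intro openin_right_translate_preimage openin_inv_preimage; simp)+
  moreover have "x \<in> ?A" "y \<in> ?B"
    using VW xy by auto
  moreover have "disjnt ?A ?B"
    unfolding disjnt_iff
  proof (intro allI notI, clarsimp)
    fix z assume z: "z \<in> carrier G" "inv (z \<otimes> inv x) \<in> V" "z \<otimes> inv y \<in> W"
    have "inv (z \<otimes> inv x) \<otimes> (z \<otimes> inv y) = ?q"
      using z(1) xy by (simp add: inv_mult_group m_assoc)
    then show False
      using VW(5)[OF z(2,3)] by simp
  qed
  ultimately show "\<exists>U V. openin T U \<and> openin T V \<and> x \<in> U \<and> y \<in> V \<and> disjnt U V"
    by blast
qed

text \<open>\<open>g z\<close> is (1/2)^m for the first \<open>m\<close> with \<open>z\<close>
  outside \<open>V m\<close>, so \<open>V n\<close> is the set where \<open>g\<close> is below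
  (1/2)^n. If three factors have \<open>g\<close> below half of (1/2)^m, they lie in
  \<open>V (Suc m)\<close> and their product in \<open>V m\<close>: the cube hypothesis is Frink's
  three-term inequality for the left invariant function
  \<open>g (inv x \<otimes> y)\<close>.\<close>

lemma birkhoff_kakutani:
  fixes V :: "nat \<Rightarrow> 'a set"
  assumes sub: "\<And>n. V n \<subseteq> carrier G" and one: "\<And>n. \<one> \<in> V n"
    and inv: "\<And>n x. x \<in> V n \<Longrightarrow> inv x \<in> V n"
    and cube: "\<And>n x y z. x \<in> V (Suc n) \<Longrightarrow> y \<in> V (Suc n) \<Longrightarrow> z \<in> V (Suc n) \<Longrightarrow> x \<otimes> (y \<otimes> z) \<in> V n"
    and nbhd: "\<And>n. \<exists>W. openin T W \<and> \<one> \<in> W \<and> W \<subseteq> V n"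
    and base: "\<And>W. openin T W \<Longrightarrow> \<one> \<in> W \<Longrightarrow> \<exists>n. V n \<subseteq> W"
  shows "metrizable_space T"
proof -
  have dec: "V (Suc n) \<subseteq> V n" for n
    using cube[OF _ one one] sub by fastforce
  have dec': "V n \<subseteq> V m" if "m \<le> n" for m n
    by (rule lift_Suc_antimono_le[of V, OF dec that])
  define g :: "'a \<Rightarrow> real" where
    "g z = (if \<forall>n. z \<in> V n then 0 else (1/2) ^ (LEAST n. z \<notin> V n))" for z
  have g_nonneg: "0 \<le> g z" for z by (simp add: g_def)
  have mem_iff: "z \<in> V n \<longleftrightarrow> g z < (1/2)^n" for z n
  proof (cases "\<forall>n. z \<in> V n")
    case False
    let ?m = "LEAST n. z \<notin> V n"
    have m: "z \<notin> V ?m" using LeastI_ex[of "\<lambda>n. z \<notin> V n"] False by blast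
    have "z \<in> V n \<longleftrightarrow> n < ?m"
    proof
      assume "z \<in> V n"
      then show "n < ?m"
        using m dec'[of ?m n] by (cases "?m \<le> n") auto
    next
      assume "n < ?m"
      then show "z \<in> V n"
        using not_less_Least[of n "\<lambda>n. z \<notin> V n"] by simp
    qed
    also have "\<dots> \<longleftrightarrow> (1/2::real) ^ ?m < (1/2)^n"
      by simp
    also have "(1/2) ^ ?m = g z"
      using False by (simp only: g_def if_False)
    finally show ?thesis .
  qed (simp add: g_def)
  have g_values: "g z = 0 \<or> (\<exists>m. g z = (1/2)^m)" for z
    by (auto simp: g_def)
  have g_zero: "g z = 0 \<longleftrightarrow> z = \<one>" if "z \<in> carrier G" for z
  proof
    assume 0: "g z = 0"
    show "z = \<one>"
    proof (rule ccontr)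
      assume "z \<noteq> \<one>"
      moreover have "openin T (carrier G - {z})"
        using t1 that by (metis t1_space_openin_delete_alt topspace_eq openin_topspace)
      ultimately obtain n where "V n \<subseteq> carrier G - {z}"
        using base by (metis DiffI one_closed singletonD)
      then show False
        using mem_iff[of z n] 0 by auto
    qed
  next
    assume "z = \<one>"
    then show "g z = 0" using one by (simp add: g_def)
  qed
  have g_inv: "g (inv z) = g z" if "z \<in> carrier G" for z
  proof -
    have "inv z \<in> V n \<longleftrightarrow> z \<in> V n" for n
      using inv[of z n] inv[of "inv z" n] that by auto
    then show ?thesis by (simp add: g_def)
  qed
  have g_cube: "g (a \<otimes> (b \<otimes> c)) \<le> 2 * max (g a) (max (g b) (g c))" for a b c
  proof (rule ccontr)
    assume "\<not> ?thesis"
    then have gt: "2 * max (g a) (max (g b) (g c)) < g (a \<otimes> (b \<otimes> c))" by simp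
    moreover have "0 \<le> max (g a) (max (g b) (g c))"
      using g_nonneg by (simp add: max.coboundedI1)
    ultimately have "g (a \<otimes> (b \<otimes> c)) \<noteq> 0"
      by linarith
    then obtain m where m: "g (a \<otimes> (b \<otimes> c)) = (1/2)^m"
      using g_values[of "a \<otimes> (b \<otimes> c)"] by blast
    then have "max (g a) (max (g b) (g c)) < (1/2) ^ Suc m"
      using gt unfolding m by simp
    then have "a \<in> V (Suc m)" "b \<in> V (Suc m)" "c \<in> V (Suc m)"
      unfolding mem_iff by auto
    from cube[OF this] show False
      unfolding mem_iff m by simp
  qed
  let ?f = "\<lambda>x y. g (inv x \<otimes> y)"
  have f_zero: "?f x y = 0 \<longleftrightarrow> x = y" if "x \<in> carrier G" "y \<in> carrier G" for x y
  proof -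
    have "inv x \<otimes> y = \<one> \<longleftrightarrow> x = y"
      using that inv_equality[of "inv x" y] by (metis inv_closed inv_inv l_inv)
    then show ?thesis
      using that g_zero[of "inv x \<otimes> y"] by simp
  qed
  have f_sym: "?f x y = ?f y x" if "x \<in> carrier G" "y \<in> carrier G" for x y
    using that g_inv[of "inv x \<otimes> y"] by (simp add: inv_mult_group)
  have f_tri: "?f x w \<le> 2 * max (?f x y) (max (?f y z) (?f z w))"
    if "x \<in> carrier G" "y \<in> carrier G" "z \<in> carrier G" "w \<in> carrier G" for x y z w
  proof -
    have "inv x \<otimes> w = (inv x \<otimes> y) \<otimes> ((inv y \<otimes> z) \<otimes> (inv z \<otimes> w))"
      using that by (simp add: m_assoc)
    then show ?thesis
      using g_cube by simp
  qed
  show ?thesis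
  proof (rule frink_metrizable[where S = "carrier G" and f = ?f])
    show "0 \<le> ?f x y" for x y by (rule g_nonneg)
    show "?f x y = 0 \<longleftrightarrow> x = y" if "x \<in> carrier G" "y \<in> carrier G" for x y
      using that by (rule f_zero)
    show "?f x y = ?f y x" if "x \<in> carrier G" "y \<in> carrier G" for x y
      using that by (rule f_sym)
    show "?f x w \<le> 2 * max (?f x y) (max (?f y z) (?f z w))"
      if "x \<in> carrier G" "y \<in> carrier G" "z \<in> carrier G" "w \<in> carrier G" for x y z w
      using that by (rule f_tri)
    show "openin T U \<longleftrightarrow> U \<subseteq> carrier G \<and> (\<forall>x\<in>U. \<exists>r>0. \<forall>y\<in>carrier G. ?f x y < r \<longrightarrow> y \<in> U)" for U
    proof (intro iffI conjI ballI)
      assume U: "openin T U"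
      then show sub_U: "U \<subseteq> carrier G"
        using openin_subset by force
      fix x assume "x \<in> U"
      then have x: "x \<in> carrier G" using sub_U by blast
      have "\<one> \<in> {z \<in> carrier G. x \<otimes> z \<in> U}"
        using x \<open>x \<in> U\<close> by simp
      from base[OF openin_translate_preimage[OF U x] this]
      obtain n where n: "V n \<subseteq> {z \<in> carrier G. x \<otimes> z \<in> U}" ..
      show "\<exists>r>0. \<forall>y\<in>carrier G. ?f x y < r \<longrightarrow> y \<in> U"
      proof (intro exI[of _ "(1/2)^n"] conjI ballI impI)
        fix y assume y: "y \<in> carrier G" "?f x y < (1/2)^n"
        then have "inv x \<otimes> y \<in> V n"
          unfolding mem_iff by simp
        then have "x \<otimes> (inv x \<otimes> y) \<in> U" using n by blast
        then show "y \<in> U" using x y by simp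
      qed simp
    next
      assume U: "U \<subseteq> carrier G \<and> (\<forall>x\<in>U. \<exists>r>0. \<forall>y\<in>carrier G. ?f x y < r \<longrightarrow> y \<in> U)"
      show "openin T U"
      proof (subst openin_subopen, intro ballI)
        fix x assume "x \<in> U"
        then obtain r where r: "r > 0" "\<And>y. y \<in> carrier G \<Longrightarrow> ?f x y < r \<Longrightarrow> y \<in> U" and x: "x \<in> carrier G"
          using U by (meson subsetD)
        obtain n where n: "(1/2::real)^n < r"
          using real_arch_pow_inv[OF r(1), of "1/2"] by auto
        obtain W where W: "openin T W" "\<one> \<in> W" "W \<subseteq> V n"
          using nbhd[of n] by (elim exE conjE)
        let ?N = "{y \<in> carrier G. inv x \<otimes> y \<in> W}"
        have "y \<in> U" if y: "y \<in> carrier G" "inv x \<otimes> y \<in> W" for y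
        proof -
          have "g (inv x \<otimes> y) < (1/2)^n"
            using y W mem_iff by (meson subsetD)
          then show ?thesis using r(2) y n by simp
        qed
        then have "?N \<subseteq> U" by blast
        moreover have "openin T ?N"
          using openin_translate_preimage[OF W(1), of "inv x"] x by simp
        moreover have "x \<in> ?N" using W x by simp
        ultimately show "\<exists>N. openin T N \<and> x \<in> N \<and> N \<subseteq> U"
          by meson
      qed
    qed
  qed
qed

end

section \<open>Sequences in groups covered by closed metrizable subspaces\<close>

text \<open>Points of \<open>Q\<close> chosen outside longer and longer initial unions meet each
  \<open>C k\<close> in a finite set. Every subset of their range is therefore closed, so the
  infinite range has no accumulation point, against compactness.\<close>

lemma compactin_countable_cover:
  fixes C :: "nat \<Rightarrow> 'a set"
  assumes t1: "t1_space X" and cover: "(\<Union>n. C n) = topspace X"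
    and openI: "\<And>U. U \<subseteq> topspace X \<Longrightarrow> (\<And>n. openin (subtopology X (C n)) (U \<inter> C n)) \<Longrightarrow> openin X U"
    and Q: "compactin X Q"
  shows "\<exists>n. Q \<subseteq> (\<Union>i<n. C i)"
proof (rule ccontr)
  assume "\<nexists>n. Q \<subseteq> (\<Union>i<n. C i)"
  then have "\<forall>n. \<exists>x. x \<in> Q \<and> x \<notin> (\<Union>i<n. C i)"
    by blast
  then obtain x where x: "\<And>n. x n \<in> Q" "\<And>n. x n \<notin> (\<Union>i<n. C i)"
    by metis
  have QX: "Q \<subseteq> topspace X"
    using Q by (rule compactin_subset_topspace)
  have fin: "finite (range x \<inter> C k)" for k
  proof -
    have "n \<le> k" if "x n \<in> C k" for n
    proof (rule ccontr)
      assume "\<not> n \<le> k"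
      then have "x n \<in> (\<Union>i<n. C i)" using that by (intro UN_I[of k]) auto
      then show False using x(2) by blast
    qed
    then have "range x \<inter> C k \<subseteq> x ` {..k}" by auto
    then show ?thesis by (rule finite_subset) simp
  qed
  have inf: "infinite (range x)"
  proof
    assume "finite (range x)"
    then obtain n0 where n0: "range x = range x \<inter> (\<Union>i<n0. C i)"
    proof -
      have "\<exists>k. y \<in> C k" if "y \<in> range x" for y
        using that x(1) QX cover by blast
      then obtain k where k: "\<And>y. y \<in> range x \<Longrightarrow> y \<in> C (k y)" by metis
      have "y \<in> (\<Union>i<Suc (Max (k ` range x)). C i)" if "y \<in> range x" for y
      proof (rule UN_I[of "k y"])
        show "k y \<in> {..<Suc (Max (k ` range x))}"
          using that \<open>finite (range x)\<close> by (simp add: less_Suc_eq_le)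
      qed (rule k[OF that])
      then show ?thesis
        using that[of "Suc (Max (k ` range x))"] by blast
    qed
    then show False
      using x(2)[of n0] by blast
  qed
  obtain a where a: "a \<in> X derived_set_of (range x)"
    using compactin_imp_Bolzano_Weierstrass[OF Q, of "range x"] inf x(1) by blast
  let ?O = "topspace X - (range x - {a})"
  have "openin X ?O"
  proof (rule openI)
    fix n
    have "finite ((range x - {a}) \<inter> C n)"
      by (rule finite_subset[OF _ fin[of n]]) auto
    moreover have "(range x - {a}) \<inter> C n \<subseteq> topspace X"
      using x(1) QX by blast
    ultimately have "closedin X ((range x - {a}) \<inter> C n)"
      using t1 unfolding t1_space_closedin_finite by simp
    then have "closedin (subtopology X (C n)) ((range x - {a}) \<inter> C n)"
      by (auto simp: closedin_subtopology)
    moreover have "?O \<inter> C n = topspace (subtopology X (C n)) - ((range x - {a}) \<inter> C n)"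
      by auto
    ultimately show "openin (subtopology X (C n)) (?O \<inter> C n)"
      by (metis openin_diff openin_topspace)
  qed auto
  moreover have "a \<in> ?O"
    using a by (auto simp: derived_set_of_def)
  ultimately have "\<exists>y. y \<noteq> a \<and> y \<in> range x \<and> y \<in> ?O"
    using a unfolding derived_set_of_def mem_Collect_eq by (elim conjE) (drule spec[of _ ?O], blast)
  then obtain y where "y \<noteq> a" "y \<in> range x" "y \<in> ?O"
    by (elim exE conjE)
  then show False by blast
qed

lemma subsequence_of_not_eventually:
  assumes "\<not> eventually P sequentially"
  obtains r :: "nat \<Rightarrow> nat" where "strict_mono r" "\<And>j. \<not> P (r j)"
proof -
  have inf: "infinite {n. \<not> P n}"
    using assms unfolding infinite_nat_iff_unbounded_le eventually_sequentially by auto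
  show ?thesis
  proof (rule that)
    show "strict_mono (enumerate {n. \<not> P n})"
      using inf by (rule strict_mono_enumerate)
    show "\<not> P (enumerate {n. \<not> P n} j)" for j
      using enumerate_in_set[OF inf, of j] by simp
  qed
qed

lemma subsequence_const_or_strict_mono:
  fixes f :: "nat \<Rightarrow> nat"
  obtains r :: "nat \<Rightarrow> nat" and c where "strict_mono r" "\<And>j. f (r j) = c"
  | r where "strict_mono (r :: nat \<Rightarrow> nat)" "strict_mono (\<lambda>j. f (r j))"
proof (cases "\<exists>c. infinite {n. f n = c}")
  case True
  then obtain c where "infinite {n. f n = c}" by blast
  then show ?thesis
    using that(1)[of "enumerate {n. f n = c}" c] strict_mono_enumerate[of "{n. f n = c}"]
      enumerate_in_set[of "{n. f n = c}"] by simp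
next
  case False
  have ex: "\<exists>m>n. f m > f n" for n
  proof -
    have "{m. f m \<le> f n} = (\<Union>c\<le>f n. {m. f m = c})" by auto
    then have "finite {m. f m \<le> f n}" using False by simp
    then have "finite ({m. f m \<le> f n} \<union> {..n})" by simp
    then obtain m where "m \<notin> {m. f m \<le> f n} \<union> {..n}"
      using infinite_UNIV_nat by (metis UNIV_eq_I)
    then show ?thesis by (auto simp: not_le)
  qed
  define r where "r = rec_nat 0 (\<lambda>_ n. SOME m. m > n \<and> f m > f n)"
  have r: "r (Suc j) > r j" "f (r (Suc j)) > f (r j)" for j
    using someI_ex[OF ex[of "r j"]] by (auto simp: r_def)
  then show ?thesis
    using that(2)[of r] by (simp add: strict_mono_Suc_iff)
qed

text \<open>The cover is listed as a sequence, possibly with repetitions, so that finite initial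
  unions are available.\<close>

locale M_omega_grp = t1_group G T for G :: "('a, 'm) monoid_scheme" (structure) and T +
  fixes K :: "nat \<Rightarrow> 'a set"
  assumes K_cover: "(\<Union>n. K n) = carrier G"
    and K_closed: "closedin T (K n)"
    and K_metrizable: "metrizable_space (subtopology T (K n))"
    and openinI: "U \<subseteq> carrier G \<Longrightarrow> (\<And>n. openin (subtopology T (K n)) (U \<inter> K n)) \<Longrightarrow> openin T U"

lemma M_omega_group_imp_M_omega_grp:
  assumes "M_omega_group G T"
  obtains K where "M_omega_grp G T K"
proof -
  have tg: "topological_group G T" and "M_omega_space T"
    using assms by (auto simp: M_omega_group_def)
  then have grp: "group G" and top: "topspace T = carrier G"
    by (auto simp: topological_group_def)
  from \<open>M_omega_space T\<close> obtain \<K> where K: "countable \<K> \<and> \<Union>\<K> = topspace T \<and>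
      (\<forall>K\<in>\<K>. closedin T K \<and> metrizable_space (subtopology T K)) \<and>
      (\<forall>U. U \<subseteq> topspace T \<longrightarrow> (openin T U \<longleftrightarrow> (\<forall>K\<in>\<K>. openin (subtopology T K) (U \<inter> K))))"
    unfolding M_omega_space_def by (elim exE)
  have \<K>: "countable \<K>" "\<Union>\<K> = topspace T"
    "\<And>K. K \<in> \<K> \<Longrightarrow> closedin T K \<and> metrizable_space (subtopology T K)"
    "\<And>U. U \<subseteq> topspace T \<Longrightarrow> (\<forall>K\<in>\<K>. openin (subtopology T K) (U \<inter> K)) \<Longrightarrow> openin T U"
    using K by simp_all
  have "carrier G \<noteq> {}"
    using monoid.one_closed[OF group.is_monoid[OF grp]] by auto
  then have ne: "\<K> \<noteq> {}"
    using \<K>(2) top by auto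
  let ?K = "from_nat_into \<K>"
  have range: "range ?K = \<K>"
    using ne \<K>(1) by (rule range_from_nat_into)
  have mem: "?K n \<in> \<K>" for n
    using ne by (rule from_nat_into)
  have t1: "t1_space T"
    unfolding t1_space_closedin_singleton
  proof
    fix x assume "x \<in> topspace T"
    then obtain K where K: "K \<in> \<K>" "x \<in> K" using \<K>(2) by auto
    then have "closedin T K" "t1_space (subtopology T K)"
      using \<K>(3) metrizable_imp_t1_space by auto
    moreover have "x \<in> topspace (subtopology T K)"
      using K \<open>x \<in> topspace T\<close> by simp
    ultimately have "closedin (subtopology T K) {x}"
      by (simp add: t1_space_closedin_singleton)
    then show "closedin T {x}"
      using \<open>closedin T K\<close> by (rule closedin_trans_full)
  qed
  show ?thesis
  proof (rule that[of ?K], intro_locales)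
    show "Group.monoid G" "group_axioms G"
      using grp by (auto simp: group_def)
    show "t1_group_axioms G T"
      using tg t1 by (simp add: t1_group_axioms_def topological_group_def)
    show "M_omega_grp_axioms G T ?K"
    proof
      show "(\<Union>n. ?K n) = carrier G"
        using range \<K>(2) top by simp
      show "closedin T (?K n)" "metrizable_space (subtopology T (?K n))" for n
        using \<K>(3)[OF mem] by auto
      show "openin T U" if "U \<subseteq> carrier G" "\<And>n. openin (subtopology T (?K n)) (U \<inter> ?K n)" for U
      proof (rule \<K>(4))
        show "U \<subseteq> topspace T" using that(1) top by simp
        show "\<forall>K\<in>\<K>. openin (subtopology T K) (U \<inter> K)"
          using that(2) range by (metis imageE)
      qed
    qed
  qed
qed

context M_omega_grp
begin

lemma K_subset: "K n \<subseteq> carrier G"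
  using closedin_subset[OF K_closed] by simp

lemma compactin_imp_finite_cover:
  assumes "compactin T Q"
  shows "\<exists>n. Q \<subseteq> (\<Union>i<n. K i)"
  using compactin_countable_cover[OF t1, of K, OF _ _ assms] K_cover openinI by simp

lemma K_metric:
  obtains m where "Metric_space (K i) m" "subtopology T (K i) = Metric_space.mtopology (K i) m"
proof -
  obtain M m where M: "Metric_space M m" "subtopology T (K i) = Metric_space.mtopology M m"
    using K_metrizable[of i] unfolding metrizable_space_def by (elim exE conjE)
  have "topspace (subtopology T (K i)) = M"
    unfolding M(2) by (rule Metric_space.topspace_mtopology[OF M(1)])
  then have "M = K i"
    using K_subset[of i] by auto
  then show ?thesis
    using that M by simp
qed

text \<open>The topology is determined by the metrizable sets \<open>K n\<close>, and in each of
  them closedness can be tested by sequences.\<close>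

lemma closedin_sequentiallyI:
  assumes A: "A \<subseteq> carrier G"
    and seq: "\<And>x a. range x \<subseteq> A \<Longrightarrow> limitin T x a sequentially \<Longrightarrow> a \<in> A"
  shows "closedin T A"
proof -
  have "openin T (carrier G - A)"
  proof (rule openinI)
    fix n
    obtain m where m: "Metric_space (K n) m" "subtopology T (K n) = Metric_space.mtopology (K n) m"
      by (rule K_metric)
    have "closedin (subtopology T (K n)) (A \<inter> K n)"
      unfolding m(2) Metric_space.metric_closedin_iff_sequentially_closed[OF m(1)]
      unfolding m(2)[symmetric]
    proof (intro conjI allI impI)
      fix x a assume xa: "range x \<subseteq> A \<inter> K n \<and> limitin (subtopology T (K n)) x a sequentially"
      then have "limitin T x a sequentially" "a \<in> K n"
        by (auto simp: limitin_subtopology)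
      then show "a \<in> A \<inter> K n"
        using seq[of x a] xa by blast
    qed simp
    moreover have "(carrier G - A) \<inter> K n = topspace (subtopology T (K n)) - (A \<inter> K n)"
      using K_subset[of n] by auto
    ultimately show "openin (subtopology T (K n)) ((carrier G - A) \<inter> K n)"
      by (metis openin_diff openin_topspace)
  qed auto
  then show ?thesis
    using A by (simp add: closedin_def)
qed

lemma openin_sequentiallyI:
  assumes U: "U \<subseteq> carrier G"
    and seq: "\<And>x a. a \<in> U \<Longrightarrow> range x \<subseteq> carrier G \<Longrightarrow> limitin T x a sequentially \<Longrightarrow> \<exists>j. x j \<in> U"
  shows "openin T U"
proof -
  have "closedin T (carrier G - U)"
  proof (rule closedin_sequentiallyI)
    fix x a assume x: "range x \<subseteq> carrier G - U" "limitin T x a sequentially"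
    then have "a \<in> carrier G" using limitin_topspace by fastforce
    moreover have "a \<notin> U" using seq[of a x] x by blast
    ultimately show "a \<in> carrier G - U" by simp
  qed auto
  then have "openin T (carrier G - (carrier G - U))"
    using openin_diff[OF openin_topspace[of T]] by simp
  then show ?thesis using U by (simp add: double_diff)
qed

lemma limitin_sequence_finite_cover:
  assumes "limitin T x a sequentially" "range x \<subseteq> carrier G"
  shows "\<exists>n. range x \<subseteq> (\<Union>i<n. K i)"
proof -
  have "compactin T (insert a (range x))"
    using assms by (intro compactin_sequence_with_limit[of T x a]) auto
  from compactin_imp_finite_cover[OF this]
  obtain n where "insert a (range x) \<subseteq> (\<Union>i<n. K i)" ..
  then have "range x \<subseteq> (\<Union>i<n. K i)"
    by (simp only: insert_subset)
  then show ?thesis ..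
qed

lemma limitin_unique:
  assumes "limitin T x a sequentially" "limitin T x b sequentially"
  shows "a = b"
  using limitin_Hausdorff_unique[OF assms _ Hausdorff] by simp

end

section \<open>Metrizability from a finite part of the cover\<close>

context M_omega_grp
begin

text \<open>By hypothesis every sequence tending to the unit is eventually inside a union of
  finitely many members of the cover. Unions of balls about the unit in these members therefore look
  like a countable neighbourhood base to sequences. They are not yet known to be neighbourhoods;
  this and the cube property follow from sequential arguments, since the topology is
  sequential.\<close>

lemma metrizableI:
  assumes seq: "\<And>t. limitin T t \<one> sequentially \<Longrightarrow> range t \<subseteq> carrier G \<Longrightarrow> \<exists>j. t j \<in> (\<Union>i<n. K i)"
  shows "metrizable_space T"
proof -
  let ?F = "\<Union>i<n. K i"
  have evF: "eventually (\<lambda>j. t j \<in> ?F) sequentially"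
    if t: "limitin T t \<one> sequentially" "range t \<subseteq> carrier G" for t
  proof (rule ccontr)
    assume "\<not> ?thesis"
    then obtain r :: "nat \<Rightarrow> nat" where r: "strict_mono r" "\<And>j. t (r j) \<notin> ?F"
      by (rule subsequence_of_not_eventually) blast
    have "limitin T (t \<circ> r) \<one> sequentially"
      using r(1) t(1) by (rule limitin_subsequence)
    moreover have "range (t \<circ> r) \<subseteq> carrier G" using t(2) by auto
    ultimately obtain j where "(t \<circ> r) j \<in> ?F" using seq by blast
    then show False using r(2)[of j] by simp
  qed
  have "\<forall>i. \<exists>m. Metric_space (K i) m \<and> subtopology T (K i) = Metric_space.mtopology (K i) m"
  proof
    fix i show "\<exists>m. Metric_space (K i) m \<and> subtopology T (K i) = Metric_space.mtopology (K i) m"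
      by (rule K_metric[of i]) (intro exI conjI)
  qed
  then obtain m where m: "\<And>i. Metric_space (K i) (m i)"
      "\<And>i. subtopology T (K i) = Metric_space.mtopology (K i) (m i)"
    by metis
  define B where "B i k = {x \<in> K i. m i \<one> x < inverse (real (Suc k))}" for i k
  define I where "I = {i. i < n \<and> \<one> \<in> K i}"
  define U where "U k = (\<Union>i\<in>I. B i k)" for k
  have U_sub: "U k \<subseteq> carrier G" for k
    using K_subset unfolding U_def B_def by blast
  have B_dec: "B i k \<subseteq> B i j" if "j \<le> k" for i j k
  proof -
    have "inverse (real (Suc k)) \<le> inverse (real (Suc j))"
      using that by (intro le_imp_inverse_le) auto
    then show ?thesis
      unfolding B_def by (auto simp del: of_nat_Suc intro: less_le_trans)
  qed
  then have U_dec: "U k \<subseteq> U j" if "j \<le> k" for j k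
    using that unfolding U_def by blast
  \<comment> \<open>The constant sequence puts the unit into the union, so that \<open>I\<close> is
    nonempty.\<close>
  have "\<exists>j::nat. \<one> \<in> ?F"
    using seq[of "\<lambda>_. \<one>"] by auto
  then have I_ne: "I \<noteq> {}"
    unfolding I_def by auto
  have B_one: "\<one> \<in> B i k" if "i \<in> I" for i k
    using that Metric_space.zero[OF m(1), of \<one> i \<one>] unfolding B_def I_def by simp
  have U_one: "\<one> \<in> U k" for k
    using I_ne B_one unfolding U_def by blast
  have fin: "finite I" unfolding I_def by simp
  have U_small: "\<exists>k. U k \<subseteq> W" if W: "openin T W" "\<one> \<in> W" for W
  proof -
    have "\<exists>k. B i k \<subseteq> W" if i: "i \<in> I" for i
    proof -
      have "openin (Metric_space.mtopology (K i) (m i)) (W \<inter> K i)"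
        using W(1) unfolding m(2)[symmetric] by (rule openin_subtopology_Int)
      moreover have "\<one> \<in> W \<inter> K i" using W i by (simp add: I_def)
      ultimately obtain r where r: "r > 0" "Metric_space.mball (K i) (m i) \<one> r \<subseteq> W \<inter> K i"
        unfolding Metric_space.openin_mtopology[OF m(1)] by blast
      obtain k where k: "inverse (real (Suc k)) < r"
        using reals_Archimedean[OF r(1)] by blast
      have "B i k \<subseteq> Metric_space.mball (K i) (m i) \<one> r"
        using k i unfolding B_def I_def Metric_space.mball_def[OF m(1)] by auto
      then show ?thesis using r(2) by blast
    qed
    then obtain k where k: "\<And>i. i \<in> I \<Longrightarrow> B i (k i) \<subseteq> W" by metis
    have "B i (Max (k ` I)) \<subseteq> W" if "i \<in> I" for i
      using B_dec[of "k i" "Max (k ` I)" i] k[OF that] fin that by auto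
    then show ?thesis unfolding U_def by blast
  qed
  have U_large: "eventually (\<lambda>j. t j \<in> U k) sequentially"
    if t: "limitin T t \<one> sequentially" "range t \<subseteq> carrier G" for t k
  proof -
    have "eventually (\<lambda>j. t j \<in> K i \<longrightarrow> i \<in> I \<and> t j \<in> B i k) sequentially" if i: "i < n" for i
    proof (cases "\<one> \<in> K i")
      case True
      then have "i \<in> I" using i by (simp add: I_def)
      have "B i k = Metric_space.mball (K i) (m i) \<one> (inverse (real (Suc k)))"
        using True unfolding B_def Metric_space.mball_def[OF m(1)] by auto
      then have "openin (subtopology T (K i)) (B i k)"
        unfolding m(2) using Metric_space.openin_mball[OF m(1)] by simp
      then obtain W where W: "openin T W" "B i k = W \<inter> K i"
        unfolding openin_subtopology by blast
      have "eventually (\<lambda>j. t j \<in> W) sequentially"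
        using t(1) W B_one[OF \<open>i \<in> I\<close>, of k] unfolding limitin_def by simp
      then show ?thesis
        by (rule eventually_mono) (use W(2) \<open>i \<in> I\<close> in simp)
    next
      case False
      have "openin T (carrier G - K i)"
        using K_closed[of i] by (simp add: closedin_def)
      moreover have "\<one> \<in> carrier G - K i" using False by simp
      ultimately have "eventually (\<lambda>j. t j \<in> carrier G - K i) sequentially"
        using t(1) unfolding limitin_def by blast
      then show ?thesis
        by (rule eventually_mono) simp
    qed
    then have "eventually (\<lambda>j. \<forall>i\<in>{..<n}. t j \<in> K i \<longrightarrow> i \<in> I \<and> t j \<in> B i k) sequentially"
      by (intro eventually_ball_finite) auto
    from eventually_conj[OF this evF[OF t]] show ?thesis
      by (rule eventually_mono) (auto simp: U_def)
  qed
  define S where "S k = {x \<in> U k. inv x \<in> U k}" for k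
  have S_sub: "S k \<subseteq> carrier G" for k
    using U_sub[of k] by (auto simp: S_def)
  have S_one: "\<one> \<in> S k" for k using U_one by (simp add: S_def)
  have S_large: "eventually (\<lambda>j. t j \<in> S k) sequentially"
    if t: "limitin T t \<one> sequentially" "range t \<subseteq> carrier G" for t k
  proof -
    have "limitin T (\<lambda>j. inv (t j)) \<one> sequentially"
      using limitin_inv[OF t(1)] by simp
    moreover have "range (\<lambda>j. inv (t j)) \<subseteq> carrier G" using t(2) by auto
    ultimately have "eventually (\<lambda>j. inv (t j) \<in> U k) sequentially" by (rule U_large)
    from eventually_conj[OF this U_large[OF t, of k]] show ?thesis
      by (rule eventually_mono) (simp add: S_def)
  qed
  have S_small: "limitin T t \<one> sequentially"
    if t: "\<And>j. t j \<in> S (c j)" "\<And>j. j \<le> c j" for t c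
    unfolding limitin_sequentially
  proof (intro conjI allI impI)
    fix W assume "openin T W \<and> \<one> \<in> W"
    then obtain k where k: "U k \<subseteq> W" using U_small by blast
    have "t j \<in> W" if "k \<le> j" for j
      using t(1)[of j] U_dec[of k "c j"] t(2)[of j] that k unfolding S_def by auto
    then show "\<exists>N. \<forall>j\<ge>N. t j \<in> W" by blast
  qed simp
  \<comment> \<open>Otherwise there are, for every \<open>j\<close>, triples in
    \<open>S (Suc (k + j))\<close> with product outside \<open>S k\<close>. The three sequences tend
    to the unit, hence so does the product, against \<open>S_large\<close>.\<close>
  have S_cube: "\<exists>k'>k. \<forall>x\<in>S k'. \<forall>y\<in>S k'. \<forall>z\<in>S k'. x \<otimes> (y \<otimes> z) \<in> S k" for k
  proof (rule ccontr)
    assume "\<not> ?thesis"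
    then have "\<forall>j. \<exists>x y z. x \<in> S (Suc (k + j)) \<and> y \<in> S (Suc (k + j)) \<and> z \<in> S (Suc (k + j)) \<and> x \<otimes> (y \<otimes> z) \<notin> S k"
      by (meson less_add_Suc1)
    then obtain x y z where xyz: "\<And>j. x j \<in> S (Suc (k + j))" "\<And>j. y j \<in> S (Suc (k + j))"
        "\<And>j. z j \<in> S (Suc (k + j))" "\<And>j. x j \<otimes> (y j \<otimes> z j) \<notin> S k"
      by metis
    have "limitin T x \<one> sequentially" "limitin T y \<one> sequentially" "limitin T z \<one> sequentially"
      by (rule S_small[of _ "\<lambda>j. Suc (k + j)"], rule xyz, simp)+
    then have "limitin T (\<lambda>j. x j \<otimes> (y j \<otimes> z j)) (\<one> \<otimes> (\<one> \<otimes> \<one>)) sequentially"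
      by (intro limitin_mult)
    moreover have "range (\<lambda>j. x j \<otimes> (y j \<otimes> z j)) \<subseteq> carrier G"
      using subsetD[OF S_sub xyz(1)] subsetD[OF S_sub xyz(2)] subsetD[OF S_sub xyz(3)]
      by (auto intro!: m_closed)
    ultimately have "eventually (\<lambda>j. x j \<otimes> (y j \<otimes> z j) \<in> S k) sequentially"
      by (intro S_large) simp_all
    then show False using xyz(4) by simp
  qed
  define c where "c = rec_nat 0 (\<lambda>_ k. SOME k'. k' > k \<and> (\<forall>x\<in>S k'. \<forall>y\<in>S k'. \<forall>z\<in>S k'. x \<otimes> (y \<otimes> z) \<in> S k))"
  have c: "c (Suc j) > c j" "\<forall>x\<in>S (c (Suc j)). \<forall>y\<in>S (c (Suc j)). \<forall>z\<in>S (c (Suc j)). x \<otimes> (y \<otimes> z) \<in> S (c j)" for j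
    using someI_ex[OF S_cube[of "c j"]] by (simp_all add: c_def)
  then have "strict_mono c"
    by (simp add: strict_mono_Suc_iff)
  then have c_ge: "j \<le> c j" for j
    by (rule strict_mono_imp_increasing)
  define V where "V j = S (c j)" for j
  have V_cube: "x \<otimes> (y \<otimes> z) \<in> V j" if "x \<in> V (Suc j)" "y \<in> V (Suc j)" "z \<in> V (Suc j)" for x y z j
    using c(2)[of j] that unfolding V_def by blast
  have V_sub: "V j \<subseteq> carrier G" for j unfolding V_def by (rule S_sub)
  show ?thesis
  proof (rule birkhoff_kakutani[of V])
    show "V j \<subseteq> carrier G" "\<one> \<in> V j" for j
      unfolding V_def by (rule S_sub S_one)+
    show "inv x \<in> V j" if "x \<in> V j" for x j
      using that subsetD[OF V_sub that] unfolding V_def S_def by auto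
    show "x \<otimes> (y \<otimes> z) \<in> V j" if "x \<in> V (Suc j)" "y \<in> V (Suc j)" "z \<in> V (Suc j)" for x y z j
      using that by (rule V_cube)
    show "\<exists>j. V j \<subseteq> W" if W: "openin T W" "\<one> \<in> W" for W
    proof -
      obtain k where "U k \<subseteq> W" using U_small[OF W] by blast
      moreover have "V k \<subseteq> U k"
        using U_dec[OF c_ge[of k]] unfolding V_def S_def by blast
      ultimately show ?thesis by blast
    qed
    fix j
    \<comment> \<open>Points at which some translated \<open>V k\<close> still fits into
      \<open>V j\<close>. The cube property carries this from \<open>a\<close> to terms close to
      \<open>a\<close> at the cost of one index, so the set is sequentially open and hence
      open.\<close>
    let ?I = "{x \<in> carrier G. \<exists>k. \<forall>v\<in>V k. x \<otimes> v \<in> V j}"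
    have "openin T ?I"
    proof (rule openin_sequentiallyI)
      fix t a assume a: "a \<in> ?I" and t: "range t \<subseteq> carrier G" "limitin T t a sequentially"
      then obtain k where k: "\<forall>v\<in>V k. a \<otimes> v \<in> V j" and ac: "a \<in> carrier G" by blast
      have tc: "t i \<in> carrier G" for i using t(1) by blast
      have "limitin T (\<lambda>i. inv a \<otimes> t i) (inv a \<otimes> a) sequentially"
        using ac by (intro limitin_mult t(2)) simp
      moreover have "range (\<lambda>i. inv a \<otimes> t i) \<subseteq> carrier G"
        using ac tc by auto
      ultimately have "eventually (\<lambda>i. inv a \<otimes> t i \<in> V (Suc k)) sequentially"
        unfolding V_def using ac by (intro S_large) simp_all
      then obtain i where i: "inv a \<otimes> t i \<in> V (Suc k)"
        unfolding eventually_sequentially by blast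
      have "t i \<otimes> v \<in> V j" if v: "v \<in> V (Suc k)" for v
      proof -
        have vc: "v \<in> carrier G" using v V_sub by blast
        have "(inv a \<otimes> t i) \<otimes> (v \<otimes> \<one>) \<in> V k"
          using i v by (rule V_cube) (simp add: V_def S_one)
        then have "a \<otimes> ((inv a \<otimes> t i) \<otimes> (v \<otimes> \<one>)) \<in> V j" using k by blast
        moreover have "a \<otimes> ((inv a \<otimes> t i) \<otimes> (v \<otimes> \<one>)) = t i \<otimes> v"
          using ac tc[of i] vc by (simp add: m_assoc)
        ultimately show ?thesis by simp
      qed
      then show "\<exists>i. t i \<in> ?I" using tc by blast
    qed auto
    moreover have "\<one> \<in> ?I"
      using subsetD[OF V_sub] by (auto intro!: exI[of _ j])
    moreover have "?I \<subseteq> V j"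
    proof
      fix x assume "x \<in> ?I"
      then obtain k where "x \<otimes> \<one> \<in> V j" "x \<in> carrier G"
        using S_one unfolding V_def by blast
      then show "x \<in> V j" by simp
    qed
    ultimately show "\<exists>W. openin T W \<and> \<one> \<in> W \<and> W \<subseteq> V j"
      by (intro exI[of _ ?I] conjI)
  qed
qed

end

section \<open>Local compactness and sigma-compact subgroups of non-metrizable groups\<close>

locale nonmetrizable_M_omega_grp = M_omega_grp +
  assumes nonmetrizable: "\<not> metrizable_space T"
begin

lemma sequence_outside_cover:
  obtains t where "limitin T t \<one> sequentially" "\<And>j. t j \<in> carrier G" "\<And>j. t j \<notin> (\<Union>i<n. K i)"
proof -
  have "\<exists>t. limitin T t \<one> sequentially \<and> range t \<subseteq> carrier G \<and> (\<forall>j. t j \<notin> (\<Union>i<n. K i))"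
    using metrizableI[of n] nonmetrizable by blast
  then show ?thesis
    using that by blast
qed

lemma sequence_outside_compact:
  assumes "compactin T Q"
  obtains t where "limitin T t \<one> sequentially" "\<And>j. t j \<in> carrier G" "\<And>j. t j \<notin> Q"
proof -
  obtain n where n: "Q \<subseteq> (\<Union>i<n. K i)"
    using compactin_imp_finite_cover[OF assms] ..
  obtain t where "limitin T t \<one> sequentially" "\<And>j. t j \<in> carrier G" "\<And>j. t j \<notin> (\<Union>i<n. K i)"
    by (rule sequence_outside_cover[of n]) blast
  then show ?thesis
    using n by (intro that[of t]) blast+
qed

text \<open>
  If \<open>K i\<close> were not locally compact at \<open>p\<close>, then in every ball around \<open>p\<close> there would be a sequence
  \<open>d n\<close> without convergent subsequences. With sequences \<open>t n\<close> that converge to \<open>\<one>\<close> but avoid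
  larger and larger parts of the cover, the points \<open>d n j \<otimes> t n j\<close> other than \<open>p\<close> form a
  sequentially closed set having \<open>p\<close> in its closure.
\<close>

lemma K_locally_compact:
  assumes p: "p \<in> K i"
  shows "\<exists>W L. openin T W \<and> p \<in> W \<and> compactin T L \<and> L \<subseteq> K i \<and> W \<inter> K i \<subseteq> L"
proof -
  obtain m where m: "Metric_space (K i) m" "subtopology T (K i) = Metric_space.mtopology (K i) m"
    by (rule K_metric)
  define B where "B n = Metric_space.mcball (K i) m p (inverse (real (Suc n)))" for n
  have B_sub: "B n \<subseteq> K i" for n
    unfolding B_def by (rule Metric_space.mcball_subset_mspace[OF m(1)])
  have pc: "p \<in> carrier G" using p K_subset by blast
  show ?thesis
  proof (cases "\<exists>n. compactin (subtopology T (K i)) (B n)")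
    case True
    then obtain n where n: "compactin (subtopology T (K i)) (B n)" by blast
    let ?b = "Metric_space.mball (K i) m p (inverse (real (Suc n)))"
    have "openin (subtopology T (K i)) ?b"
      unfolding m(2) by (rule Metric_space.openin_mball[OF m(1)])
    then obtain W where W: "openin T W" "?b = W \<inter> K i"
      unfolding openin_subtopology by blast
    have "p \<in> ?b"
      using p Metric_space.centre_in_mball_iff[OF m(1)] by simp
    moreover have "?b \<subseteq> B n"
      unfolding B_def by (rule Metric_space.mball_subset_mcball[OF m(1)])
    ultimately show ?thesis
      using W n B_sub[of n] by (intro exI[of _ W] exI[of _ "B n"]) (auto simp: compactin_subtopology)
  next
    case False
    have "\<exists>d. range d \<subseteq> B n \<and> (\<forall>a r. strict_mono (r::nat \<Rightarrow> nat) \<longrightarrow> \<not> limitin T (d \<circ> r) a sequentially)" for n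
    proof -
      have "\<not> compactin (Metric_space.mtopology (K i) m) (B n)"
        using False unfolding m(2) by blast
      then obtain d :: "nat \<Rightarrow> 'a" where d: "range d \<subseteq> B n"
        "\<And>a r. a \<in> B n \<Longrightarrow> strict_mono r \<Longrightarrow> \<not> limitin (subtopology T (K i)) (d \<circ> r) a sequentially"
        unfolding Metric_space.compactin_sequentially[OF m(1)] m(2) using B_sub[of n] by blast
      have "\<not> limitin T (d \<circ> r) a sequentially" if r: "strict_mono r" for a r
      proof
        assume lim: "limitin T (d \<circ> r) a sequentially"
        have "closedin (subtopology T (K i)) (B n)"
          unfolding m(2) B_def by (rule Metric_space.closedin_mcball[OF m(1)])
        then have "closedin T (B n)"
          using K_closed by (rule closedin_trans_full)
        moreover have "\<forall>j. (d \<circ> r) j \<in> B n" using d(1) by auto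
        ultimately have a: "a \<in> B n"
          using limitin_closedin[OF lim] by (simp add: always_eventually)
        have "limitin (subtopology T (K i)) (d \<circ> r) a sequentially"
          unfolding limitin_subtopology using lim a d(1) B_sub[of n] by (auto intro!: always_eventually)
        then show False using d(2)[OF a r] by blast
      qed
      then show ?thesis using d(1) by blast
    qed
    then obtain d where d: "\<And>n. range (d n) \<subseteq> B n"
        "\<And>n a r. strict_mono (r::nat \<Rightarrow> nat) \<Longrightarrow> \<not> limitin T (d n \<circ> r) a sequentially"
      by metis
    have dc: "d n j \<in> carrier G" for n j
      using d(1)[of n] B_sub[of n] K_subset[of i] by blast
    have "\<forall>n. \<exists>t. limitin T t \<one> sequentially \<and> (\<forall>j. t j \<in> carrier G) \<and> (\<forall>j. t j \<notin> (\<Union>i<n. K i))"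
    proof
      fix n show "\<exists>t. limitin T t \<one> sequentially \<and> (\<forall>j. t j \<in> carrier G) \<and> (\<forall>j. t j \<notin> (\<Union>i<n. K i))"
        by (rule sequence_outside_cover[of n]) blast
    qed
    then obtain t where t: "\<And>n. limitin T (t n) \<one> sequentially" "\<And>n j. t n j \<in> carrier G"
        "\<And>n j. t n j \<notin> (\<Union>i<n. K i)"
      by metis
    define A where "A = {d n j \<otimes> t n j | n j. True} - {p}"
    have d_lim: "limitin T (\<lambda>l. d (s l) (e l)) p sequentially" if s: "strict_mono s" for s :: "nat \<Rightarrow> nat" and e
      unfolding limitin_sequentially
    proof (intro conjI allI impI)
      fix W assume W: "openin T W \<and> p \<in> W"
      then have "openin (Metric_space.mtopology (K i) m) (W \<inter> K i)"
        unfolding m(2)[symmetric] by (simp add: openin_subtopology_Int)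
      then obtain r where r: "r > 0" "Metric_space.mball (K i) m p r \<subseteq> W \<inter> K i"
        unfolding Metric_space.openin_mtopology[OF m(1)] using W p by blast
      obtain k where k: "inverse (real (Suc k)) < r"
        using reals_Archimedean[OF r(1)] by blast
      have "d (s l) (e l) \<in> W" if l: "k \<le> l" for l
      proof -
        have "inverse (real (Suc (s l))) \<le> inverse (real (Suc k))"
          using strict_mono_imp_increasing[OF s, of l] l by (intro le_imp_inverse_le) auto
        moreover have "d (s l) (e l) \<in> B (s l)" using d(1) by blast
        ultimately have "m p (d (s l) (e l)) < r" "d (s l) (e l) \<in> K i"
          using k unfolding B_def Metric_space.mcball_def[OF m(1)] mem_Collect_eq by linarith+
        then have "d (s l) (e l) \<in> Metric_space.mball (K i) m p r"
          using p unfolding Metric_space.mball_def[OF m(1)] by simp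
        then show ?thesis using r(2) by blast
      qed
      then show "\<exists>N. \<forall>l\<ge>N. d (s l) (e l) \<in> W" by blast
    qed (simp add: pc)
    have "closedin T A"
    proof (rule closedin_sequentiallyI)
      have mem_A: "\<exists>n j. y = d n j \<otimes> t n j" if "y \<in> A" for y
        using that unfolding A_def by blast
      show "A \<subseteq> carrier G" unfolding A_def using dc t(2) by auto
      fix x a assume x: "range x \<subseteq> A" and lim: "limitin T x a sequentially"
      have "\<forall>l. \<exists>n j. x l = d n j \<otimes> t n j"
        using x by (intro allI mem_A) blast
      then obtain \<nu> \<mu> where x_eq: "\<And>l. x l = d (\<nu> l) (\<mu> l) \<otimes> t (\<nu> l) (\<mu> l)" by metis
      have ac: "a \<in> carrier G" using limitin_topspace[OF lim] by simp
      \<comment> \<open>Along subsequences \<open>\<nu>\<close> and \<open>\<mu>\<close> are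
        constant or strictly increasing. Both constant: the limit is a term of the sequence. Only
        \<open>\<nu>\<close> constant: \<open>t N\<close> tends to the unit, so a subsequence of
        \<open>d N\<close> would converge. \<open>\<nu>\<close> increasing: the \<open>d\<close>
        terms tend to \<open>p\<close>, so the \<open>t\<close> terms converge and lie in finitely
        many members of the cover, which the later \<open>t n\<close> avoid.\<close>
      show "a \<in> A"
      proof (cases rule: subsequence_const_or_strict_mono[of \<nu>])
        case (1 r N)
        have lim_r: "limitin T (x \<circ> r) a sequentially"
          using 1(1) lim by (rule limitin_subsequence)
        show ?thesis
        proof (cases rule: subsequence_const_or_strict_mono[of "\<lambda>j. \<mu> (r j)"])
          case (1 s M)
          have "limitin T ((x \<circ> r) \<circ> s) a sequentially"
            using 1(1) lim_r by (rule limitin_subsequence)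
          moreover have "(x \<circ> r) \<circ> s = (\<lambda>_. x (r (s 0)))"
            using 1(2) \<open>\<And>j. \<nu> (r j) = N\<close> by (auto simp: x_eq)
          moreover have "limitin T (\<lambda>_::nat. x (r (s 0))) (x (r (s 0))) sequentially"
            using x \<open>A \<subseteq> carrier G\<close> by auto
          ultimately have "a = x (r (s 0))" using limitin_unique by simp
          then show ?thesis using x by blast
        next
          case (2 s)
          have "limitin T ((x \<circ> r) \<circ> s) a sequentially"
            using 2(1) lim_r by (rule limitin_subsequence)
          moreover have "limitin T (t N \<circ> (\<lambda>j. \<mu> (r (s j)))) \<one> sequentially"
            using 2(2) t(1) by (rule limitin_subsequence)
          ultimately have "limitin T (\<lambda>j. ((x \<circ> r) \<circ> s) j \<otimes> inv ((t N \<circ> (\<lambda>j. \<mu> (r (s j)))) j)) (a \<otimes> inv \<one>) sequentially"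
            by (intro limitin_mult limitin_inv)
          moreover have "(\<lambda>j. ((x \<circ> r) \<circ> s) j \<otimes> inv ((t N \<circ> (\<lambda>j. \<mu> (r (s j)))) j)) = d N \<circ> (\<lambda>j. \<mu> (r (s j)))"
            using \<open>\<And>j. \<nu> (r j) = N\<close> dc t(2) by (auto simp: x_eq m_assoc)
          ultimately show ?thesis
            using d(2)[OF 2(2)] by auto
        qed
      next
        case (2 r)
        have lim_r: "limitin T (x \<circ> r) a sequentially"
          using 2(1) lim by (rule limitin_subsequence)
        have "limitin T (\<lambda>l. d (\<nu> (r l)) (\<mu> (r l))) p sequentially"
          using d_lim[OF 2(2)] .
        then have "limitin T (\<lambda>l. inv (d (\<nu> (r l)) (\<mu> (r l))) \<otimes> (x \<circ> r) l) (inv p \<otimes> a) sequentially"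
          by (intro limitin_mult limitin_inv lim_r)
        moreover have "(\<lambda>l. inv (d (\<nu> (r l)) (\<mu> (r l))) \<otimes> (x \<circ> r) l) = (\<lambda>l. t (\<nu> (r l)) (\<mu> (r l)))"
          using dc t(2) by (auto simp: x_eq)
        ultimately have "limitin T (\<lambda>l. t (\<nu> (r l)) (\<mu> (r l))) (inv p \<otimes> a) sequentially" by simp
        then have "\<exists>n. range (\<lambda>l. t (\<nu> (r l)) (\<mu> (r l))) \<subseteq> (\<Union>i<n. K i)"
          by (rule limitin_sequence_finite_cover) (use t(2) in auto)
        then obtain n where n: "\<And>l. t (\<nu> (r l)) (\<mu> (r l)) \<in> (\<Union>i<n. K i)" by blast
        have "n \<le> \<nu> (r n)"
          using strict_mono_imp_increasing[OF 2(2), of n] .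
        then have "(\<Union>i<n. K i) \<subseteq> (\<Union>i<\<nu> (r n). K i)"
          by (intro UN_mono) auto
        then show ?thesis
          using n[of n] t(3)[of "\<nu> (r n)" "\<mu> (r n)"] by blast
      qed
    qed
    then have "openin T (carrier G - A)" by (simp add: closedin_def)
    moreover have "p \<otimes> \<one> \<in> carrier G - A" using pc by (simp add: A_def)
    ultimately obtain V W where VW: "openin T V" "openin T W" "p \<in> V" "\<one> \<in> W"
        "\<And>v w. v \<in> V \<Longrightarrow> w \<in> W \<Longrightarrow> v \<otimes> w \<in> carrier G - A"
      using pc one_closed by (rule mult_nbhd) blast
    \<comment> \<open>Otherwise one term outside \<open>V\<close> from each \<open>d n\<close> would
      form a sequence that converges to \<open>p\<close>.\<close>
    have "\<exists>n. \<forall>j. d n j \<in> V"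
    proof (rule ccontr)
      assume "\<not> ?thesis"
      then obtain e where e: "\<And>n. d n (e n) \<notin> V" by metis
      have "limitin T (\<lambda>l. d l (e l)) p sequentially"
        using d_lim[of "\<lambda>l. l" e] by (simp add: strict_mono_def)
      then show False
        using VW(1,3) e unfolding limitin_sequentially by blast
    qed
    then obtain n where n: "\<And>j. d n j \<in> V" by blast
    obtain N where N: "\<And>j. j \<ge> N \<Longrightarrow> t n j \<in> W"
      using t(1)[of n] VW(2,4) unfolding limitin_sequentially by blast
    \<comment> \<open>The product avoids \<open>A\<close>, so it is the point \<open>p\<close> that
      was left out of \<open>A\<close>. From \<open>N\<close> on, \<open>d n\<close> is thus
      \<open>p\<close> times the inverse of \<open>t n\<close> and converges, which was
      excluded.\<close>
    have eq: "d n j \<otimes> t n j = p" if "j \<ge> N" for j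
    proof -
      have "d n j \<otimes> t n j \<notin> A" using VW(5)[OF n N[OF that]] by blast
      then show ?thesis unfolding A_def by blast
    qed
    have shift: "strict_mono (\<lambda>j. j + N)" by (simp add: strict_mono_def)
    have "limitin T (\<lambda>j. p \<otimes> inv ((t n \<circ> (\<lambda>j. j + N)) j)) (p \<otimes> inv \<one>) sequentially"
      using pc by (intro limitin_mult limitin_inv limitin_subsequence[OF shift] t(1)) simp
    moreover have "(\<lambda>j. p \<otimes> inv ((t n \<circ> (\<lambda>j. j + N)) j)) = d n \<circ> (\<lambda>j. j + N)"
    proof
      fix j
      show "p \<otimes> inv ((t n \<circ> (\<lambda>j. j + N)) j) = (d n \<circ> (\<lambda>j. j + N)) j"
        using eq[of "j + N", symmetric] dc[of n "j + N"] t(2)[of n "j + N"] by (simp add: m_assoc)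
    qed
    ultimately have False using d(2)[OF shift] by auto
    then show ?thesis ..
  qed
qed

text \<open>
  The subgroup is exhausted by a countable family of compact sets which is closed under products and
  inverses and contains, with each member, compact neighbourhoods in all \<open>K i\<close> of its points.
\<close>

lemma open_sigma_compact_subgroup:
  assumes S: "countable S" "S \<subseteq> carrier G"
  obtains H \<C> where "subgroup H G" "S \<subseteq> H" "countable \<C>" "\<Union>\<C> = H" "\<And>C. C \<in> \<C> \<Longrightarrow> compactin T C"
    "\<And>U. U \<subseteq> H \<Longrightarrow> (\<And>C. C \<in> \<C> \<Longrightarrow> openin (subtopology T C) (U \<inter> C)) \<Longrightarrow> openin T U"
proof -
  \<comment> \<open>\<open>C \<inter> K i\<close> is compact, so finitely many of the compact
    neighbourhoods given by local compactness of \<open>K i\<close> suffice.\<close>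
  have "\<exists>\<L>. finite \<L> \<and> (\<forall>L\<in>\<L>. compactin T L) \<and>
      (\<forall>x\<in>C \<inter> K i. \<exists>L\<in>\<L>. \<exists>W. openin T W \<and> x \<in> W \<and> W \<inter> K i \<subseteq> L)"
    if C: "compactin T C" for C i
  proof -
    have "\<forall>p\<in>K i. \<exists>W. \<exists>L. openin T W \<and> p \<in> W \<and> compactin T L \<and> L \<subseteq> K i \<and> W \<inter> K i \<subseteq> L"
      by (intro ballI K_locally_compact)
    from bchoice[OF this] obtain W
      where "\<forall>p\<in>K i. \<exists>L. openin T (W p) \<and> p \<in> W p \<and> compactin T L \<and> L \<subseteq> K i \<and> W p \<inter> K i \<subseteq> L" ..
    from bchoice[OF this] obtain L
      where L: "\<forall>p\<in>K i. openin T (W p) \<and> p \<in> W p \<and> compactin T (L p) \<and> L p \<subseteq> K i \<and> W p \<inter> K i \<subseteq> L p" ..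
    then have WL: "\<And>p. p \<in> K i \<Longrightarrow> openin T (W p) \<and> p \<in> W p \<and> compactin T (L p) \<and> W p \<inter> K i \<subseteq> L p"
      by simp
    have "compactin T (C \<inter> K i)"
      using C K_closed by (rule compact_Int_closedin)
    moreover have "\<forall>U\<in>W ` (C \<inter> K i). openin T U"
      using WL by blast
    moreover have "C \<inter> K i \<subseteq> \<Union>(W ` (C \<inter> K i))"
      using WL by blast
    ultimately have "\<exists>\<F>. finite \<F> \<and> \<F> \<subseteq> W ` (C \<inter> K i) \<and> C \<inter> K i \<subseteq> \<Union>\<F>"
      unfolding compactin_def by simp
    then obtain P where P: "finite P" "P \<subseteq> C \<inter> K i" "C \<inter> K i \<subseteq> \<Union>(W ` P)"
      by (metis finite_subset_image)
    show ?thesis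
    proof (intro exI[of _ "L ` P"] conjI ballI)
      show "compactin T M" if "M \<in> L ` P" for M
        using that P(2) WL by blast
      fix x assume "x \<in> C \<inter> K i"
      then obtain p where "p \<in> P" "x \<in> W p" using P(3) by blast
      then show "\<exists>M\<in>L ` P. \<exists>W. openin T W \<and> x \<in> W \<and> W \<inter> K i \<subseteq> M"
        using WL[of p] P(2) by blast
    qed (simp add: P(1))
  qed
  then have "\<forall>C. \<exists>\<L>. compactin T C \<longrightarrow> countable \<L> \<and> (\<forall>L\<in>\<L>. compactin T L) \<and>
      (\<forall>i. \<forall>x\<in>C \<inter> K i. \<exists>L\<in>\<L>. \<exists>W. openin T W \<and> x \<in> W \<and> W \<inter> K i \<subseteq> L)"
  proof (intro allI)
    fix C
    assume ex: "\<And>C i. compactin T C \<Longrightarrow> \<exists>\<L>. finite \<L> \<and> (\<forall>L\<in>\<L>. compactin T L) \<and>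
      (\<forall>x\<in>C \<inter> K i. \<exists>L\<in>\<L>. \<exists>W. openin T W \<and> x \<in> W \<and> W \<inter> K i \<subseteq> L)"
    show "\<exists>\<L>. compactin T C \<longrightarrow> countable \<L> \<and> (\<forall>L\<in>\<L>. compactin T L) \<and>
      (\<forall>i. \<forall>x\<in>C \<inter> K i. \<exists>L\<in>\<L>. \<exists>W. openin T W \<and> x \<in> W \<and> W \<inter> K i \<subseteq> L)"
    proof (cases "compactin T C")
      case True
      obtain \<L> where \<L>: "\<And>i. finite (\<L> i)" "\<And>i. \<forall>L\<in>\<L> i. compactin T L"
          "\<And>i. \<forall>x\<in>C \<inter> K i. \<exists>L\<in>\<L> i. \<exists>W. openin T W \<and> x \<in> W \<and> W \<inter> K i \<subseteq> L"
        using ex[OF True] by metis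
      have "countable (\<Union>i. \<L> i)"
        using \<L>(1) by (simp add: countable_finite)
      moreover have "\<forall>L\<in>(\<Union>i. \<L> i). compactin T L" using \<L>(2) by blast
      moreover have "\<forall>i. \<forall>x\<in>C \<inter> K i. \<exists>L\<in>(\<Union>i. \<L> i). \<exists>W. openin T W \<and> x \<in> W \<and> W \<inter> K i \<subseteq> L"
      proof (intro allI ballI)
        fix i x assume "x \<in> C \<inter> K i"
        from bspec[OF \<L>(3) this] show "\<exists>L\<in>(\<Union>i. \<L> i). \<exists>W. openin T W \<and> x \<in> W \<and> W \<inter> K i \<subseteq> L"
          by (elim bexE) (rule bexI, assumption, blast)
      qed
      ultimately show ?thesis by (intro exI[of _ "\<Union>i. \<L> i"] impI conjI)
    qed simp
  qed
  then obtain N where N: "\<And>C. compactin T C \<Longrightarrow> countable (N C)"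
      "\<And>C L. compactin T C \<Longrightarrow> L \<in> N C \<Longrightarrow> compactin T L"
      "\<And>C i x. compactin T C \<Longrightarrow> x \<in> C \<Longrightarrow> x \<in> K i \<Longrightarrow> \<exists>L\<in>N C. \<exists>W. openin T W \<and> x \<in> W \<and> W \<inter> K i \<subseteq> L"
    by (metis IntI)
  let ?m = "\<lambda>(C, D). (\<lambda>(x, y). x \<otimes> y) ` (C \<times> D)"
  let ?i = "\<lambda>C. (\<lambda>x. inv x) ` C"
  define step where "step \<D> = \<D> \<union> \<Union>(N ` \<D>) \<union> ?m ` (\<D> \<times> \<D>) \<union> ?i ` \<D>" for \<D>
  define \<C> where "\<C> n = (step ^^ n) (insert {\<one>} ((\<lambda>x. {x}) ` S))" for n
  have \<C>_Suc: "\<C> (Suc n) = step (\<C> n)" for n by (simp add: \<C>_def)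
  have \<C>_mono: "\<C> i \<subseteq> \<C> j" if "i \<le> j" for i j
    using that by (rule lift_Suc_mono_le[of \<C>, rotated]) (auto simp: \<C>_Suc step_def)
  have cmpt: "\<forall>C\<in>\<C> n. compactin T C" for n
  proof (induction n)
    case 0
    then show ?case using S(2) by (auto simp: \<C>_def)
  next
    case (Suc n)
    have "compactin T (?m (C, D))" if "C \<in> \<C> n" "D \<in> \<C> n" for C D
    proof -
      have "compactin (prod_topology T T) (C \<times> D)"
        using Suc that by (simp add: compactin_Times)
      then show ?thesis
        using image_compactin[OF _ continuous_mult] by simp
    qed
    moreover have "compactin T (?i C)" if "C \<in> \<C> n" for C
      using Suc that by (auto intro: image_compactin[OF _ continuous_inv])
    ultimately show ?case
      using Suc N(2) unfolding \<C>_Suc step_def by blast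
  qed
  have cnt: "countable (\<C> n)" for n
  proof (induction n)
    case 0
    then show ?case using S(1) by (simp add: \<C>_def)
  next
    case (Suc n)
    then have "countable (\<Union>(N ` \<C> n))"
      using N(1) cmpt by (intro countable_UN) auto
    then show ?case
      using Suc unfolding \<C>_Suc step_def by simp
  qed
  define H where "H = \<Union>(\<Union>n. \<C> n)"
  have mem_H: "x \<in> H \<longleftrightarrow> (\<exists>n. \<exists>C\<in>\<C> n. x \<in> C)" for x
    unfolding H_def by blast
  have H_sub: "H \<subseteq> carrier G"
    using cmpt compactin_subset_topspace unfolding H_def by fastforce
  have "subgroup H G"
  proof (rule subgroupI)
    show "H \<subseteq> carrier G" by (rule H_sub)
    have "\<one> \<in> H" unfolding mem_H by (intro exI[of _ 0]) (simp add: \<C>_def)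
    then show "H \<noteq> {}" by blast
    fix x assume "x \<in> H"
    then obtain n C where C: "C \<in> \<C> n" "x \<in> C" unfolding mem_H by blast
    have "?i C \<in> \<C> (Suc n)" using C(1) unfolding \<C>_Suc step_def by blast
    then show "inv x \<in> H" using C(2) unfolding mem_H by blast
    fix y assume "y \<in> H"
    then obtain k D where D: "D \<in> \<C> k" "y \<in> D" unfolding mem_H by blast
    have "C \<in> \<C> (max n k)" "D \<in> \<C> (max n k)"
      using C D \<C>_mono[of n "max n k"] \<C>_mono[of k "max n k"] by auto
    then have "?m (C, D) \<in> \<C> (Suc (max n k))"
      unfolding \<C>_Suc step_def by blast
    moreover have "x \<otimes> y \<in> ?m (C, D)" using C(2) D(2) by auto
    ultimately show "x \<otimes> y \<in> H"
      unfolding mem_H by (intro exI[of _ "Suc (max n k)"] bexI[of _ "?m (C, D)"])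
  qed
  moreover have "S \<subseteq> H"
  proof
    fix x assume "x \<in> S"
    then have "{x} \<in> \<C> 0" by (simp add: \<C>_def)
    then show "x \<in> H" unfolding mem_H by blast
  qed
  moreover have "countable (\<Union>n. \<C> n)" using cnt by simp
  moreover have "\<Union>(\<Union>n. \<C> n) = H" by (simp add: H_def)
  moreover have "compactin T C" if "C \<in> (\<Union>n. \<C> n)" for C
    using that cmpt by blast
  \<comment> \<open>A point of \<open>U\<close> in \<open>K i\<close> lies in some \<open>C\<close>
    of a stage \<open>n\<close>. Stage \<open>Suc n\<close> contains a compact \<open>L\<close> that
    includes a neighbourhood of the point in \<open>K i\<close>, and openness of
    \<open>U \<inter> L\<close> in \<open>L\<close> passes to \<open>K i\<close>.\<close>
  moreover have "openin T U" if U: "U \<subseteq> H"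
      and op: "\<And>C. C \<in> (\<Union>n. \<C> n) \<Longrightarrow> openin (subtopology T C) (U \<inter> C)" for U
  proof (rule openinI)
    show "U \<subseteq> carrier G" using U H_sub by blast
    fix i
    show "openin (subtopology T (K i)) (U \<inter> K i)"
    proof (subst openin_subopen, intro ballI)
      fix x assume x: "x \<in> U \<inter> K i"
      then obtain n C where C: "C \<in> \<C> n" "x \<in> C" using U unfolding mem_H subset_iff by blast
      have "compactin T C" using C(1) cmpt by blast
      from N(3)[OF this C(2)] x obtain L W where L: "L \<in> N C" and W: "openin T W" "x \<in> W" "W \<inter> K i \<subseteq> L"
        by blast
      have "L \<in> \<C> (Suc n)" using L C(1) unfolding \<C>_Suc step_def by blast
      then have "openin (subtopology T L) (U \<inter> L)" by (intro op) blast
      then obtain V where V: "openin T V" "U \<inter> L = V \<inter> L"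
        unfolding openin_subtopology by blast
      have "openin (subtopology T (K i)) ((V \<inter> W) \<inter> K i)"
        using V(1) W(1) by (intro openin_subtopology_Int openin_Int)
      moreover have "x \<in> (V \<inter> W) \<inter> K i" using V(2) W x by blast
      moreover have "(V \<inter> W) \<inter> K i \<subseteq> U \<inter> K i" using V(2) W(3) by blast
      ultimately show "\<exists>N. openin (subtopology T (K i)) N \<and> x \<in> N \<and> N \<subseteq> U \<inter> K i" by blast
    qed
  qed
  ultimately show ?thesis by (rule that)
qed

end

section \<open>Derived sets of subspaces\<close>

lemma nonisolated_points_iff:
  assumes "A \<subseteq> topspace X"
  shows "x \<in> nonisolated_points X A \<longleftrightarrow> x \<in> A \<and> (\<forall>V. openin X V \<and> x \<in> V \<longrightarrow> (\<exists>y\<in>A. y \<in> V \<and> y \<noteq> x))"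
proof -
  have "isolated_point X A x \<longleftrightarrow> (\<exists>V. openin X V \<and> x \<in> V \<and> (\<forall>y\<in>A. y \<in> V \<longrightarrow> y = x))" if "x \<in> A"
  proof
    assume "isolated_point X A x"
    then obtain V where V: "openin X V" "{x} = V \<inter> A"
      unfolding isolated_point_def openin_subtopology by blast
    have "x \<in> V" "\<forall>y\<in>A. y \<in> V \<longrightarrow> y = x" using V(2) by auto
    then show "\<exists>V. openin X V \<and> x \<in> V \<and> (\<forall>y\<in>A. y \<in> V \<longrightarrow> y = x)"
      using V(1) by blast
  next
    assume "\<exists>V. openin X V \<and> x \<in> V \<and> (\<forall>y\<in>A. y \<in> V \<longrightarrow> y = x)"
    then obtain V where V: "openin X V" "x \<in> V" "\<forall>y\<in>A. y \<in> V \<longrightarrow> y = x" by blast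
    then have "{x} = V \<inter> A" using that by blast
    then show "isolated_point X A x"
      unfolding isolated_point_def openin_subtopology using V(1) by blast
  qed
  then show ?thesis
    unfolding nonisolated_points_def by blast
qed

text \<open>One condition on all smaller ordinals replaces the recursion through zero, successors
  and limits, so that later inductions need no case distinction.\<close>

lemma iter_derived_iff:
  fixes s :: "'b rel"
  assumes "Well_order s"
  shows "x \<in> iter_derived X s \<longleftrightarrow>
    x \<in> topspace X \<and> (\<forall>t. t <o s \<longrightarrow> x \<in> nonisolated_points X (iter_derived X (t :: 'b rel)))"
proof (intro iffI conjI allI impI)
  assume x: "x \<in> iter_derived X s"
  show "x \<in> topspace X"
    using x iter_derived_subset[OF assms, of X] by blast
  show "x \<in> nonisolated_points X (iter_derived X t)" if "t <o s" for t :: "'b rel"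
    using x iter_derived_less[OF that, of X] by blast
next
  assume x: "x \<in> topspace X \<and> (\<forall>t. t <o s \<longrightarrow> x \<in> nonisolated_points X (iter_derived X (t :: 'b rel)))"
  show "x \<in> iter_derived X s"
  proof (cases "s = {}")
    case True
    then show ?thesis using x by (simp add: iter_derived_zero)
  next
    case False
    show ?thesis
    proof (cases "\<exists>p. ord_covers p s")
      case True
      then obtain p where p: "ord_covers p s" ..
      then have "p <o s" by (simp add: ord_covers_def)
      then show ?thesis
        using x unfolding iter_derived_succ[OF p] by blast
    next
      case limit: False
      show ?thesis
        unfolding iter_derived_limit[OF False limit]
        using x by (auto simp: nonisolated_points_def)
    qed
  qed
qed

text \<open>Ordinals below \<open>s\<close> have isomorphic copies below \<open>s'\<close> over the
  other type, and conversely; the induction hypothesis applies to these. Needed because the ranks of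
  two groups live over different types.\<close>

lemma iter_derived_ordIso_types:
  fixes s :: "'b rel" and s' :: "'c rel"
  assumes "s =o s'"
  shows "iter_derived X s = iter_derived X s'"
  using assms
proof (induction s arbitrary: s' rule: wf_induct_rule[OF wf_ordLess])
  case (1 s)
  have wo: "Well_order s" "Well_order s'"
    using 1(2) by (auto simp: ordIso_def)
  have "(\<forall>t. t <o s \<longrightarrow> x \<in> nonisolated_points X (iter_derived X (t :: 'b rel))) \<longleftrightarrow>
      (\<forall>t. t <o s' \<longrightarrow> x \<in> nonisolated_points X (iter_derived X (t :: 'c rel)))" for x
  proof (intro iffI allI impI)
    fix t' :: "'c rel"
    assume all: "\<forall>t. t <o s \<longrightarrow> x \<in> nonisolated_points X (iter_derived X (t :: 'b rel))" and "t' <o s'"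
    then have "t' <o s"
      using 1(2) ordIso_symmetric ordLess_ordIso_trans by blast
    then obtain t :: "'b rel" where t: "t' =o t" "t <o s"
      using internalize_ordLess[of t' s] by blast
    then have "iter_derived X t = iter_derived X t'"
      using 1(1)[of t t'] ordIso_symmetric by blast
    then show "x \<in> nonisolated_points X (iter_derived X t')"
      using all t(2) by auto
  next
    fix t :: "'b rel"
    assume all: "\<forall>t. t <o s' \<longrightarrow> x \<in> nonisolated_points X (iter_derived X (t :: 'c rel))" and "t <o s"
    then have "t <o s'"
      using 1(2) ordLess_ordIso_trans by blast
    then obtain t' :: "'c rel" where t: "t =o t'" "t' <o s'"
      using internalize_ordLess[of t s'] by blast
    then have "iter_derived X t = iter_derived X t'"
      using 1(1)[of t t'] \<open>t <o s\<close> by blast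
    then show "x \<in> nonisolated_points X (iter_derived X t)"
      using all t(2) by auto
  qed
  then show ?case
    using iter_derived_iff[OF wo(1), of _ X] iter_derived_iff[OF wo(2), of _ X] by blast
qed

text \<open>The type of \<open>s\<close> is independent of the type of points: a compact set can be
  measured by an index that is represented over the type of another space.\<close>

definition derived :: "'a topology \<Rightarrow> 'a set \<Rightarrow> 'b rel \<Rightarrow> 'a set" where
  "derived X K s = iter_derived (subtopology X K) s"

lemma derived_subset:
  assumes "Well_order s"
  shows "derived X K s \<subseteq> K"
  using iter_derived_subset[OF assms, of "subtopology X K"] unfolding derived_def by auto

lemma derived_ordIso:
  fixes s :: "'b rel" and s' :: "'c rel"
  assumes "s =o s'"
  shows "derived X K s = derived X K s'"
  unfolding derived_def using assms by (rule iter_derived_ordIso_types)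

lemma derived_iff:
  fixes s :: "'b rel"
  assumes K: "K \<subseteq> topspace X" and "Well_order s"
  shows "x \<in> derived X K s \<longleftrightarrow> x \<in> K \<and>
    (\<forall>t :: 'b rel. t <o s \<longrightarrow> (\<forall>V. openin X V \<and> x \<in> V \<longrightarrow> (\<exists>y\<in>derived X K t. y \<in> V \<and> y \<noteq> x)))"
  using assms(2)
proof (induction s rule: wf_induct_rule[OF wf_ordLess])
  case (1 s)
  let ?Y = "subtopology X K"
  have top: "topspace ?Y = K" using K by auto
  have "x \<in> nonisolated_points ?Y (iter_derived ?Y t) \<longleftrightarrow>
      x \<in> derived X K t \<and> (\<forall>V. openin X V \<and> x \<in> V \<longrightarrow> (\<exists>y\<in>derived X K t. y \<in> V \<and> y \<noteq> x))"
    if t: "t <o s" and x: "x \<in> K" for t :: "'b rel"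
  proof -
    have "Well_order t" using t by (simp add: ordLess_def)
    then have sub: "iter_derived ?Y t \<subseteq> topspace ?Y" by (rule iter_derived_subset)
    have "(\<forall>V. openin ?Y V \<and> x \<in> V \<longrightarrow> (\<exists>y\<in>derived X K t. y \<in> V \<and> y \<noteq> x)) \<longleftrightarrow>
        (\<forall>V. openin X V \<and> x \<in> V \<longrightarrow> (\<exists>y\<in>derived X K t. y \<in> V \<and> y \<noteq> x))"
    proof (intro iffI allI impI)
      fix V assume *: "\<forall>V. openin ?Y V \<and> x \<in> V \<longrightarrow> (\<exists>y\<in>derived X K t. y \<in> V \<and> y \<noteq> x)"
        and V: "openin X V \<and> x \<in> V"
      have "openin ?Y (V \<inter> K)" using V by (simp add: openin_subtopology_Int)
      then show "\<exists>y\<in>derived X K t. y \<in> V \<and> y \<noteq> x"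
        using *[rule_format, of "V \<inter> K"] V x by blast
    next
      fix V assume *: "\<forall>V. openin X V \<and> x \<in> V \<longrightarrow> (\<exists>y\<in>derived X K t. y \<in> V \<and> y \<noteq> x)"
        and V: "openin ?Y V \<and> x \<in> V"
      then obtain W where W: "openin X W" "V = W \<inter> K"
        unfolding openin_subtopology by blast
      then obtain y where "y \<in> derived X K t" "y \<in> W" "y \<noteq> x"
        using * V by blast
      moreover have "y \<in> K"
        using calculation(1) derived_subset[OF \<open>Well_order t\<close>, of X K] by blast
      ultimately show "\<exists>y\<in>derived X K t. y \<in> V \<and> y \<noteq> x"
        using W(2) by blast
    qed
    then show ?thesis
      unfolding nonisolated_points_iff[OF sub] unfolding derived_def by simp
  qed
  note noniso = this
  have mem: "x \<in> derived X K t"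
    if "x \<in> K" and all: "\<forall>t :: 'b rel. t <o s \<longrightarrow> (\<forall>V. openin X V \<and> x \<in> V \<longrightarrow> (\<exists>y\<in>derived X K t. y \<in> V \<and> y \<noteq> x))"
      and t: "t <o s" for t :: "'b rel"
  proof -
    have "Well_order t" using t by (simp add: ordLess_def)
    moreover have "\<forall>V. openin X V \<and> x \<in> V \<longrightarrow> (\<exists>y\<in>derived X K t'. y \<in> V \<and> y \<noteq> x)"
      if "t' <o t" for t' :: "'b rel"
      using all ordLess_transitive[OF that t] by blast
    ultimately show ?thesis
      using 1(1)[OF t] \<open>x \<in> K\<close> by blast
  qed
  have iff: "x \<in> derived X K s \<longleftrightarrow> x \<in> K \<and> (\<forall>t :: 'b rel. t <o s \<longrightarrow> x \<in> nonisolated_points ?Y (iter_derived ?Y t))"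
    unfolding derived_def iter_derived_iff[OF 1(2)] top by (rule refl)
  show ?case
    unfolding iff
  proof (intro iffI conjI allI impI)
    assume x: "x \<in> K \<and> (\<forall>t :: 'b rel. t <o s \<longrightarrow> x \<in> nonisolated_points ?Y (iter_derived ?Y t))"
    then show "x \<in> K" by simp
    fix t :: "'b rel" and V assume "t <o s" "openin X V \<and> x \<in> V"
    then show "\<exists>y\<in>derived X K t. y \<in> V \<and> y \<noteq> x"
      using x noniso[of t] by simp
  next
    assume x: "x \<in> K \<and> (\<forall>t :: 'b rel. t <o s \<longrightarrow> (\<forall>V. openin X V \<and> x \<in> V \<longrightarrow> (\<exists>y\<in>derived X K t. y \<in> V \<and> y \<noteq> x)))"
    then show "x \<in> K" by simp
    fix t :: "'b rel" assume t: "t <o s"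
    show "x \<in> nonisolated_points ?Y (iter_derived ?Y t)"
      using noniso[OF t] mem[OF _ _ t] x t by simp
  qed
qed

lemma derived_accumulates:
  fixes s :: "'b rel" and t :: "'c rel"
  assumes K: "K \<subseteq> topspace X" and ts: "t <o s" and x: "x \<in> derived X K s" "openin X V" "x \<in> V"
  obtains y where "y \<in> derived X K t" "y \<in> V" "y \<noteq> x"
proof -
  obtain t' :: "'b rel" where t': "t =o t'" "t' <o s"
    using internalize_ordLess[of t s] ts by blast
  have "Well_order s" using ts by (simp add: ordLess_def)
  then obtain y where "y \<in> derived X K t'" "y \<in> V" "y \<noteq> x"
    using x t'(2) derived_iff[OF K] by blast
  then show ?thesis
    using that derived_ordIso[OF t'(1), of X K] by blast
qed

lemma derived_antimono:
  fixes s :: "'b rel" and t :: "'c rel"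
  assumes K: "K \<subseteq> topspace X" and "t \<le>o s"
  shows "derived X K s \<subseteq> derived X K t"
proof -
  consider "t <o s" | "t =o s"
    using assms(2) ordLeq_iff_ordLess_or_ordIso by blast
  then show ?thesis
  proof cases
    case 1
    then obtain t' :: "'b rel" where t': "t =o t'" "t' <o s"
      using internalize_ordLess[of t s] by blast
    have "iter_derived (subtopology X K) s \<subseteq> iter_derived (subtopology X K) t'"
      using iter_derived_less[OF t'(2), of "subtopology X K"] unfolding nonisolated_points_def by blast
    then show ?thesis
      unfolding derived_ordIso[OF t'(1)] unfolding derived_def .
  next
    case 2
    then show ?thesis by (simp add: derived_ordIso)
  qed
qed

lemma derived_mono:
  fixes s :: "'b rel"
  assumes L: "L \<subseteq> topspace X" and KL: "K \<subseteq> L" and "Well_order s"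
  shows "derived X K s \<subseteq> derived X L s"
  using assms(3)
proof (induction s rule: wf_induct_rule[OF wf_ordLess])
  case (1 s)
  have K: "K \<subseteq> topspace X" using L KL by blast
  have IH: "derived X K t \<subseteq> derived X L t" if "t <o s" for t :: "'b rel"
    using 1(1)[OF that] that by (simp add: ordLess_def)
  show ?case
    using IH KL unfolding subset_iff derived_iff[OF K 1(2)] derived_iff[OF L 1(2)] by meson
qed

lemma derived_open_subset:
  fixes s :: "'b rel"
  assumes K: "K \<subseteq> topspace X" and V: "openin X V" and "Well_order s"
  shows "derived X K s \<inter> V \<subseteq> derived X (K \<inter> V) s"
  using assms(3)
proof (induction s rule: wf_induct_rule[OF wf_ordLess])
  case (1 s)
  have KV: "K \<inter> V \<subseteq> topspace X" using K by blast
  have IH: "derived X K t \<inter> V \<subseteq> derived X (K \<inter> V) t" if "t <o s" for t :: "'b rel"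
    using 1(1)[OF that] that by (simp add: ordLess_def)
  show ?case
  proof
    fix x assume x: "x \<in> derived X K s \<inter> V"
    show "x \<in> derived X (K \<inter> V) s"
      unfolding derived_iff[OF KV 1(2)]
    proof (intro conjI allI impI)
      show "x \<in> K \<inter> V" using x derived_subset[OF 1(2), of X K] by blast
      fix t :: "'b rel" and W assume t: "t <o s" and W: "openin X W \<and> x \<in> W"
      have "openin X (W \<inter> V)" using W V by blast
      then obtain y where "y \<in> derived X K t" "y \<in> W \<inter> V" "y \<noteq> x"
        using x W derived_accumulates[OF K t] by blast
      then show "\<exists>y\<in>derived X (K \<inter> V) t. y \<in> W \<and> y \<noteq> x"
        using IH[OF t] by blast
    qed
  qed
qed

text \<open>Continuity keeps accumulating points close to the limit and injectivity keeps them
  different from it.\<close>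

lemma derived_image:
  fixes s :: "'c rel"
  assumes K: "K \<subseteq> topspace X" and f: "continuous_map (subtopology X K) Y f" "inj_on f K"
    and "Well_order s"
  shows "f ` derived X K s \<subseteq> derived Y (f ` K) s"
  using assms(4)
proof (induction s rule: wf_induct_rule[OF wf_ordLess])
  case (1 s)
  have fK: "f ` K \<subseteq> topspace Y"
    using continuous_map_image_subset_topspace[OF f(1)] K by (simp add: inf.absorb2)
  have IH: "f ` derived X K t \<subseteq> derived Y (f ` K) t" if "t <o s" for t :: "'c rel"
    using 1(1)[OF that] that by (simp add: ordLess_def)
  show ?case
  proof clarify
    fix x assume x: "x \<in> derived X K s"
    have xK: "x \<in> K" using x derived_subset[OF 1(2), of X K] by blast
    show "f x \<in> derived Y (f ` K) s"
      unfolding derived_iff[OF fK 1(2)]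
    proof (intro conjI allI impI)
      show "f x \<in> f ` K" using xK by blast
      fix t :: "'c rel" and V assume t: "t <o s" and V: "openin Y V \<and> f x \<in> V"
      obtain W where W: "openin X W" "x \<in> W" "\<And>y. y \<in> K \<Longrightarrow> y \<in> W \<Longrightarrow> f y \<in> V"
        using continuous_map_subtopology_nbhd[OF f(1) K xK] V by blast
      obtain y where y: "y \<in> derived X K t" "y \<in> W" "y \<noteq> x"
        using derived_accumulates[OF K t x W(1,2)] by blast
      have "Well_order t" using t by (simp add: ordLess_def)
      then have "y \<in> K" using y(1) derived_subset[of t X K] by blast
      then have "f y \<noteq> f x" using inj_onD[OF f(2)] xK y(3) by blast
      then show "\<exists>z\<in>derived Y (f ` K) t. z \<in> V \<and> z \<noteq> f x"
        using IH[OF t] y W(3)[OF \<open>y \<in> K\<close>] by blast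
    qed
  qed
qed

text \<open>Each derived set before stage \<open>s\<close> is infinite and so accumulates in
  \<open>K\<close>. The sets of accumulation points are closed and decrease with the ordinal, so by
  compactness they have a common point, which survives to stage \<open>s\<close>. At the
  scatteredness index this yields a point of the first finite derived set.\<close>

lemma derived_nonempty:
  fixes s :: "'b rel"
  assumes X: "Hausdorff_space X" and K: "compactin X K" "K \<noteq> {}" and s: "Well_order s"
    and inf: "\<And>t :: 'b rel. t <o s \<Longrightarrow> infinite (derived X K t)"
  shows "derived X K s \<noteq> {}"
proof -
  have KX: "K \<subseteq> topspace X" using K(1) by (rule compactin_subset_topspace)
  let ?d = "\<lambda>t :: 'b rel. X derived_set_of (derived X K t)"
  have "K \<inter> \<Inter>(?d ` {t. t <o s}) \<noteq> {}"
  proof (rule K(1)[unfolded compactin_fip, THEN conjunct2, rule_format], intro conjI ballI allI impI)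
    show "closedin X C" if "C \<in> ?d ` {t. t <o s}" for C
      using that closedin_derived_set_of[OF X] by auto
    fix \<F> assume "finite \<F> \<and> \<F> \<subseteq> ?d ` {t. t <o s}"
    then have "\<exists>P. P \<subseteq> {t. t <o s} \<and> finite P \<and> \<F> = ?d ` P"
      by (intro finite_subset_image) simp_all
    then obtain P where P: "finite P" "P \<subseteq> {t. t <o s}" "\<F> = ?d ` P"
      by (elim exE conjE)
    have max: "P = {} \<or> (\<exists>m\<in>P. \<forall>t\<in>P. t \<le>o m)"
      using P(1,2)
    proof (induction P rule: finite_induct)
      case (insert t P)
      have wt: "Well_order t" using insert.prems by (auto simp: ordLess_def)
      show ?case
      proof (cases "P = {}")
        case True
        then show ?thesis using ordLeq_reflexive[OF wt] by blast
      next
        case False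
        then obtain m where m: "m \<in> P" "\<forall>t\<in>P. t \<le>o m" using insert by blast
        then have "Well_order m" using insert.prems by (auto simp: ordLess_def)
        then consider "t \<le>o m" | "m \<le>o t" using ordLeq_total[OF wt] by blast
        then show ?thesis
        proof cases
          case 1
          then show ?thesis using m by blast
        next
          case 2
          then show ?thesis using m(2) ordLeq_reflexive[OF wt] ordLeq_transitive by blast
        qed
      qed
    qed simp
    show "K \<inter> \<Inter>\<F> \<noteq> {}"
    proof (cases "P = {}")
      case True
      then show ?thesis using K(2) P(3) by simp
    next
      case False
      then obtain m where m: "m \<in> P" "\<forall>t\<in>P. t \<le>o m" using max by blast
      have "m <o s" using m(1) P(2) by blast
      then have "infinite (derived X K m)" "derived X K m \<subseteq> K"
        using inf derived_subset[of m X K] by (auto simp: ordLess_def)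
      then obtain a where a: "a \<in> K" "a \<in> ?d m"
        using compactin_imp_Bolzano_Weierstrass[OF K(1), of "derived X K m"] by blast
      have "a \<in> ?d t" if "t \<in> P" for t
        using a(2) derived_set_of_mono[OF derived_antimono[OF KX m(2)[rule_format, OF that]], of X] by blast
      then show ?thesis using a(1) P(3) by blast
    qed
  qed
  then obtain a where a: "a \<in> K" "\<And>t. t <o s \<Longrightarrow> a \<in> ?d t" by blast
  have "a \<in> derived X K s"
    unfolding derived_iff[OF KX s]
  proof (intro conjI allI impI)
    fix t :: "'b rel" and V assume "t <o s" and V: "openin X V \<and> a \<in> V"
    then have "a \<in> ?d t" using a(2) by blast
    then show "\<exists>y\<in>derived X K t. y \<in> V \<and> y \<noteq> a"
      using V unfolding derived_set_of_def mem_Collect_eq by blast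
  qed (rule a(1))
  then show ?thesis by blast
qed

section \<open>Perfect and scattered subsets\<close>

text \<open>For compact subsets of a Hausdorff space this means perfect.\<close>

definition dense_in_itself :: "'a topology \<Rightarrow> 'a set \<Rightarrow> bool" where
  "dense_in_itself X A \<longleftrightarrow> (\<forall>x\<in>A. \<forall>V. openin X V \<and> x \<in> V \<longrightarrow> (\<exists>y\<in>A. y \<in> V \<and> y \<noteq> x))"

lemma scattered_subtopology_iff:
  assumes K: "K \<subseteq> topspace X"
  shows "scattered_space (subtopology X K) \<longleftrightarrow> (\<forall>A. A \<subseteq> K \<and> A \<noteq> {} \<longrightarrow> \<not> dense_in_itself X A)"
proof -
  have eq: "(\<exists>a\<in>A. isolated_point (subtopology X K) A a) \<longleftrightarrow> \<not> dense_in_itself X A" if A: "A \<subseteq> K" for A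
  proof -
    have AX: "A \<subseteq> topspace X" using A K by blast
    have sub: "subtopology (subtopology X K) A = subtopology X A"
      using A by (simp add: subtopology_subtopology inf.absorb2)
    have "dense_in_itself X A \<longleftrightarrow> (\<forall>a\<in>A. a \<in> nonisolated_points X A)"
      unfolding nonisolated_points_iff[OF AX] dense_in_itself_def by blast
    then show ?thesis
      unfolding nonisolated_points_def isolated_point_def sub by blast
  qed
  have "topspace (subtopology X K) = K" using K by auto
  then show ?thesis
    unfolding scattered_space_def using eq by auto
qed

lemma dense_in_itself_image:
  assumes A: "A \<subseteq> topspace X" "dense_in_itself X A"
    and f: "continuous_map (subtopology X A) Y f" "inj_on f A"
  shows "dense_in_itself Y (f ` A)"
  unfolding dense_in_itself_def
proof (intro ballI allI impI)
  fix z V assume "z \<in> f ` A" and V: "openin Y V \<and> z \<in> V"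
  then obtain x where x: "x \<in> A" "z = f x" by blast
  obtain W where W: "openin X W" "x \<in> W" "\<And>y. y \<in> A \<Longrightarrow> y \<in> W \<Longrightarrow> f y \<in> V"
    using continuous_map_subtopology_nbhd[OF f(1) A(1) x(1)] V x(2) by blast
  obtain y where "y \<in> A" "y \<in> W" "y \<noteq> x"
    using A(2) x(1) W(1,2) unfolding dense_in_itself_def by blast
  then show "\<exists>y\<in>f ` A. y \<in> V \<and> y \<noteq> z"
    using W(3) x inj_onD[OF f(2)] by blast
qed

lemma compact_image_of_injective:
  assumes K: "compactin X K" and Y: "Hausdorff_space Y"
    and f: "continuous_map (subtopology X K) Y f" "inj_on f K"
  shows "compactin Y (f ` K)" and "continuous_map (subtopology Y (f ` K)) X (inv_into K f)"
proof -
  have KX: "K \<subseteq> topspace X" using K by (rule compactin_subset_topspace)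
  have im: "compactin Y (f ` C)" if "compactin X C" "C \<subseteq> K" for C
    using that by (intro image_compactin[OF _ f(1)]) (simp add: compactin_subtopology)
  show cpt: "compactin Y (f ` K)" using im[OF K] by blast
  show "continuous_map (subtopology Y (f ` K)) X (inv_into K f)"
  proof (rule continuous_map_subtopology_pointwiseI)
    show "f ` K \<subseteq> topspace Y" using cpt by (rule compactin_subset_topspace)
    show "inv_into K f z \<in> topspace X" if "z \<in> f ` K" for z
      using inv_into_into[OF that] KX by blast
    fix z V assume z: "z \<in> f ` K" and V: "openin X V" "inv_into K f z \<in> V"
    have "closedin X (topspace X - V)" using V(1) by blast
    then have "compactin X (K \<inter> (topspace X - V))"
      using K by (rule compact_Int_closedin[rotated])
    then have "closedin Y (f ` (K \<inter> (topspace X - V)))"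
      using im by (intro compactin_imp_closedin[OF Y]) blast
    then have "openin Y (topspace Y - f ` (K \<inter> (topspace X - V)))" by blast
    moreover have "z \<in> topspace Y - f ` (K \<inter> (topspace X - V))"
      using z V(2) inv_into_f_f[OF f(2)] cpt compactin_subset_topspace by fastforce
    moreover have "\<forall>y\<in>f ` K. y \<in> topspace Y - f ` (K \<inter> (topspace X - V)) \<longrightarrow> inv_into K f y \<in> V"
      using KX inv_into_f_f[OF f(2)] by auto
    ultimately show "\<exists>W. openin Y W \<and> z \<in> W \<and> (\<forall>y\<in>f ` K. y \<in> W \<longrightarrow> inv_into K f y \<in> V)"
      by blast
  qed
qed

text \<open>The inverse of the embedding would carry a dense-in-itself subset of the image back into
  \<open>K\<close>.\<close>

lemma scattered_image:
  assumes K: "compactin X K" "scattered_space (subtopology X K)" and Y: "Hausdorff_space Y"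
    and f: "continuous_map (subtopology X K) Y f" "inj_on f K"
  shows "scattered_space (subtopology Y (f ` K))"
proof -
  have KX: "K \<subseteq> topspace X" using K(1) by (rule compactin_subset_topspace)
  note inv = compact_image_of_injective[OF K(1) Y f]
  have fK: "f ` K \<subseteq> topspace Y" using inv(1) by (rule compactin_subset_topspace)
  show ?thesis
    unfolding scattered_subtopology_iff[OF fK]
  proof (intro allI impI notI)
    fix A assume A: "A \<subseteq> f ` K \<and> A \<noteq> {}" and dii: "dense_in_itself Y A"
    have "continuous_map (subtopology Y A) X (inv_into K f)"
      using inv(2) A by (blast intro: continuous_map_from_subtopology_mono)
    moreover have "inj_on (inv_into K f) A"
      using A by (blast intro: inj_on_inv_into)
    ultimately have "dense_in_itself X (inv_into K f ` A)"
      using dii by (intro dense_in_itself_image[of A Y] order_trans[OF _ fK]) (use A in simp_all)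
    moreover have "inv_into K f ` A \<subseteq> K" using A by (auto intro: inv_into_into)
    ultimately show False
      using K(2) A unfolding scattered_subtopology_iff[OF KX] by blast
  qed
qed

section \<open>Ranks and homeomorphisms\<close>

lemma infinite_derived_iff:
  fixes s :: "'c rel" and K :: "'a set"
  assumes K: "K \<subseteq> topspace X" "scattered_space (subtopology X K)" and s: "Well_order s"
  shows "infinite (derived X K s) \<longleftrightarrow> s <o scatteredness_index (subtopology X K)"
proof
  let ?i = "scatteredness_index (subtopology X K)"
  note i = scatteredness_index[OF K(2)]
  assume inf: "infinite (derived X K s)"
  show "s <o ?i"
  proof (rule ccontr)
    assume "\<not> s <o ?i"
    then have "?i \<le>o s" using not_ordLess_iff_ordLeq[OF i(1) s] by blast
    then have "derived X K s \<subseteq> derived X K ?i" by (rule derived_antimono[OF K(1)])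
    then show False using inf i(2) unfolding derived_def by (metis finite_subset)
  qed
next
  let ?i = "scatteredness_index (subtopology X K)"
  note i = scatteredness_index[OF K(2)]
  assume "s <o ?i"
  then obtain p :: "'a set rel" where p: "s =o p" "p <o ?i"
    using internalize_ordLess[of s ?i] by blast
  have "Well_order p" using p(2) by (simp add: ordLess_def)
  show "infinite (derived X K s)"
  proof
    assume "finite (derived X K s)"
    then have "finite (iter_derived (subtopology X K) p)"
      unfolding derived_ordIso[OF p(1)] unfolding derived_def .
    then have "?i \<le>o p" using i(3) \<open>Well_order p\<close> by blast
    then show False using p(2) not_ordLess_ordLeq by blast
  qed
qed

text \<open>By minimality of the supremum some index exceeds \<open>s\<close>, and an index exceeds
  \<open>s\<close> precisely when the derived set at \<open>s\<close> is infinite. The type of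
  \<open>s\<close> is free, which the comparison of two groups requires.\<close>

lemma ordLess_rank_iff:
  fixes s :: "'c rel" and X :: "'a topology"
  assumes s: "Well_order s"
  shows "s <o compact_scatteredness_rank X \<longleftrightarrow>
    (\<exists>K. compactin X K \<and> scattered_space (subtopology X K) \<and> infinite (derived X K s))"
proof
  let ?r = "compact_scatteredness_rank X"
  note r = compact_scatteredness_rank[where X = X]
  assume "s <o ?r"
  then obtain p :: "'a set rel" where p: "s =o p" "p <o ?r"
    using internalize_ordLess[of s ?r] by blast
  have wp: "Well_order p" using p(2) by (simp add: ordLess_def)
  have "\<not> ?r \<le>o p" using p(2) not_ordLess_ordLeq by blast
  then obtain K where K: "compactin X K" "scattered_space (subtopology X K)"
      "\<not> scatteredness_index (subtopology X K) \<le>o p"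
    using r(3)[OF wp] by blast
  have "p <o scatteredness_index (subtopology X K)"
    using K(3) not_ordLeq_iff_ordLess[OF wp scatteredness_index(1)[OF K(2)]] by blast
  then have "s <o scatteredness_index (subtopology X K)"
    using p(1) ordIso_ordLess_trans by blast
  then show "\<exists>K. compactin X K \<and> scattered_space (subtopology X K) \<and> infinite (derived X K s)"
    using K infinite_derived_iff[OF compactin_subset_topspace[OF K(1)] K(2) s] by blast
next
  assume "\<exists>K. compactin X K \<and> scattered_space (subtopology X K) \<and> infinite (derived X K s)"
  then obtain K where K: "compactin X K" "scattered_space (subtopology X K)" "infinite (derived X K s)"
    by blast
  then have "s <o scatteredness_index (subtopology X K)"
    using infinite_derived_iff[OF compactin_subset_topspace[OF K(1)] K(2) s] by blast
  then show "s <o compact_scatteredness_rank X"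
    using compact_scatteredness_rank(2)[OF K(1,2)] ordLess_ordLeq_trans by blast
qed

text \<open>A continuous injection embeds compact sets, keeps them scattered and maps derived sets
  into derived sets, so every ordinal below the rank of \<open>X\<close> is below that of
  \<open>Y\<close>.\<close>

lemma rank_le_of_injective_map:
  assumes f: "continuous_map X Y f" "inj_on f (topspace X)" and Y: "Hausdorff_space Y"
  shows "compact_scatteredness_rank X \<le>o compact_scatteredness_rank Y"
proof (rule ccontr)
  let ?s = "compact_scatteredness_rank Y"
  note wo = compact_scatteredness_rank(1)
  assume "\<not> ?thesis"
  then have "?s <o compact_scatteredness_rank X"
    using not_ordLeq_iff_ordLess[OF wo wo] by blast
  then obtain K where K: "compactin X K" "scattered_space (subtopology X K)" "infinite (derived X K ?s)"
    unfolding ordLess_rank_iff[OF wo] by blast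
  have KX: "K \<subseteq> topspace X" using K(1) by (rule compactin_subset_topspace)
  have fK: "continuous_map (subtopology X K) Y f" "inj_on f K"
    using f KX by (auto intro: continuous_map_from_subtopology inj_on_subset)
  have "infinite (f ` derived X K ?s)"
    using K(3) fK(2) derived_subset[OF wo, of X K] by (meson finite_imageD inj_on_subset)
  then have "infinite (derived Y (f ` K) ?s)"
    using derived_image[OF KX fK wo] finite_subset by blast
  then have "?s <o ?s"
    using compact_image_of_injective(1)[OF K(1) Y fK] scattered_image[OF K(1,2) Y fK]
    unfolding ordLess_rank_iff[OF wo] by blast
  then show False using ordLess_irreflexive by blast
qed

lemma homeomorphic_imp_rank_eq:
  assumes "X homeomorphic_space Y" "Hausdorff_space X" "Hausdorff_space Y"
  shows "compact_scatteredness_rank X =o compact_scatteredness_rank Y"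
proof -
  obtain f g where "homeomorphic_maps X Y f g"
    using assms(1) unfolding homeomorphic_space_def by blast
  then have fg: "continuous_map X Y f" "continuous_map Y X g"
      "\<And>x. x \<in> topspace X \<Longrightarrow> g (f x) = x" "\<And>y. y \<in> topspace Y \<Longrightarrow> f (g y) = y"
    unfolding homeomorphic_maps_def by auto
  have inj: "inj_on f (topspace X)" "inj_on g (topspace Y)"
    using fg(3,4) by (auto intro: inj_on_inverseI)
  show ?thesis
    unfolding ordIso_iff_ordLeq
    using rank_le_of_injective_map[OF fg(1) inj(1) assms(3)]
      rank_le_of_injective_map[OF fg(2) inj(2) assms(2)] by (rule conjI)
qed

lemma density_le_of_surjective_map:
  assumes f: "continuous_map X Y f" "f ` topspace X = topspace Y"
  shows "space_density Y \<le>o space_density X"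
proof (rule space_density[of X])
  fix D assume D: "dense_in X D" "space_density X = |D|"
  have "f ` (X closure_of D) \<subseteq> Y closure_of (f ` D)"
    using f(1) unfolding continuous_map_eq_image_closure_subset by (simp add: image_subset_iff_funcset)
  then have "Y closure_of (f ` D) = topspace Y"
    using D(1) f(2) closure_of_subset_topspace[of Y "f ` D"] unfolding dense_in_def by simp
  moreover have "f ` D \<subseteq> topspace Y"
    using D(1) f(2) unfolding dense_in_def by blast
  ultimately have dense: "dense_in Y (f ` D)" unfolding dense_in_def by simp
  have "space_density Y \<le>o |f ` D|"
  proof (rule space_density[of Y])
    fix E assume "\<And>E'. dense_in Y E' \<Longrightarrow> space_density Y \<le>o |E'|"
    then show ?thesis using dense .
  qed
  then show ?thesis
    unfolding D(2) by (rule ordLeq_transitive[OF _ card_of_image])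
qed

lemma homeomorphic_imp_density_eq:
  assumes "X homeomorphic_space Y"
  shows "space_density X =o space_density Y"
proof -
  obtain f g where fg: "homeomorphic_maps X Y f g"
    using assms(1) unfolding homeomorphic_space_def by (elim exE)
  then have f: "homeomorphic_map X Y f" and g: "homeomorphic_map Y X g"
    using homeomorphic_maps_map homeomorphic_maps_sym by blast+
  show ?thesis
    unfolding ordIso_iff_ordLeq
    using density_le_of_surjective_map[OF homeomorphic_imp_continuous_map[OF g] homeomorphic_imp_surjective_map[OF g]]
      density_le_of_surjective_map[OF homeomorphic_imp_continuous_map[OF f] homeomorphic_imp_surjective_map[OF f]]
    by (rule conjI)
qed

section \<open>Zero-dimensional compact sets\<close>

definition agree :: "nat \<Rightarrow> (nat \<Rightarrow> bool) \<Rightarrow> (nat \<Rightarrow> bool) \<Rightarrow> bool" where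
  "agree n x y \<longleftrightarrow> (\<forall>i<n. x i = y i)"

lemma agree_refl [simp]: "agree n x x"
  by (simp add: agree_def)

lemma agree_sym: "agree n x y \<Longrightarrow> agree n y x"
  by (simp add: agree_def)

lemma agree_trans: "agree n x y \<Longrightarrow> agree n y z \<Longrightarrow> agree n x z"
  by (simp add: agree_def)

lemma agree_mono: "agree n x y \<Longrightarrow> m \<le> n \<Longrightarrow> agree m x y"
  by (simp add: agree_def)

lemma agree_all_imp_eq: "(\<And>n. agree n x y) \<Longrightarrow> x = y"
  by (rule ext) (metis agree_def lessI)

definition cyl :: "('a \<Rightarrow> nat \<Rightarrow> bool) \<Rightarrow> 'a set \<Rightarrow> nat \<Rightarrow> 'a \<Rightarrow> 'a set" where
  "cyl \<phi> A n x = {y \<in> A. agree n (\<phi> x) (\<phi> y)}"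

lemma cyl_self: "x \<in> A \<Longrightarrow> x \<in> cyl \<phi> A n x"
  by (simp add: cyl_def)

lemma cyl_subset: "cyl \<phi> A n x \<subseteq> A"
  by (auto simp: cyl_def)

lemma cyl_antimono: "m \<le> n \<Longrightarrow> cyl \<phi> A n x \<subseteq> cyl \<phi> A m x"
  by (auto simp: cyl_def agree_mono)

lemma cyl_eq: "y \<in> cyl \<phi> A n x \<Longrightarrow> m \<le> n \<Longrightarrow> cyl \<phi> A m y = cyl \<phi> A m x"
  by (auto simp: cyl_def) (meson agree_mono agree_sym agree_trans)+

text \<open>\<open>\<phi>\<close> embeds \<open>A\<close> into the Cantor cube; its continuity is
  expressed by one pair of complementary open sets for each coordinate. So \<open>A\<close> is
  compact, metrizable and zero-dimensional.\<close>

definition coded :: "'a topology \<Rightarrow> 'a set \<Rightarrow> ('a \<Rightarrow> nat \<Rightarrow> bool) \<Rightarrow> bool" where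
  "coded X A \<phi> \<longleftrightarrow> compactin X A \<and> inj_on \<phi> A \<and>
     (\<forall>n. openin (subtopology X A) {x \<in> A. \<phi> x n} \<and> openin (subtopology X A) {x \<in> A. \<not> \<phi> x n})"

lemma coded_imp_compactin: "coded X A \<phi> \<Longrightarrow> compactin X A"
  by (simp add: coded_def)

lemma coded_imp_subset: "coded X A \<phi> \<Longrightarrow> A \<subseteq> topspace X"
  by (simp add: coded_def compactin_subset_topspace)

lemma coded_imp_inj: "coded X A \<phi> \<Longrightarrow> inj_on \<phi> A"
  by (simp add: coded_def)

lemma coded_subset:
  assumes "coded X A \<phi>" "compactin X B" "B \<subseteq> A"
  shows "coded X B \<phi>"
proof -
  have "openin (subtopology X B) {x \<in> B. P x}" if "openin (subtopology X A) {x \<in> A. P x}" for P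
  proof -
    have "openin (subtopology (subtopology X A) B) ({x \<in> A. P x} \<inter> B)"
      using that by (rule openin_subtopology_Int)
    moreover have "subtopology (subtopology X A) B = subtopology X B"
      using assms(3) by (simp add: subtopology_subtopology inf.absorb2)
    moreover have "{x \<in> A. P x} \<inter> B = {x \<in> B. P x}" using assms(3) by auto
    ultimately show ?thesis by simp
  qed
  then show ?thesis
    using assms(1,2) inj_on_subset[OF _ assms(3), of \<phi>] unfolding coded_def by simp
qed

lemma openin_cyl:
  assumes "coded X A \<phi>"
  shows "openin (subtopology X A) (cyl \<phi> A n x)"
proof (induction n)
  case 0
  have "cyl \<phi> A 0 x = A" by (auto simp: cyl_def agree_def)
  then show ?case
    using openin_topspace[of "subtopology X A"] coded_imp_subset[OF assms] by (simp add: inf.absorb2)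
next
  case (Suc n)
  have "openin (subtopology X A) {y \<in> A. \<phi> y n = \<phi> x n}"
    using assms unfolding coded_def by (cases "\<phi> x n") simp_all
  moreover have "cyl \<phi> A (Suc n) x = cyl \<phi> A n x \<inter> {y \<in> A. \<phi> y n = \<phi> x n}"
    by (auto simp: cyl_def agree_def less_Suc_eq)
  ultimately show ?case using Suc openin_Int by simp
qed

lemma openin_Diff_cyl:
  assumes "coded X A \<phi>"
  shows "openin (subtopology X A) (A - cyl \<phi> A n x)"
proof -
  have "A - cyl \<phi> A n x = (\<Union>y\<in>A - cyl \<phi> A n x. cyl \<phi> A n y)"
  proof (intro equalityI subsetI)
    fix y assume "y \<in> A - cyl \<phi> A n x"
    then show "y \<in> (\<Union>y\<in>A - cyl \<phi> A n x. cyl \<phi> A n y)"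
      using cyl_self[of y A] by blast
  next
    fix y assume "y \<in> (\<Union>y\<in>A - cyl \<phi> A n x. cyl \<phi> A n y)"
    then obtain z where z: "z \<in> A - cyl \<phi> A n x" "y \<in> cyl \<phi> A n z" by blast
    then have "y \<notin> cyl \<phi> A n x"
      unfolding cyl_def by simp (meson agree_sym agree_trans)
    then show "y \<in> A - cyl \<phi> A n x" using z(2) cyl_subset[of \<phi> A n z] by blast
  qed
  moreover have "openin (subtopology X A) (\<Union>y\<in>A - cyl \<phi> A n x. cyl \<phi> A n y)"
    using openin_cyl[OF assms] by (intro openin_clauses(3)) auto
  ultimately show ?thesis by simp
qed

lemma compactin_complement_openin:
  assumes A: "compactin X A" and C: "C \<subseteq> A" "openin (subtopology X A) (A - C)"
  shows "compactin X C"
proof -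
  have AX: "A \<subseteq> topspace X" using A by (rule compactin_subset_topspace)
  obtain V where V: "openin X V" "A - C = V \<inter> A"
    using C(2) unfolding openin_subtopology by blast
  have "C = A \<inter> (topspace X - V)" using V(2) C(1) AX by blast
  moreover have "closedin X (topspace X - V)" using V(1) by blast
  ultimately show ?thesis using compact_Int_closedin[OF A] by simp
qed

lemma compactin_cyl:
  assumes "coded X A \<phi>"
  shows "compactin X (cyl \<phi> A n x)"
  using compactin_complement_openin[OF coded_imp_compactin[OF assms] cyl_subset openin_Diff_cyl[OF assms]] .

lemma compactin_nested:
  fixes C :: "nat \<Rightarrow> 'a set"
  assumes A: "compactin X A" and sub: "\<And>n. C n \<subseteq> A"
    and clo: "\<And>n. openin (subtopology X A) (A - C n)"
    and ne: "\<And>n. C n \<noteq> {}" and dec: "\<And>n. C (Suc n) \<subseteq> C n"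
  shows "(\<Inter>n. C n) \<noteq> {}"
proof (rule compact_space_imp_nest[of "subtopology X A"])
  have AX: "A \<subseteq> topspace X" using A by (rule compactin_subset_topspace)
  show "compact_space (subtopology X A)" using A by (simp add: compact_space_subtopology)
  have top: "topspace (subtopology X A) = A" using AX by auto
  show "closedin (subtopology X A) (C n)" for n
    unfolding closedin_def top using sub clo by blast
  show "decseq C" using dec by (rule decseq_SucI)
qed (rule ne)

text \<open>If every cylinder about \<open>x\<close> left \<open>V\<close>, compactness would give a
  point outside \<open>V\<close> with the same code as \<open>x\<close>.\<close>

lemma coded_nbhd:
  assumes co: "coded X A \<phi>" and x: "x \<in> A" "openin X V" "x \<in> V"
  obtains n where "cyl \<phi> A n x \<subseteq> V"
proof -
  have "\<exists>n. cyl \<phi> A n x \<subseteq> V"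
  proof (rule ccontr)
    assume no: "\<not> ?thesis"
    have "(\<Inter>n. cyl \<phi> A n x - V) \<noteq> {}"
    proof (rule compactin_nested[OF coded_imp_compactin[OF co]])
      show "cyl \<phi> A n x - V \<subseteq> A" for n
        using cyl_subset[of \<phi> A n x] by blast
      show "cyl \<phi> A n x - V \<noteq> {}" for n using no by auto
      show "cyl \<phi> A (Suc n) x - V \<subseteq> cyl \<phi> A n x - V" for n
        using cyl_antimono[of n "Suc n" \<phi> A x] by auto
      have "A - (cyl \<phi> A n x - V) = (A - cyl \<phi> A n x) \<union> (V \<inter> A)" for n by blast
      then show "openin (subtopology X A) (A - (cyl \<phi> A n x - V))" for n
        using openin_Diff_cyl[OF co, of n x] openin_subtopology_Int[OF x(2), of A] by (simp add: openin_Un)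
    qed
    then obtain y where y: "\<And>n. y \<in> cyl \<phi> A n x" "y \<notin> V" by blast
    then have "\<phi> x = \<phi> y" "y \<in> A"
      unfolding cyl_def by (auto intro: agree_all_imp_eq)
    then have "x = y" using inj_onD[OF coded_imp_inj[OF co]] x(1) by blast
    then show False using y(2) x(3) by blast
  qed
  then show ?thesis using that by blast
qed

lemma coded_openin_cyl:
  assumes "coded X A \<phi>"
  obtains W where "openin X W" "W \<inter> A = cyl \<phi> A n x"
proof -
  obtain W where "openin X W" "cyl \<phi> A n x = W \<inter> A"
    using openin_cyl[OF assms, of n x] unfolding openin_subtopology by blast
  then show ?thesis using that by simp
qed

text \<open>One point is picked from each nonempty cylinder; cylinders are named by finite lists of
  bits.\<close>

lemma coded_separable:
  assumes "coded X A \<phi>"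
  obtains D where "countable D" "D \<subseteq> A" "A \<subseteq> X closure_of D"
proof -
  define code where "code n x = map (\<phi> x) [0..<n]" for n x
  have code_eq: "agree n (\<phi> x) (\<phi> y) \<longleftrightarrow> code n x = code n y" for n x y
    unfolding agree_def code_def by auto
  define D where "D = (\<lambda>l. SOME x. x \<in> A \<and> code (length l) x = l) ` {l. \<exists>x\<in>A. code (length l) x = l}"
  have pick: "(SOME x. x \<in> A \<and> code (length l) x = l) \<in> A"
      "code (length l) (SOME x. x \<in> A \<and> code (length l) x = l) = l" if "\<exists>x\<in>A. code (length l) x = l" for l
    using someI_ex[of "\<lambda>x. x \<in> A \<and> code (length l) x = l"] that by blast+
  show ?thesis
  proof (rule that[of D])
    show "countable D" unfolding D_def by simp
    show "D \<subseteq> A" unfolding D_def using pick(1) by auto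
    show "A \<subseteq> X closure_of D"
    proof
      fix x assume x: "x \<in> A"
      have "\<exists>y\<in>D. y \<in> V" if V: "openin X V" "x \<in> V" for V
      proof -
        obtain n where n: "cyl \<phi> A n x \<subseteq> V" using coded_nbhd[OF assms x V] .
        have len: "length (code n x) = n" by (simp add: code_def)
        then have ex: "\<exists>z\<in>A. code (length (code n x)) z = code n x" using x by auto
        let ?y = "SOME y. y \<in> A \<and> code (length (code n x)) y = code n x"
        have "?y \<in> D" unfolding D_def using ex by blast
        moreover have "?y \<in> cyl \<phi> A n x"
          using pick[OF ex] len unfolding cyl_def code_eq by simp
        ultimately show ?thesis using n by blast
      qed
      then show "x \<in> X closure_of D"
        using x coded_imp_subset[OF assms] unfolding in_closure_of by blast
    qed
  qed
qed

section \<open>Coding the compact subsets of punctiform spaces\<close>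

text \<open>The closed balls about finite nets form a network rather than a base. Networks of
  several pieces can be united, whereas a set open in one piece need not be open in the union; and
  clopen separation takes compact sets as input.\<close>

lemma compact_metrizable_network:
  assumes M: "compactin X M" "metrizable_space (subtopology X M)"
  obtains \<B> where "countable \<B>" "\<And>B. B \<in> \<B> \<Longrightarrow> compactin X B" "\<And>B. B \<in> \<B> \<Longrightarrow> B \<subseteq> M"
    "\<And>x V. x \<in> M \<Longrightarrow> openin X V \<Longrightarrow> x \<in> V \<Longrightarrow> \<exists>B\<in>\<B>. x \<in> B \<and> B \<subseteq> V"
proof -
  obtain M' m where M': "Metric_space M' m" "subtopology X M = Metric_space.mtopology M' m"
    using M(2) unfolding metrizable_space_def by (elim exE conjE)
  have "topspace (subtopology X M) = M'"
    unfolding M'(2) by (rule Metric_space.topspace_mtopology[OF M'(1)])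
  then have "M' = M" using compactin_subset_topspace[OF M(1)] by auto
  then have m: "Metric_space M m" "subtopology X M = Metric_space.mtopology M m"
    using M' by auto
  have cm: "compactin (subtopology X M) M" using M(1) by (simp add: compactin_subtopology)
  then have tb: "Metric_space.mtotally_bounded M m M"
    unfolding m(2) by (rule Metric_space.compactin_imp_mtotally_bounded[OF m(1)])
  have "\<exists>P. finite P \<and> P \<subseteq> M \<and> M \<subseteq> (\<Union>x\<in>P. Metric_space.mball M m x (inverse (real (Suc n))))" for n
    by (rule tb[unfolded Metric_space.mtotally_bounded_def[OF m(1)], rule_format]) simp
  then obtain P where P: "\<And>n. finite (P n)" "\<And>n. P n \<subseteq> M"
      "\<And>n. M \<subseteq> (\<Union>x\<in>P n. Metric_space.mball M m x (inverse (real (Suc n))))"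
    by metis
  let ?b = "\<lambda>n x. Metric_space.mcball M m x (inverse (real (Suc n)))"
  show ?thesis
  proof (rule that[of "\<Union>n. ?b n ` P n"])
    show "countable (\<Union>n. ?b n ` P n)"
      using P(1) by (simp add: countable_finite)
    show "compactin X B" if "B \<in> (\<Union>n. ?b n ` P n)" for B
    proof -
      obtain n x where B: "B = ?b n x" using \<open>B \<in> _\<close> by auto
      have "closedin (subtopology X M) B"
        unfolding B m(2) by (rule Metric_space.closedin_mcball[OF m(1)])
      moreover have "B \<subseteq> M"
        unfolding B by (rule Metric_space.mcball_subset_mspace[OF m(1)])
      ultimately have "compactin (subtopology X M) B"
        by (intro closed_compactin[OF cm])
      then show ?thesis by (simp add: compactin_subtopology)
    qed
    show "B \<subseteq> M" if "B \<in> (\<Union>n. ?b n ` P n)" for B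
      using \<open>B \<in> _\<close> Metric_space.mcball_subset_mspace[OF m(1)] by auto
    fix x V assume x: "x \<in> M" "openin X V" "x \<in> V"
    have "openin (Metric_space.mtopology M m) (V \<inter> M)"
      unfolding m(2)[symmetric] using x(2) by (rule openin_subtopology_Int)
    then obtain r where r: "r > 0" "Metric_space.mball M m x r \<subseteq> V \<inter> M"
      unfolding Metric_space.openin_mtopology[OF m(1)] using x by blast
    \<comment> \<open>Half of \<open>r\<close>, because a ball that contains \<open>x\<close>
      reaches up to twice its radius away from \<open>x\<close>.\<close>
    obtain n where n: "inverse (real (Suc n)) < r / 2"
      using reals_Archimedean[of "r / 2"] r(1) by auto
    obtain p where p: "p \<in> P n" "x \<in> Metric_space.mball M m p (inverse (real (Suc n)))"
      using P(3)[of n] x(1) by blast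
    have d: "m p x < inverse (real (Suc n))" "p \<in> M"
      using p(2) unfolding Metric_space.mball_def[OF m(1)] by auto
    have "x \<in> ?b n p"
      using d x(1) unfolding Metric_space.mcball_def[OF m(1)] by simp
    moreover have "?b n p \<subseteq> V"
    proof
      fix y assume "y \<in> ?b n p"
      then have y: "y \<in> M" "m p y \<le> inverse (real (Suc n))"
        unfolding Metric_space.mcball_def[OF m(1)] by auto
      have "m x y \<le> m x p + m p y"
        using Metric_space.triangle[OF m(1) x(1) d(2) y(1)] .
      also have "m x p = m p x" by (rule Metric_space.commute[OF m(1)])
      finally have "m x y < r" using d(1) y(2) n by linarith
      then have "y \<in> Metric_space.mball M m x r"
        using x(1) y(1) unfolding Metric_space.mball_def[OF m(1)] by simp
      then show "y \<in> V" using r(2) by blast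
    qed
    moreover have "?b n p \<in> (\<Union>n. ?b n ` P n)" using p(1) by blast
    ultimately show "\<exists>B\<in>(\<Union>n. ?b n ` P n). x \<in> B \<and> B \<subseteq> V" by (intro bexI[of _ "?b n p"] conjI)
  qed
qed

text \<open>In the compact Hausdorff space \<open>Q\<close> quasi-components are components. The
  closure of a connected set is compact and connected, hence trivial, so points are separated by
  clopen sets, and compactness extends this to \<open>A\<close> and \<open>B\<close>.\<close>

lemma punctiform_compact_clopen_separation:
  assumes X: "Hausdorff_space X" "punctiform_space X" and Q: "compactin X Q"
    and AB: "compactin X A" "compactin X B" "A \<subseteq> Q" "B \<subseteq> Q" "A \<inter> B = {}"
  obtains C where "openin (subtopology X Q) C" "openin (subtopology X Q) (Q - C)" "A \<subseteq> C" "B \<inter> C = {}"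
proof -
  let ?Y = "subtopology X Q"
  have QX: "Q \<subseteq> topspace X" using Q by (rule compactin_subset_topspace)
  then have top: "topspace ?Y = Q" by auto
  have Y: "compact_space ?Y" "Hausdorff_space ?Y"
    using Q X(1) by (auto simp: compact_space_subtopology Hausdorff_space_subtopology)
  have eq: "quasi_component_of ?Y x = connected_component_of ?Y x" for x
    using Y by (intro quasi_eq_connected_component_of) auto
  have sep: "separated_between ?Y {x} {y}" if xy: "x \<in> Q" "y \<in> Q" "x \<noteq> y" for x y
  proof -
    have "\<not> connected_component_of ?Y x y"
    proof
      assume "connected_component_of ?Y x y"
      then obtain C where C: "connectedin ?Y C" "x \<in> C" "y \<in> C"
        unfolding connected_component_of_def by blast
      let ?D = "?Y closure_of C"
      have D: "connectedin ?Y ?D" using C(1) by (rule connectedin_closure_of)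
      have "compactin ?Y ?D"
        using Y(1) by (intro closedin_compact_space) auto
      moreover have "C \<subseteq> ?D"
        using connectedin_subset_topspace[OF C(1)] by (rule closure_of_subset)
      ultimately show False
        using X(2) D C(2,3) xy(3) unfolding punctiform_space_def
        by (metis compactin_subtopology connectedin_subtopology subsetD)
    qed
    then show ?thesis
      unfolding separated_between_singletons top eq using xy by blast
  qed
  have cA: "compactin ?Y A" and cB: "compactin ?Y B"
    using AB by (auto simp: compactin_subtopology)
  have "separated_between ?Y {x} {y}" if "x \<in> A" "y \<in> B" for x y
    using that AB(3-5) by (intro sep) auto
  then have "separated_between ?Y {x} B" if "x \<in> A" for x
    unfolding separated_between_pointwise_right[OF cB] using that AB(3) top by auto
  then have "separated_between ?Y A B"
    unfolding separated_between_pointwise_left[OF cA] using AB(4) top by auto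
  then obtain C where C: "closedin ?Y C" "openin ?Y C" "A \<subseteq> C" "B \<subseteq> topspace ?Y - C"
    unfolding separated_between by blast
  have "openin ?Y (Q - C)" using C(1) unfolding closedin_def top by blast
  then show ?thesis using that C by blast
qed

text \<open>Countably many clopen sets, one for each disjoint pair from a countable network of
  compact sets, separate the points; membership in the \<open>n\<close>-th of them is the
  \<open>n\<close>-th bit of the code.\<close>

lemma punctiform_compact_coded:
  assumes X: "Hausdorff_space X" "punctiform_space X" and Q: "compactin X Q"
    and I: "finite I" "Q = (\<Union>i\<in>I. M i)"
    and M: "\<And>i. i \<in> I \<Longrightarrow> compactin X (M i)" "\<And>i. i \<in> I \<Longrightarrow> metrizable_space (subtopology X (M i))"
  obtains \<phi> where "coded X Q \<phi>"
proof -
  have "\<forall>i\<in>I. \<exists>\<B>. countable \<B> \<and> (\<forall>B\<in>\<B>. compactin X B) \<and> (\<forall>B\<in>\<B>. B \<subseteq> M i) \<and>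
      (\<forall>x V. x \<in> M i \<longrightarrow> openin X V \<longrightarrow> x \<in> V \<longrightarrow> (\<exists>B\<in>\<B>. x \<in> B \<and> B \<subseteq> V))"
  proof
    fix i assume "i \<in> I"
    then have Mi: "compactin X (M i)" "metrizable_space (subtopology X (M i))"
      using M by simp_all
    show "\<exists>\<B>. countable \<B> \<and> (\<forall>B\<in>\<B>. compactin X B) \<and> (\<forall>B\<in>\<B>. B \<subseteq> M i) \<and>
      (\<forall>x V. x \<in> M i \<longrightarrow> openin X V \<longrightarrow> x \<in> V \<longrightarrow> (\<exists>B\<in>\<B>. x \<in> B \<and> B \<subseteq> V))"
    proof (rule compact_metrizable_network[OF Mi])
      fix \<B>
      assume "countable \<B>" "\<And>B. B \<in> \<B> \<Longrightarrow> compactin X B" "\<And>B. B \<in> \<B> \<Longrightarrow> B \<subseteq> M i"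
        "\<And>x V. x \<in> M i \<Longrightarrow> openin X V \<Longrightarrow> x \<in> V \<Longrightarrow> \<exists>B\<in>\<B>. x \<in> B \<and> B \<subseteq> V"
      then show ?thesis by (intro exI[of _ \<B>] conjI ballI allI impI) simp_all
    qed
  qed
  from bchoice[OF this] obtain b where b: "\<forall>i\<in>I. countable (b i) \<and> (\<forall>B\<in>b i. compactin X B) \<and> (\<forall>B\<in>b i. B \<subseteq> M i) \<and>
      (\<forall>x V. x \<in> M i \<longrightarrow> openin X V \<longrightarrow> x \<in> V \<longrightarrow> (\<exists>B\<in>b i. x \<in> B \<and> B \<subseteq> V))" ..
  define \<B> where "\<B> = (\<Union>i\<in>I. b i)"
  have \<B>: "countable \<B>" "\<And>B. B \<in> \<B> \<Longrightarrow> compactin X B" "\<And>B. B \<in> \<B> \<Longrightarrow> B \<subseteq> Q"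
  proof -
    show "countable \<B>" unfolding \<B>_def using b I(1) by (simp add: countable_finite)
    fix B assume "B \<in> \<B>"
    then obtain i where i: "i \<in> I" "B \<in> b i" unfolding \<B>_def by (elim UN_E)
    then show "compactin X B" using b by simp
    have "B \<subseteq> M i" using b i by simp
    then show "B \<subseteq> Q" using i(1) I(2) by auto
  qed
  have net: "\<exists>B\<in>\<B>. x \<in> B \<and> B \<subseteq> V" if x: "x \<in> Q" "openin X V" "x \<in> V" for x V
  proof -
    obtain i where i: "i \<in> I" "x \<in> M i" using x(1) I(2) by auto
    then have "\<exists>B\<in>b i. x \<in> B \<and> B \<subseteq> V" using b x(2,3) by simp
    then show ?thesis using i(1) unfolding \<B>_def by auto
  qed
  let ?good = "\<lambda>C. openin (subtopology X Q) C \<and> openin (subtopology X Q) (Q - C)"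
  define \<P> where "\<P> = {p \<in> \<B> \<times> \<B>. fst p \<inter> snd p = {}}"
  have "\<forall>p\<in>\<P>. \<exists>C. ?good C \<and> fst p \<subseteq> C \<and> snd p \<inter> C = {}"
  proof
    fix p assume "p \<in> \<P>"
    then have p: "fst p \<in> \<B>" "snd p \<in> \<B>" "fst p \<inter> snd p = {}"
      unfolding \<P>_def by auto
    show "\<exists>C. ?good C \<and> fst p \<subseteq> C \<and> snd p \<inter> C = {}"
    proof (rule punctiform_compact_clopen_separation[OF X Q \<B>(2)[OF p(1)] \<B>(2)[OF p(2)] \<B>(3)[OF p(1)] \<B>(3)[OF p(2)] p(3)])
      fix C
      assume "openin (subtopology X Q) C" "openin (subtopology X Q) (Q - C)" "fst p \<subseteq> C" "snd p \<inter> C = {}"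
      then show ?thesis by (intro exI[of _ C] conjI)
    qed
  qed
  then obtain c where c: "\<forall>p\<in>\<P>. ?good (c p) \<and> fst p \<subseteq> c p \<and> snd p \<inter> c p = {}"
    by (rule bchoice[THEN exE])
  \<comment> \<open>The empty set keeps the family nonempty, as \<open>from_nat_into\<close>
    requires.\<close>
  define \<C> where "\<C> = insert {} (c ` \<P>)"
  have "countable (\<B> \<times> \<B>)" using \<B>(1) by simp
  then have "countable \<P>"
    by (rule countable_subset[rotated]) (simp add: \<P>_def)
  then have \<C>: "countable \<C>" "\<C> \<noteq> {}" unfolding \<C>_def by simp_all
  have QX: "Q \<subseteq> topspace X" using Q by (rule compactin_subset_topspace)
  have "openin (subtopology X Q) Q"
    using openin_topspace[of "subtopology X Q"] QX by (simp add: inf.absorb2)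
  then have good: "?good C" if C: "C \<in> \<C>" for C
  proof (cases "C = {}")
    case False
    then obtain p where "p \<in> \<P>" "C = c p" using C unfolding \<C>_def by auto
    then show ?thesis using c by simp
  qed simp
  define \<phi> where "\<phi> x n \<longleftrightarrow> x \<in> from_nat_into \<C> n" for x n
  have fn: "from_nat_into \<C> n \<in> \<C>" for n using \<C>(2) by (rule from_nat_into)
  have "coded X Q \<phi>"
    unfolding coded_def
  proof (intro conjI allI)
    show "compactin X Q" by (rule Q)
    fix n
    have sub: "from_nat_into \<C> n \<subseteq> Q"
      using openin_subset[OF conjunct1[OF good[OF fn[of n]]]] by simp
    then have "{x \<in> Q. \<phi> x n} = from_nat_into \<C> n" "{x \<in> Q. \<not> \<phi> x n} = Q - from_nat_into \<C> n"
      unfolding \<phi>_def by auto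
    then show "openin (subtopology X Q) {x \<in> Q. \<phi> x n}" "openin (subtopology X Q) {x \<in> Q. \<not> \<phi> x n}"
      using good[OF fn[of n]] by auto
  next
    show "inj_on \<phi> Q"
    proof (rule inj_onI, rule ccontr)
      fix x y assume xy: "x \<in> Q" "y \<in> Q" "\<phi> x = \<phi> y" "x \<noteq> y"
      obtain U V where UV: "openin X U" "openin X V" "x \<in> U" "y \<in> V" "disjnt U V"
        using X(1)[unfolded Hausdorff_space_def, rule_format, of x y] xy QX by auto
      obtain A where A: "A \<in> \<B>" "x \<in> A" "A \<subseteq> U" using net[OF xy(1) UV(1,3)] by blast
      obtain B where B: "B \<in> \<B>" "y \<in> B" "B \<subseteq> V" using net[OF xy(2) UV(2,4)] by blast
      have "(A, B) \<in> \<P>"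
        using A B UV(5) unfolding \<P>_def disjnt_def by auto
      then have "A \<subseteq> c (A, B)" "B \<inter> c (A, B) = {}" "c (A, B) \<in> \<C>"
        using bspec[OF c, of "(A, B)"] unfolding \<C>_def by simp_all
      then have "x \<in> c (A, B)" "y \<notin> c (A, B)" "c (A, B) \<in> \<C>"
        using A(2) B(2) by auto
      moreover obtain n where "from_nat_into \<C> n = c (A, B)"
        using from_nat_into_surj[OF \<C>(1) calculation(3)] by blast
      ultimately have "\<phi> x n \<noteq> \<phi> y n" unfolding \<phi>_def by simp
      then show False using xy(3) by simp
    qed
  qed
  then show ?thesis by (rule that)
qed

section \<open>Extending embeddings of compact sets\<close>

context t1_group
begin

lemma carrier_of_compactin: "compactin T C \<Longrightarrow> C \<subseteq> carrier G"
  using compactin_subset_topspace[of T C] by simp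

lemma openin_Diff_compactin:
  assumes "openin T V" "compactin T C"
  shows "openin T (V - C)"
  using openin_diff[OF assms(1) compactin_imp_closedin[OF Hausdorff assms(2)]] .

text \<open>A tube argument: each point of \<open>A\<close> has a neighbourhood and a stage that
  keep products out of \<open>C\<close>, and finitely many such neighbourhoods cover
  \<open>A\<close>. The bound \<open>j\<close> lets the stage grow with the piece to be
  placed.\<close>

lemma translates_avoid_compact:
  assumes A: "compactin T A" and C: "compactin T C" and dis: "C \<inter> A = {}"
    and N: "\<And>k. N (Suc k) \<subseteq> N k" "\<And>V. openin T V \<Longrightarrow> \<one> \<in> V \<Longrightarrow> \<exists>k::nat. N k \<subseteq> V"
  obtains k where "k \<ge> j" "\<And>a n. a \<in> A \<Longrightarrow> n \<in> N k \<Longrightarrow> a \<otimes> n \<notin> C"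
proof -
  have N_dec: "N k \<subseteq> N i" if "i \<le> k" for i k
    using that by (rule lift_Suc_antimono_le[of N, OF N(1)])
  have Ac: "A \<subseteq> carrier G" using A by (rule carrier_of_compactin)
  have ex: "\<forall>a\<in>A. \<exists>V. openin T V \<and> a \<in> V \<and> (\<exists>k. \<forall>v\<in>V. \<forall>n\<in>N k. v \<otimes> n \<notin> C)"
  proof
    fix a assume a: "a \<in> A"
    then have ac: "a \<in> carrier G" using Ac by blast
    have op: "openin T (carrier G - C)"
      using openin_Diff_compactin[OF _ C, of "carrier G"] openin_topspace[of T] by simp
    have "a \<otimes> \<one> \<in> carrier G - C" using a ac dis by auto
    from mult_nbhd[OF op this ac one_closed] obtain V W
      where VW: "openin T V" "openin T W" "a \<in> V" "\<one> \<in> W" "\<And>v w. v \<in> V \<Longrightarrow> w \<in> W \<Longrightarrow> v \<otimes> w \<in> carrier G - C"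
      by metis
    obtain k where "N k \<subseteq> W" using N(2)[OF VW(2,4)] ..
    then have "\<forall>v\<in>V. \<forall>n\<in>N k. v \<otimes> n \<notin> C" using VW(5) by (simp add: subset_iff)
    then show "\<exists>V. openin T V \<and> a \<in> V \<and> (\<exists>k. \<forall>v\<in>V. \<forall>n\<in>N k. v \<otimes> n \<notin> C)"
      using VW(1,3) by (intro exI[of _ V] conjI exI[of _ k])
  qed
  from bchoice[OF ex] obtain V where V: "\<forall>a\<in>A. openin T (V a) \<and> a \<in> V a \<and> (\<exists>k. \<forall>v\<in>V a. \<forall>n\<in>N k. v \<otimes> n \<notin> C)" ..
  then have "\<forall>a\<in>A. \<exists>k. \<forall>v\<in>V a. \<forall>n\<in>N k. v \<otimes> n \<notin> C" by simp
  from bchoice[OF this] obtain k where k: "\<forall>a\<in>A. \<forall>v\<in>V a. \<forall>n\<in>N (k a). v \<otimes> n \<notin> C" ..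
  have "\<exists>\<F>. finite \<F> \<and> \<F> \<subseteq> V ` A \<and> A \<subseteq> \<Union>\<F>"
    using A[unfolded compactin_def, THEN conjunct2, rule_format, of "V ` A"] V by auto
  then obtain \<F> where \<F>: "finite \<F>" "\<F> \<subseteq> V ` A" "A \<subseteq> \<Union>\<F>" by (elim exE conjE)
  have "\<exists>P\<subseteq>A. finite P \<and> \<F> = V ` P"
    using \<F>(1,2) by (rule finite_subset_image)
  then obtain P where P: "P \<subseteq> A" "finite P" "\<F> = V ` P" by (elim exE conjE)
  show ?thesis
  proof (rule that[of "Max (insert j (k ` P))"])
    show "j \<le> Max (insert j (k ` P))" using P(2) by simp
    fix a n assume an: "a \<in> A" "n \<in> N (Max (insert j (k ` P)))"
    obtain b where b: "b \<in> P" "a \<in> V b" using an(1) \<F>(3) P(3) by auto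
    have "k b \<le> Max (insert j (k ` P))" using b(1) P(2) by simp
    then have "n \<in> N (k b)" using N_dec an(2) by blast
    then show "a \<otimes> n \<notin> C" using k b P(1) by blast
  qed
qed

text \<open>
  \<open>B - A\<close> splits into countably many compact open pieces \<open>U j\<close> that approach points \<open>a j\<close> of \<open>A\<close>.
  Mapping \<open>U j\<close> into \<open>f (a j) \<otimes> N j\<close>, where the sets \<open>N j\<close> shrink to \<open>\<one>\<close>, makes the extension
  continuous; injectivity is achieved by avoiding the images of the earlier pieces.
\<close>

lemma extend_embedding:
  fixes X :: "'x topology" and N :: "nat \<Rightarrow> 'a set"
  assumes X: "Hausdorff_space X" and co: "coded X B \<phi>"
    and A: "A \<subseteq> B" "compactin X A" "A \<noteq> {}"
    and f: "continuous_map (subtopology X A) T f" "inj_on f A"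
    and N: "\<And>k. N k \<subseteq> carrier G" "\<And>k. N (Suc k) \<subseteq> N k"
      "\<And>V. openin T V \<Longrightarrow> \<one> \<in> V \<Longrightarrow> \<exists>k. N k \<subseteq> V"
    and loc: "\<And>x. x \<in> B - A \<Longrightarrow> \<exists>V. openin X V \<and> x \<in> V \<and>
      (\<forall>U a k. U \<subseteq> V \<inter> (B - A) \<and> compactin X U \<and> a \<in> A \<longrightarrow>
        (\<exists>h. continuous_map (subtopology X U) T h \<and> inj_on h U \<and>
             (\<forall>u\<in>U. \<exists>n\<in>N k. h u = f a \<otimes> n) \<and> h ` U \<inter> f ` A = {}))"
  shows "\<exists>g. continuous_map (subtopology X B) T g \<and> inj_on g B \<and> (\<forall>x\<in>A. g x = f x) \<and>
    (\<forall>x\<in>B. g x \<in> f ` A \<or> (\<exists>a\<in>A. \<exists>n\<in>N 0. g x = f a \<otimes> n))"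
proof -
  have BX: "B \<subseteq> topspace X" using co by (rule coded_imp_subset)
  have AX: "A \<subseteq> topspace X" using A(1) BX by blast
  have fA: "compactin T (f ` A)" by (rule compact_image_of_injective(1)[OF A(2) Hausdorff f])
  have fAc: "f ` A \<subseteq> carrier G" using fA by (rule carrier_of_compactin)
  have N_dec: "N k \<subseteq> N i" if "i \<le> k" for i k
    using that by (rule lift_Suc_antimono_le[of N, OF N(2)])
  let ?c = "cyl \<phi> B"
  \<comment> \<open>All centres \<open>a\<close> and all sizes \<open>k\<close> stay available,
    since the centre of a piece and the size forced on it by earlier pieces are known only
    later.\<close>
  define E where "E U \<longleftrightarrow> (\<forall>a\<in>A. \<forall>k. \<exists>h. continuous_map (subtopology X U) T h \<and> inj_on h U \<and>
             (\<forall>u\<in>U. \<exists>n\<in>N k. h u = f a \<otimes> n) \<and> h ` U \<inter> f ` A = {})" for U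
  define good where "good n x \<longleftrightarrow> ?c n x \<inter> A = {} \<and> E (?c n x)" for n x
  have ex_good: "\<exists>n. good n x" if x: "x \<in> B - A" for x
  proof -
    obtain V where V: "openin X V" "x \<in> V" and emb: "\<forall>U a k. U \<subseteq> V \<inter> (B - A) \<and> compactin X U \<and> a \<in> A \<longrightarrow>
        (\<exists>h. continuous_map (subtopology X U) T h \<and> inj_on h U \<and>
             (\<forall>u\<in>U. \<exists>n\<in>N k. h u = f a \<otimes> n) \<and> h ` U \<inter> f ` A = {})"
      using loc[OF x] by (elim exE conjE)
    have "openin X (V - A)"
      using V(1) compactin_imp_closedin[OF X A(2)] by (rule openin_diff)
    then obtain n where n: "?c n x \<subseteq> V - A"
      using coded_nbhd[OF co, of x "V - A"] x V(2) by (metis Diff_iff)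
    have "E (?c n x)"
      unfolding E_def
    proof (intro ballI allI)
      fix a k assume "a \<in> A"
      moreover have "?c n x \<subseteq> V \<inter> (B - A)" using n cyl_subset[of \<phi> B n x] by blast
      ultimately show "\<exists>h. continuous_map (subtopology X (?c n x)) T h \<and> inj_on h (?c n x) \<and>
             (\<forall>u\<in>?c n x. \<exists>n\<in>N k. h u = f a \<otimes> n) \<and> h ` ?c n x \<inter> f ` A = {}"
        using emb compactin_cyl[OF co, of n x] by simp
    qed
    then show ?thesis using n unfolding good_def by (intro exI[of _ n]) auto
  qed
  \<comment> \<open>The first good level: all points of the resulting cylinder have the same level,
    so these cylinders are pairwise equal or disjoint and partition \<open>B - A\<close>.\<close>
  define lev where "lev x = (LEAST n. good n x)" for x
  have good_lev: "good (lev x) x" if "x \<in> B - A" for x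
    unfolding lev_def using ex_good[OF that] by (rule LeastI_ex)
  have lev_eq: "y \<in> B - A" "lev y = lev x" if x: "x \<in> B - A" and y: "y \<in> ?c (lev x) x" for x y
  proof -
    show "y \<in> B - A"
      using y good_lev[OF x] cyl_subset[of \<phi> B "lev x" x] unfolding good_def by blast
    have eq: "good m y \<longleftrightarrow> good m x" if "m \<le> lev x" for m
      unfolding good_def cyl_eq[OF y that] ..
    show "lev y = lev x"
      unfolding lev_def[of y]
    proof (rule Least_equality)
      show "good (lev x) y" using eq good_lev[OF x] by simp
      show "lev x \<le> m" if "good m y" for m
      proof (rule ccontr)
        assume "\<not> lev x \<le> m"
        then have "good m x" "m < lev x" using eq[of m] that by auto
        then show False using not_less_Least[of m "\<lambda>n. good n x"] unfolding lev_def by blast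
      qed
    qed
  qed
  \<comment> \<open>A natural number that names the cylinder of \<open>x\<close> by its list of
    bits; numbers that name no such cylinder give an empty piece.\<close>
  define code where "code x = to_nat (map (\<phi> x) [0..<lev x])" for x
  define U where "U j = {x \<in> B - A. code x = j}" for j
  have U_cyl: "U j = ?c (lev x) x" if x: "x \<in> U j" for j x
  proof (intro equalityI subsetI)
    have xB: "x \<in> B - A" and cx: "code x = j" using x by (auto simp: U_def)
    {
      fix y assume "y \<in> U j"
      then have y: "y \<in> B - A" "map (\<phi> y) [0..<lev y] = map (\<phi> x) [0..<lev x]"
        using cx by (auto simp: U_def code_def)
      have "lev y = lev x" using arg_cong[OF y(2), of length] by simp
      then have "agree (lev x) (\<phi> x) (\<phi> y)" using y(2) by (auto simp: agree_def)
      then show "y \<in> ?c (lev x) x" using y(1) by (simp add: cyl_def)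
    }
    fix y assume y: "y \<in> ?c (lev x) x"
    then have "map (\<phi> y) [0..<lev y] = map (\<phi> x) [0..<lev x]"
      unfolding lev_eq(2)[OF xB y] by (auto simp: cyl_def agree_def)
    then show "y \<in> U j" using lev_eq(1)[OF xB y] cx by (simp add: U_def code_def)
  qed
  have U_sub: "U j \<subseteq> B - A" for j by (auto simp: U_def)
  have U_cpt: "compactin X (U j)" for j
  proof (cases "U j = {}")
    case False
    then obtain x where x: "x \<in> U j" by blast
    show ?thesis unfolding U_cyl[OF x] by (rule compactin_cyl[OF co])
  qed simp
  have U_open: "openin (subtopology X B) (U j)" for j
  proof (cases "U j = {}")
    case False
    then obtain x where x: "x \<in> U j" by blast
    show ?thesis unfolding U_cyl[OF x] by (rule openin_cyl[OF co])
  qed simp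
  have U_E: "E (U j)" for j
  proof (cases "U j = {}")
    case True
    have "continuous_map (subtopology X {}) T (\<lambda>_. \<one>)" by simp
    then show ?thesis unfolding True E_def by (intro ballI allI exI[of _ "\<lambda>_. \<one>"]) simp
  next
    case False
    then obtain x where x: "x \<in> U j" by blast
    then have "good (lev x) x" using U_sub good_lev by blast
    then show ?thesis using U_cyl[OF x] unfolding good_def by simp
  qed
  \<comment> \<open>The centre is taken from the deepest cylinder about the piece that meets
    \<open>A\<close>. Levels with this property are below the level of the piece, so all its points
    share the same cylinders there, and level 0 is always among them.\<close>
  have "\<exists>a\<in>A. \<forall>x\<in>U j. \<forall>m. ?c m x \<inter> A \<noteq> {} \<longrightarrow> a \<in> ?c m x" for j
  proof (cases "U j = {}")
    case True
    then show ?thesis using A(3) by auto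
  next
    case False
    then obtain z where z: "z \<in> U j" by blast
    have lt: "m < lev x" if x: "x \<in> U j" and "?c m x \<inter> A \<noteq> {}" for x m
    proof (rule ccontr)
      assume "\<not> m < lev x"
      then have "?c m x \<subseteq> ?c (lev x) x" by (intro cyl_antimono) simp
      moreover have "?c (lev x) x \<inter> A = {}" using x U_sub good_lev unfolding good_def by blast
      ultimately show False using that(2) by blast
    qed
    let ?S = "{m. ?c m z \<inter> A \<noteq> {}}"
    have "?S \<subseteq> {..<lev z}" using lt[OF z] by auto
    then have fin: "finite ?S" by (rule finite_subset) simp
    have "0 \<in> ?S" using A(1,3) by (auto simp: cyl_def agree_def)
    then have "Max ?S \<in> ?S" using fin by (intro Max_in) auto
    then obtain a where a: "a \<in> A" "a \<in> ?c (Max ?S) z" by blast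
    have "a \<in> ?c m x" if x: "x \<in> U j" and m: "?c m x \<inter> A \<noteq> {}" for x m
    proof -
      have xz: "x \<in> ?c (lev z) z" using x U_cyl[OF z] by simp
      have zB: "z \<in> B - A" using z U_sub by blast
      have "m < lev z" using lt[OF x m] lev_eq(2)[OF zB xz] by simp
      then have eq: "?c m x = ?c m z" using cyl_eq[OF xz] by simp
      then have "m \<in> ?S" using m by simp
      then have "m \<le> Max ?S" using fin by simp
      then show ?thesis using a(2) eq cyl_antimono[of m "Max ?S" \<phi> B z] by blast
    qed
    then show ?thesis using a(1) by blast
  qed
  then have "\<forall>j. \<exists>a. a \<in> A \<and> (\<forall>x\<in>U j. \<forall>m. ?c m x \<inter> A \<noteq> {} \<longrightarrow> a \<in> ?c m x)" by (simp add: Bex_def)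
  from choice[OF this] obtain a where a: "\<forall>j. a j \<in> A \<and> (\<forall>x\<in>U j. \<forall>m. ?c m x \<inter> A \<noteq> {} \<longrightarrow> a j \<in> ?c m x)" ..
  let ?emb = "\<lambda>C j h. continuous_map (subtopology X (U j)) T h \<and> inj_on h (U j) \<and>
             (\<forall>u\<in>U j. \<exists>n\<in>N j. h u = f (a j) \<otimes> n) \<and> h ` U j \<inter> f ` A = {} \<and> h ` U j \<inter> C = {}"
  have "\<forall>C. \<forall>j. \<exists>h. compactin T C \<and> C \<inter> f ` A = {} \<longrightarrow> ?emb C j h"
  proof (intro allI)
    fix C j
    show "\<exists>h. compactin T C \<and> C \<inter> f ` A = {} \<longrightarrow> ?emb C j h"
    proof (cases "compactin T C \<and> C \<inter> f ` A = {}")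
      case True
      then obtain k where k: "j \<le> k" "\<And>b n. b \<in> f ` A \<Longrightarrow> n \<in> N k \<Longrightarrow> b \<otimes> n \<notin> C"
        using translates_avoid_compact[OF fA _ _ N(2,3), of C j] by metis
      have aj: "a j \<in> A" using a by simp
      obtain h where h: "continuous_map (subtopology X (U j)) T h" "inj_on h (U j)"
          "\<forall>u\<in>U j. \<exists>n\<in>N k. h u = f (a j) \<otimes> n" "h ` U j \<inter> f ` A = {}"
        using U_E[of j, unfolded E_def, rule_format, OF aj, of k] by (elim exE conjE)
      have "\<forall>u\<in>U j. \<exists>n\<in>N j. h u = f (a j) \<otimes> n"
        using h(3) N_dec[OF k(1)] by (meson subsetD)
      moreover have "h ` U j \<inter> C = {}"
        using h(3) k(2)[OF imageI[OF aj]] by fastforce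
      ultimately show ?thesis using h(1,2,4) by (intro exI[of _ h]) simp
    next
      case False
      then show ?thesis by (intro exI[of _ f] impI) (erule notE, assumption)
    qed
  qed
  then have "\<forall>p. \<exists>h. compactin T (fst p) \<and> fst p \<inter> f ` A = {} \<longrightarrow> ?emb (fst p) (snd p) h" by simp
  from choice[OF this] obtain hh where hh: "\<forall>p. compactin T (fst p) \<and> fst p \<inter> f ` A = {} \<longrightarrow> ?emb (fst p) (snd p) (hh p)" ..
  \<comment> \<open>\<open>C j\<close> collects the images of the pieces before \<open>j\<close>. It
    stays compact and off the image of \<open>A\<close>, as \<open>translates_avoid_compact\<close>
    demands.\<close>
  define C where "C = rec_nat {} (\<lambda>j C. C \<union> hh (C, j) ` U j)"
  define h where "h j = hh (C j, j)" for j
  have C_Suc: "C (Suc j) = C j \<union> h j ` U j" for j by (simp add: C_def h_def)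
  have C_ok: "compactin T (C j) \<and> C j \<inter> f ` A = {}" for j
  proof (induction j)
    case 0
    then show ?case by (simp add: C_def)
  next
    case (Suc j)
    then have "?emb (C j) j (h j)" using hh unfolding h_def by simp
    then have "compactin T (h j ` U j)" "h j ` U j \<inter> f ` A = {}"
      using compact_image_of_injective(1)[OF U_cpt Hausdorff] by simp_all
    then show ?case unfolding C_Suc using Suc by (simp add: compactin_Un Int_Un_distrib2)
  qed
  then have emb: "?emb (C j) j (h j)" for j using hh unfolding h_def by simp
  have C_mono: "C i \<subseteq> C j" if "i \<le> j" for i j
    using that by (rule lift_Suc_mono_le[of C, rotated]) (simp add: C_Suc)
  have disj: "h i ` U i \<inter> h j ` U j = {}" if "i < j" for i j
  proof -
    have "h i ` U i \<subseteq> C j" using C_mono[of "Suc i" j] that C_Suc[of i] by auto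
    then show ?thesis using emb[of j] by blast
  qed
  define g where "g x = (if x \<in> A then f x else h (code x) x)" for x
  have in_U: "x \<in> U (code x)" if "x \<in> B - A" for x using that by (simp add: U_def)
  have g_h: "g x = h j x" if "x \<in> U j" for x j using that by (auto simp: g_def U_def)
  have g_f: "g x = f x" if "x \<in> A" for x using that by (simp add: g_def)
  have near: "\<exists>n\<in>N j. g x = f (a j) \<otimes> n" if "x \<in> U j" for x j
    using emb[of j] that unfolding g_h[OF that] by simp
  have g_carrier: "g x \<in> carrier G" if "x \<in> B" for x
  proof (cases "x \<in> A")
    case True
    then show ?thesis using fAc g_f by auto
  next
    case False
    then have "x \<in> B - A" using that by simp
    from near[OF in_U[OF this]] obtain n where "n \<in> N (code x)" "g x = f (a (code x)) \<otimes> n" ..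
    moreover have "f (a (code x)) \<in> carrier G" using fAc a by auto
    ultimately show ?thesis using N(1)[of "code x"] by auto
  qed
  have g_inj: "inj_on g B"
  proof (rule inj_onI)
    have A_not_U: "g x \<noteq> g y" if "x \<in> A" "y \<in> U j" for x y j
      using emb[of j] that unfolding g_f[OF that(1)] g_h[OF that(2)] by blast
    have U_U: "x = y" if x: "x \<in> U i" and y: "y \<in> U j" and eq: "g x = g y" for x y i j
    proof (cases i j rule: linorder_cases)
      case less
      then show ?thesis using disj[OF less] x y eq unfolding g_h[OF x] g_h[OF y] by blast
    next
      case equal
      have "inj_on (h j) (U j)" using emb[of j] by simp
      then show ?thesis using x y eq unfolding g_h[OF x] g_h[OF y] equal by (simp add: inj_on_eq_iff)
    next
      case greater
      then show ?thesis using disj[OF greater] x y eq unfolding g_h[OF x] g_h[OF y] by (metis IntI empty_iff imageI)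
    qed
    fix x y assume xy: "x \<in> B" "y \<in> B" "g x = g y"
    consider "x \<in> A" "y \<in> A" | "x \<in> A" "y \<in> B - A" | "x \<in> B - A" "y \<in> A" | "x \<in> B - A" "y \<in> B - A"
      using xy by blast
    then show "x = y"
    proof cases
      case 1
      then show ?thesis using inj_onD[OF f(2)] xy(3) g_f by simp
    next
      case 2
      then show ?thesis using A_not_U[OF _ in_U] xy(3) by blast
    next
      case 3
      then show ?thesis using A_not_U[OF _ in_U, of y x] xy(3) by simp
    next
      case 4
      then show ?thesis using U_U[OF in_U in_U] xy(3) by blast
    qed
  qed
  have "continuous_map (subtopology X B) T g"
  proof (rule continuous_map_subtopology_pointwiseI[OF BX])
    show "g x \<in> topspace T" if "x \<in> B" for x using g_carrier[OF that] by simp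
    fix x V assume x: "x \<in> B" and V: "openin T V" "g x \<in> V"
    show "\<exists>W. openin X W \<and> x \<in> W \<and> (\<forall>y\<in>B. y \<in> W \<longrightarrow> g y \<in> V)"
    proof (cases "x \<in> A")
      case False
      then have xU: "x \<in> U (code x)" using x in_U by blast
      let ?U = "U (code x)"
      have UX: "?U \<subseteq> topspace X" using U_sub BX by blast
      have ch: "continuous_map (subtopology X ?U) T (h (code x))" using emb by simp
      have "h (code x) x \<in> V" using V(2) g_h[OF xU] by simp
      from continuous_map_subtopology_nbhd[OF ch UX xU V(1) this] obtain W
        where W: "openin X W" "x \<in> W" "\<And>y. y \<in> ?U \<Longrightarrow> y \<in> W \<Longrightarrow> h (code x) y \<in> V"
        by metis
      obtain W' where W': "openin X W'" "?U = W' \<inter> B"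
        using U_open[of "code x"] unfolding openin_subtopology by blast
      have "g y \<in> V" if "y \<in> B" "y \<in> W \<inter> W'" for y
      proof -
        have yU: "y \<in> ?U" using that W'(2) by blast
        then show ?thesis using W(3) that g_h[OF yU] by simp
      qed
      moreover have "x \<in> W \<inter> W'" using W(2) W'(2) xU by blast
      ultimately show ?thesis using W(1) W'(1) by (intro exI[of _ "W \<inter> W'"] conjI openin_Int) auto
    next
      case True
      have fx: "f x \<otimes> \<one> \<in> V" "f x \<in> carrier G"
        using V(2) g_carrier[OF x] g_f[OF True] by simp_all
      from mult_nbhd[OF V(1) fx(1) fx(2) one_closed] obtain V1 V2
        where V12: "openin T V1" "openin T V2" "f x \<in> V1" "\<one> \<in> V2" "\<And>v w. v \<in> V1 \<Longrightarrow> w \<in> V2 \<Longrightarrow> v \<otimes> w \<in> V"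
        by metis
      have V1c: "V1 \<subseteq> carrier G" using openin_subset[OF V12(1)] by simp
      from continuous_map_subtopology_nbhd[OF f(1) AX True V12(1,3)] obtain W
        where W: "openin X W" "x \<in> W" "\<And>y. y \<in> A \<Longrightarrow> y \<in> W \<Longrightarrow> f y \<in> V1"
        by metis
      obtain n where n: "?c n x \<subseteq> W" using coded_nbhd[OF co x W(1,2)] .
      obtain J where J: "N J \<subseteq> V2" using N(3)[OF V12(2,4)] ..
      obtain O' where O': "openin X O'" "O' \<inter> B = ?c n x" using coded_openin_cyl[OF co, of n x] .
      \<comment> \<open>Without the first \<open>J\<close> pieces only factors from
        \<open>N J\<close>, hence from \<open>V2\<close>, occur. Moreover the cylinder of
        \<open>y\<close> contains the point \<open>x\<close> of \<open>A\<close>, so the centre of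
        the piece of \<open>y\<close> lies in that cylinder too.\<close>
      let ?R = "O' - (\<Union>j<J. U j)"
      have "closedin X (\<Union>j<J. U j)"
        using compactin_imp_closedin[OF X U_cpt] by (intro closedin_Union) auto
      with O'(1) have "openin X ?R" by (rule openin_diff)
      moreover have "x \<in> ?R"
        using O'(2) cyl_self[OF x, of \<phi> n] True U_sub by blast
      moreover have "g y \<in> V" if y: "y \<in> B" "y \<in> ?R" for y
      proof (cases "y \<in> A")
        case True
        have "y \<in> ?c n x" using y O'(2) by blast
        then have "f y \<in> V1" using n W(3)[OF True] by blast
        then have "f y \<otimes> \<one> \<in> V" using V12(4,5) by blast
        then show ?thesis using \<open>f y \<in> V1\<close> V1c g_f[OF True] by auto
      next
        case False
        then have yU: "y \<in> U (code y)" using y(1) in_U by blast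
        then have "J \<le> code y" using y(2) by (meson DiffE UN_I lessThan_iff not_le)
        have yc: "y \<in> ?c n x" using y O'(2) by blast
        then have eq: "?c n y = ?c n x" by (rule cyl_eq) simp
        then have "x \<in> ?c n y \<inter> A" using cyl_self[OF x, of \<phi> n] True \<open>x \<in> A\<close> by blast
        then have "a (code y) \<in> ?c n y" using a yU by blast
        then have "f (a (code y)) \<in> V1" using eq n W(3)[of "a (code y)"] a by blast
        moreover obtain m where m: "m \<in> N (code y)" "g y = f (a (code y)) \<otimes> m" using near[OF yU] ..
        moreover have "m \<in> V2" using m(1) N_dec[OF \<open>J \<le> code y\<close>] J by blast
        ultimately show ?thesis using V12(5) by simp
      qed
      ultimately show ?thesis by (intro exI[of _ ?R]) simp
    qed
  qed
  moreover have "g x \<in> f ` A \<or> (\<exists>a\<in>A. \<exists>n\<in>N 0. g x = f a \<otimes> n)" if x: "x \<in> B" for x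
  proof (cases "x \<in> A")
    case True
    then show ?thesis using g_f by simp
  next
    case False
    then have "x \<in> U (code x)" using x in_U by blast
    then obtain n where "n \<in> N (code x)" "g x = f (a (code x)) \<otimes> n" using near by blast
    moreover have "a (code x) \<in> A" using a by simp
    ultimately show ?thesis using N_dec[of 0 "code x"] by blast
  qed
  ultimately show ?thesis using g_inj g_f by (intro exI[of _ g]) simp
qed

end

section \<open>Embeddings of scattered and of perfect type\<close>

text \<open>A Cantor scheme: since \<open>K\<close> has no isolated points, each cylinder can be
  split again, and the bits of the code of \<open>u\<close> choose a branch. Different codes part at
  their first different bit, and levels increase along branches, which gives continuity.\<close>

lemma embed_perfect:
  assumes coK: "coded Y K \<psi>" and K: "dense_in_itself Y K" and p: "p \<in> K" "openin Y W" "p \<in> W"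
    and coU: "coded X U \<phi>"
  obtains h where "continuous_map (subtopology X U) Y h" "inj_on h U" "h ` U \<subseteq> K \<inter> W"
proof -
  let ?c = "cyl \<psi> K"
  have KY: "K \<subseteq> topspace Y" using coK by (rule coded_imp_subset)
  have split: "\<exists>y m. y \<in> ?c n x \<and> n < m \<and> \<not> agree m (\<psi> x) (\<psi> y)" if x: "x \<in> K" for x n
  proof -
    obtain V where V: "openin Y V" "V \<inter> K = ?c n x" using coded_openin_cyl[OF coK, of n x] .
    have "x \<in> V" using V(2) cyl_self[OF x, of \<psi> n] by blast
    then obtain y where y: "y \<in> K" "y \<in> V" "y \<noteq> x"
      using K x V(1) unfolding dense_in_itself_def by blast
    have "\<psi> x \<noteq> \<psi> y" using inj_onD[OF coded_imp_inj[OF coK]] x y by blast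
    then obtain i where "\<psi> x i \<noteq> \<psi> y i" by blast
    then have "\<not> agree (Suc (max n i)) (\<psi> x) (\<psi> y)" unfolding agree_def by (meson less_Suc_eq_le max.cobounded2)
    moreover have "y \<in> ?c n x" using y V(2) by blast
    moreover have "n < Suc (max n i)" by simp
    ultimately show ?thesis by (intro exI[of _ y] exI[of _ "Suc (max n i)"]) simp
  qed
  then have "\<forall>q. \<exists>r. fst q \<in> K \<longrightarrow> fst r \<in> ?c (snd q) (fst q) \<and> snd q < snd r \<and> \<not> agree (snd r) (\<psi> (fst q)) (\<psi> (fst r))"
    by simp
  from choice[OF this] obtain r where r: "\<forall>q. fst q \<in> K \<longrightarrow>
      fst (r q) \<in> ?c (snd q) (fst q) \<and> snd q < snd (r q) \<and> \<not> agree (snd (r q)) (\<psi> (fst q)) (\<psi> (fst (r q)))" ..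
  obtain n0 where n0: "?c n0 p \<subseteq> W" using coded_nbhd[OF coK p] .
  \<comment> \<open>A node is a point of \<open>K\<close> with the level of its cylinder. Bit
    \<open>k\<close> either keeps the point or moves to a second point of the cylinder, and the new
    level separates the two.\<close>
  define node where "node z = rec_nat (p, n0) (\<lambda>k q. (if z k then fst (r q) else fst q, snd (r q)))" for z
  have node_0: "node z 0 = (p, n0)" for z by (simp add: node_def)
  have node_Suc: "node z (Suc k) = (if z k then fst (r (node z k)) else fst (node z k), snd (r (node z k)))" for z k
    by (simp add: node_def)
  have node_K: "fst (node z k) \<in> K" for z k
  proof (induction k)
    case (Suc k)
    then show ?case using r[rule_format, of "node z k"] cyl_subset[of \<psi> K "snd (node z k)" "fst (node z k)"] unfolding node_Suc by auto
  qed (simp add: node_0 p(1))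
  note rn = r[rule_format, OF node_K]
  have node_agree: "node z k = node z' k" if "agree k z z'" for z z' k
    using that
  proof (induction k)
    case (Suc k)
    then have "node z k = node z' k" "z k = z' k" by (auto simp: agree_def)
    then show ?case by (simp add: node_Suc)
  qed (simp add: node_0)
  define Z where "Z z k = ?c (snd (node z k)) (fst (node z k))" for z k
  have node_cyl: "fst (node z (Suc k)) \<in> Z z k" for z k
    using rn[of z k] cyl_self[OF node_K[of z k], of \<psi> "snd (node z k)"] unfolding Z_def node_Suc by simp
  have snd_less: "snd (node z k) < snd (node z (Suc k))" for z k
    using rn[of z k] by (simp add: node_Suc)
  have snd_ge: "k \<le> snd (node z k)" for z k
    by (induction k) (use snd_less le_less_trans Suc_leI in blast)+
  have Z_dec: "Z z (Suc k) \<subseteq> Z z k" for z k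
  proof -
    have "Z z (Suc k) \<subseteq> ?c (snd (node z k)) (fst (node z (Suc k)))"
      unfolding Z_def using snd_less[of z k] by (intro cyl_antimono) simp
    also have "\<dots> = Z z k"
      using cyl_eq[OF node_cyl[of z k, unfolded Z_def], of "snd (node z k)"] unfolding Z_def by simp
    finally show ?thesis .
  qed
  have "(\<Inter>k. Z z k) \<noteq> {}" for z
  proof (rule compactin_nested[OF coded_imp_compactin[OF coK]])
    show "Z z k \<subseteq> K" for k unfolding Z_def by (rule cyl_subset)
    show "openin (subtopology Y K) (K - Z z k)" for k
      unfolding Z_def by (rule openin_Diff_cyl[OF coK])
    show "Z z k \<noteq> {}" for k using cyl_self[OF node_K[of z k], of \<psi> "snd (node z k)"] unfolding Z_def by blast
    show "Z z (Suc k) \<subseteq> Z z k" for k by (rule Z_dec)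
  qed
  then have "\<exists>y. y \<in> (\<Inter>k. Z z k)" for z by (simp only: ex_in_conv simp_thms)
  then have "\<forall>z. \<exists>y. \<forall>k. y \<in> Z z k" by simp
  from choice[OF this] obtain H where H: "\<forall>z k. H z \<in> Z z k" ..
  have H_K: "H z \<in> K" for z using H[rule_format, of z 0] cyl_subset[of \<psi> K "snd (node z 0)" "fst (node z 0)"] unfolding Z_def by blast
  show ?thesis
  proof (rule that[of "\<lambda>u. H (\<phi> u)"])
    show "(\<lambda>u. H (\<phi> u)) ` U \<subseteq> K \<inter> W"
    proof clarify
      fix u assume "u \<in> U"
      have "H (\<phi> u) \<in> ?c n0 p" using H[rule_format, of "\<phi> u" 0] by (simp add: Z_def node_0)
      then show "H (\<phi> u) \<in> K \<inter> W" using n0 H_K by blast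
    qed
    show "inj_on (\<lambda>u. H (\<phi> u)) U"
    proof (rule inj_onI, rule ccontr)
      fix u v assume uv: "u \<in> U" "v \<in> U" "H (\<phi> u) = H (\<phi> v)" "u \<noteq> v"
      then have "\<phi> u \<noteq> \<phi> v" using inj_onD[OF coded_imp_inj[OF coU]] by blast
      then have "\<exists>k. \<phi> u k \<noteq> \<phi> v k" by blast
      then have k: "\<phi> u (LEAST k. \<phi> u k \<noteq> \<phi> v k) \<noteq> \<phi> v (LEAST k. \<phi> u k \<noteq> \<phi> v k)"
        by (rule LeastI_ex)
      define k where "k = (LEAST k. \<phi> u k \<noteq> \<phi> v k)"
      have ne: "\<phi> u k \<noteq> \<phi> v k" using k unfolding k_def .
      have "agree k (\<phi> u) (\<phi> v)"
        unfolding agree_def k_def using not_less_Least[of _ "\<lambda>k. \<phi> u k \<noteq> \<phi> v k"] by blast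
      then have eq: "node (\<phi> u) k = node (\<phi> v) k" by (rule node_agree)
      let ?q = "node (\<phi> u) k"
      have 1: "H (\<phi> u) \<in> ?c (snd (r ?q)) (if \<phi> u k then fst (r ?q) else fst ?q)"
        using H[rule_format, of "\<phi> u" "Suc k"] unfolding Z_def node_Suc by simp
      have 2: "H (\<phi> u) \<in> ?c (snd (r ?q)) (if \<phi> v k then fst (r ?q) else fst ?q)"
        using H[rule_format, of "\<phi> v" "Suc k"] unfolding Z_def node_Suc eq uv(3) by simp
      have "H (\<phi> u) \<in> ?c (snd (r ?q)) (fst ?q)" "H (\<phi> u) \<in> ?c (snd (r ?q)) (fst (r ?q))"
        using 1 2 ne by (auto split: if_splits)
      then have "agree (snd (r ?q)) (\<psi> (fst ?q)) (\<psi> (fst (r ?q)))"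
        unfolding cyl_def using agree_trans agree_sym by blast
      then show False using rn[of "\<phi> u" k] by blast
    qed
    show "continuous_map (subtopology X U) Y (\<lambda>u. H (\<phi> u))"
    proof (rule continuous_map_subtopology_pointwiseI[OF coded_imp_subset[OF coU]])
      show "H (\<phi> u) \<in> topspace Y" for u using H_K KY by blast
      fix u V assume u: "u \<in> U" and V: "openin Y V" "H (\<phi> u) \<in> V"
      obtain n where n: "?c n (H (\<phi> u)) \<subseteq> V" using coded_nbhd[OF coK H_K V] .
      obtain O' where O': "openin X O'" "O' \<inter> U = cyl \<phi> U n u" using coded_openin_cyl[OF coU, of n u] .
      have "H (\<phi> v) \<in> V" if v: "v \<in> U" "v \<in> O'" for v
      proof -
        have "v \<in> cyl \<phi> U n u" using v O'(2) by blast
        then have "agree n (\<phi> u) (\<phi> v)" by (simp add: cyl_def)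
        then have eq: "node (\<phi> u) n = node (\<phi> v) n" by (rule node_agree)
        have "H (\<phi> u) \<in> Z (\<phi> u) n" "H (\<phi> v) \<in> Z (\<phi> u) n"
          using H[rule_format, of "\<phi> u" n] H[rule_format, of "\<phi> v" n] eq unfolding Z_def by simp_all
        then have "agree (snd (node (\<phi> u) n)) (\<psi> (H (\<phi> u))) (\<psi> (H (\<phi> v)))"
          unfolding Z_def cyl_def using agree_trans agree_sym by blast
        then have "agree n (\<psi> (H (\<phi> u))) (\<psi> (H (\<phi> v)))"
          using snd_ge[of n "\<phi> u"] by (rule agree_mono)
        then show ?thesis using n H_K[of "\<phi> v"] by (auto simp: cyl_def)
      qed
      moreover have "u \<in> O'" using O'(2) cyl_self[OF u, of \<phi> n] by blast
      ultimately show "\<exists>W. openin X W \<and> u \<in> W \<and> (\<forall>y\<in>U. y \<in> W \<longrightarrow> H (\<phi> y) \<in> V)"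
        using O'(1) by blast
    qed
  qed
qed

context t1_group
begin

text \<open>Apart from the one point \<open>u\<close> that may survive to stage \<open>s\<close>,
  each point of \<open>U\<close> has a neighbourhood in which some earlier derived set contains at
  most that point. By induction such pieces embed near points \<open>p'\<close> of the corresponding
  derived set of \<open>K\<close>, and these accumulate at \<open>p\<close>. Sending
  \<open>u\<close> to \<open>p\<close>, \<open>extend_embedding\<close> assembles the
  pieces.\<close>

lemma embed_derived:
  fixes s :: "'c rel" and X :: "'x topology"
  assumes X: "Hausdorff_space X" and coK: "coded T K \<psi>"
  shows "Well_order s \<Longrightarrow> coded X U \<phi> \<Longrightarrow> derived X U s \<subseteq> {w} \<Longrightarrow> p \<in> derived T K s \<Longrightarrow>
    openin T W \<Longrightarrow> p \<in> W \<Longrightarrow>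
    \<exists>h. continuous_map (subtopology X U) T h \<and> inj_on h U \<and> h ` U \<subseteq> K \<inter> W"
proof (induction s arbitrary: U w p W rule: wf_induct_rule[OF wf_ordLess])
  case (1 s)
  note wo = 1(2) and coU = 1(3) and U_der = 1(4) and p = 1(5) and W = 1(6,7)
  have KT: "K \<subseteq> topspace T" using coK by (rule coded_imp_subset)
  have UX: "U \<subseteq> topspace X" using coU by (rule coded_imp_subset)
  have Kc: "K \<subseteq> carrier G" using KT by simp
  have pK: "p \<in> K" using p derived_subset[OF wo, of T K] by blast
  then have pc: "p \<in> carrier G" using Kc by blast
  show ?case
  proof (cases "U = {}")
    case True
    have "continuous_map (subtopology X {}) T (\<lambda>_. \<one>)" by simp
    then show ?thesis unfolding True by (intro exI[of _ "\<lambda>_. \<one>"]) simp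
  next
    case False
    \<comment> \<open>If nothing survives to stage \<open>s\<close>, any point of \<open>U\<close>
      serves as the centre.\<close>
    have "\<exists>u\<in>U. derived X U s \<subseteq> {u}"
    proof (cases "w \<in> U")
      case True
      then show ?thesis using U_der by blast
    next
      case w: False
      then have "derived X U s = {}" using U_der derived_subset[OF wo, of X U] by blast
      then show ?thesis using False by blast
    qed
    then obtain u where u: "u \<in> U" "derived X U s \<subseteq> {u}" ..
    \<comment> \<open>Chosen so that \<open>p \<otimes> n\<close> runs through the part of
      \<open>W\<close> in the \<open>k\<close>-th cylinder about \<open>p\<close>; the extension
      then stays inside \<open>K \<inter> W\<close>.\<close>
    define N where "N k = (\<lambda>y. inv p \<otimes> y) ` (cyl \<psi> K k p \<inter> W)" for k
    have loc: "\<exists>V. openin X V \<and> x \<in> V \<and>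
      (\<forall>U' a k. U' \<subseteq> V \<inter> (U - {u}) \<and> compactin X U' \<and> a \<in> {u} \<longrightarrow>
        (\<exists>h. continuous_map (subtopology X U') T h \<and> inj_on h U' \<and>
             (\<forall>u\<in>U'. \<exists>n\<in>N k. h u = p \<otimes> n) \<and> h ` U' \<inter> (\<lambda>_. p) ` {u} = {}))"
      if x: "x \<in> U - {u}" for x
    proof -
      have "x \<notin> derived X U s" using x u(2) by blast
      then have "\<exists>t :: 'c rel. t <o s \<and> (\<exists>V. openin X V \<and> x \<in> V \<and> (\<forall>y\<in>derived X U t. y \<in> V \<longrightarrow> y = x))"
        using x unfolding derived_iff[OF UX wo] by blast
      then obtain t :: "'c rel" and V where t: "t <o s" and V: "openin X V" "x \<in> V"
          "\<forall>y\<in>derived X U t. y \<in> V \<longrightarrow> y = x"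
        by (elim exE conjE)
      have wt: "Well_order t" using t by (simp add: ordLess_def)
      have "\<exists>h. continuous_map (subtopology X U') T h \<and> inj_on h U' \<and>
             (\<forall>u\<in>U'. \<exists>n\<in>N k. h u = p \<otimes> n) \<and> h ` U' \<inter> {p} = {}"
        if U': "U' \<subseteq> V \<inter> (U - {u})" "compactin X U'" for U' k
      proof -
        have sub: "U' \<subseteq> U" using U'(1) by blast
        have coU': "coded X U' \<phi>" using coU U'(2) sub by (rule coded_subset)
        have "derived X U' t \<subseteq> derived X U t" using UX sub wt by (rule derived_mono)
        moreover have "derived X U' t \<subseteq> V" using derived_subset[OF wt, of X U'] U'(1) by blast
        ultimately have der: "derived X U' t \<subseteq> {x}" using V(3) by blast
        obtain O' where O': "openin T O'" "O' \<inter> K = cyl \<psi> K k p" using coded_openin_cyl[OF coK, of k p] .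
        have "p \<in> O'" using O'(2) cyl_self[OF pK, of \<psi> k] by blast
        then have "p \<in> W \<inter> O'" "openin T (W \<inter> O')" using W O'(1) by auto
        then obtain p' where p': "p' \<in> derived T K t" "p' \<in> W \<inter> O'" "p' \<noteq> p"
          using derived_accumulates[OF KT t p] by metis
        \<comment> \<open>Deleting \<open>p\<close> keeps the images of the pieces off the image of
          \<open>u\<close>.\<close>
        have op: "openin T (W \<inter> O' - {p})"
          using \<open>openin T (W \<inter> O')\<close> pc by (intro openin_Diff_compactin) auto
        have "p' \<in> W \<inter> O' - {p}" using p' by blast
        from 1(1)[OF t wt coU' der p'(1) op this]
        obtain h where h: "continuous_map (subtopology X U') T h" "inj_on h U'" "h ` U' \<subseteq> K \<inter> (W \<inter> O' - {p})"
          by (elim exE conjE)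
        have "\<forall>v\<in>U'. \<exists>n\<in>N k. h v = p \<otimes> n"
        proof
          fix v assume v: "v \<in> U'"
          then have "h v \<in> cyl \<psi> K k p \<inter> W" "h v \<in> K" using h(3) O'(2) by blast+
          then show "\<exists>n\<in>N k. h v = p \<otimes> n"
            using pc Kc unfolding N_def by (intro bexI[of _ "inv p \<otimes> h v"]) auto
        qed
        moreover have "h ` U' \<inter> {p} = {}" using h(3) by blast
        ultimately show ?thesis using h(1,2) by (intro exI[of _ h] conjI)
      qed
      then show ?thesis using V(1,2) by (intro exI[of _ V]) simp
    qed
    have ext: "\<exists>g. continuous_map (subtopology X U) T g \<and> inj_on g U \<and> (\<forall>x\<in>{u}. g x = p) \<and>
      (\<forall>x\<in>U. g x \<in> (\<lambda>_. p) ` {u} \<or> (\<exists>a\<in>{u}. \<exists>n\<in>N 0. g x = p \<otimes> n))"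
    proof (rule extend_embedding[OF X coU, of "{u}" "\<lambda>_. p" N])
      show "{u} \<subseteq> U" "{u} \<noteq> {}" using u(1) by auto
      show "compactin X {u}" using u(1) UX by auto
      show "continuous_map (subtopology X {u}) T (\<lambda>_. p)" using pc by simp
      show "inj_on (\<lambda>_. p) {u}" by simp
      show "N k \<subseteq> carrier G" for k
        unfolding N_def using pc Kc cyl_subset[of \<psi> K k p] by auto
      show "N (Suc k) \<subseteq> N k" for k
        unfolding N_def using cyl_antimono[of k "Suc k" \<psi> K p] by (intro image_mono) auto
      show "\<exists>k. N k \<subseteq> V" if V: "openin T V" "\<one> \<in> V" for V
      proof -
        have "openin T {y \<in> carrier G. inv p \<otimes> y \<in> V}"
          using V(1) pc by (intro openin_translate_preimage) simp_all
        moreover have "p \<in> {y \<in> carrier G. inv p \<otimes> y \<in> V}" using pc V(2) by simp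
        ultimately obtain k where "cyl \<psi> K k p \<subseteq> {y \<in> carrier G. inv p \<otimes> y \<in> V}"
          using coded_nbhd[OF coK pK] by metis
        then show ?thesis unfolding N_def by (intro exI[of _ k]) auto
      qed
    qed (rule loc)
    then obtain g where g: "continuous_map (subtopology X U) T g" "inj_on g U"
        "\<forall>x\<in>U. g x = p \<or> (\<exists>n\<in>N 0. g x = p \<otimes> n)"
      by auto
    have "g x \<in> K \<inter> W" if "x \<in> U" for x
    proof -
      consider "g x = p" | n where "n \<in> N 0" "g x = p \<otimes> n" using g(3) \<open>x \<in> U\<close> by blast
      then show ?thesis
      proof cases
        case 1
        then show ?thesis using pK W(2) by simp
      next
        case 2
        then obtain y where y: "y \<in> cyl \<psi> K 0 p \<inter> W" "n = inv p \<otimes> y" unfolding N_def by blast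
        then have "y \<in> K" using cyl_subset[of \<psi> K 0 p] by blast
        then have "g x = y" using 2(2) y(2) pc Kc by auto
        then show ?thesis using y(1) \<open>y \<in> K\<close> by blast
      qed
    qed
    then show ?thesis using g(1,2) by (intro exI[of _ g]) blast
  qed
qed

end

section \<open>Extension by small translated copies\<close>

context nonmetrizable_M_omega_grp
begin

text \<open>A copy \<open>h\<close> of a piece near \<open>p\<close> is moved to
  \<open>f a \<otimes> (t j \<otimes> (inv p \<otimes> h u))\<close>. If this were equal to
  \<open>f b\<close>, the second factor would lie in the set \<open>Q\<close> of quotients of the
  image of \<open>A\<close>; as \<open>t j\<close> avoids \<open>Q\<close>, it does not for copies
  close enough to \<open>p\<close>.\<close>

lemma extend_by_copies:
  fixes X :: "'x topology"
  assumes X: "Hausdorff_space X" and co: "coded X B \<phi>"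
    and A: "A \<subseteq> B" "compactin X A" "A \<noteq> {}"
    and f: "continuous_map (subtopology X A) T f" "inj_on f A"
    and coK: "coded T P \<psi>" and p: "p \<in> P" and O: "openin T O'" "\<one> \<in> O'"
    and loc: "\<And>x. x \<in> B - A \<Longrightarrow> \<exists>V. openin X V \<and> x \<in> V \<and>
      (\<forall>U W. U \<subseteq> V \<inter> (B - A) \<and> compactin X U \<and> openin T W \<and> p \<in> W \<longrightarrow>
        (\<exists>h. continuous_map (subtopology X U) T h \<and> inj_on h U \<and> h ` U \<subseteq> P \<inter> W))"
  shows "\<exists>g. continuous_map (subtopology X B) T g \<and> inj_on g B \<and> (\<forall>x\<in>A. g x = f x) \<and>
    (\<forall>x\<in>B. g x \<in> f ` A \<or> (\<exists>a\<in>A. \<exists>n\<in>O'. g x = f a \<otimes> n))"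
proof -
  have Kc: "P \<subseteq> carrier G" using coded_imp_subset[OF coK] by simp
  have pc: "p \<in> carrier G" using p Kc by blast
  have fA: "compactin T (f ` A)" by (rule compact_image_of_injective(1)[OF A(2) Hausdorff f])
  have fAc: "f ` A \<subseteq> carrier G" using fA by (rule carrier_of_compactin)
  define Q where "Q = (\<lambda>(x, y). inv x \<otimes> y) ` (f ` A \<times> f ` A)"
  have "continuous_map (prod_topology T T) T (\<lambda>z. inv (fst z) \<otimes> snd z)"
    by (intro continuous_map_mult continuous_map_inv continuous_map_fst continuous_map_snd)
  then have "compactin T ((\<lambda>z. inv (fst z) \<otimes> snd z) ` (f ` A \<times> f ` A))"
    using fA by (intro image_compactin[of "prod_topology T T"]) (auto simp: compactin_Times)
  then have Q: "compactin T Q" unfolding Q_def by (simp add: case_prod_unfold)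
  obtain t where t: "limitin T t \<one> sequentially" "\<And>j. t j \<in> carrier G" "\<And>j. t j \<notin> Q"
    using sequence_outside_compact[OF Q] by metis
  define N where "N k = {t j \<otimes> (inv p \<otimes> y) | j y. k \<le> j \<and> y \<in> cyl \<psi> P k p} \<inter> O'" for k
  have O'_c: "O' \<subseteq> carrier G" using openin_subset[OF O(1)] by simp
  have N0: "N 0 \<subseteq> O'" by (simp add: N_def)
  have "\<exists>g. continuous_map (subtopology X B) T g \<and> inj_on g B \<and> (\<forall>x\<in>A. g x = f x) \<and>
    (\<forall>x\<in>B. g x \<in> f ` A \<or> (\<exists>a\<in>A. \<exists>n\<in>N 0. g x = f a \<otimes> n))"
  proof (rule extend_embedding[OF X co A f])
    show "N k \<subseteq> carrier G" for k using O'_c by (auto simp: N_def)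
    show "N (Suc k) \<subseteq> N k" for k
    proof
      fix z assume "z \<in> N (Suc k)"
      then obtain j y where jy: "z = t j \<otimes> (inv p \<otimes> y)" "Suc k \<le> j" "y \<in> cyl \<psi> P (Suc k) p" "z \<in> O'"
        unfolding N_def by blast
      have "y \<in> cyl \<psi> P k p" using jy(3) cyl_antimono[of k "Suc k" \<psi> P p] by auto
      moreover have "k \<le> j" using jy(2) by simp
      ultimately show "z \<in> N k" using jy(1,4) unfolding N_def by blast
    qed
    show "\<exists>k. N k \<subseteq> V" if V: "openin T V" "\<one> \<in> V" for V
    proof -
      have "\<one> \<otimes> \<one> \<in> V" using V(2) by simp
      from mult_nbhd[OF V(1) this one_closed one_closed] obtain V1 V2
        where V12: "openin T V1" "openin T V2" "\<one> \<in> V1" "\<one> \<in> V2" "\<And>v w. v \<in> V1 \<Longrightarrow> w \<in> V2 \<Longrightarrow> v \<otimes> w \<in> V"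
        by metis
      obtain j0 where j0: "\<And>j. j0 \<le> j \<Longrightarrow> t j \<in> V1"
        using t(1) V12(1,3) unfolding limitin_sequentially by blast
      have "openin T {y \<in> carrier G. inv p \<otimes> y \<in> V2}"
        using V12(2) pc by (intro openin_translate_preimage) simp_all
      moreover have "p \<in> {y \<in> carrier G. inv p \<otimes> y \<in> V2}" using pc V12(4) by simp
      ultimately obtain k where k: "cyl \<psi> P k p \<subseteq> {y \<in> carrier G. inv p \<otimes> y \<in> V2}"
        using coded_nbhd[OF coK p] by metis
      have "z \<in> V" if z: "z \<in> N (max j0 k)" for z
      proof -
        obtain j y where jy: "z = t j \<otimes> (inv p \<otimes> y)" "max j0 k \<le> j" "y \<in> cyl \<psi> P (max j0 k) p"
          using z unfolding N_def by blast
        have "y \<in> cyl \<psi> P k p" using jy(3) cyl_antimono[of k "max j0 k" \<psi> P p] by auto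
        then have "inv p \<otimes> y \<in> V2" using k by blast
        moreover have "t j \<in> V1" using jy(2) j0 by simp
        ultimately show ?thesis using V12(5) jy(1) by simp
      qed
      then show ?thesis by blast
    qed
    fix x assume "x \<in> B - A"
    from loc[OF this] obtain V where V: "openin X V" "x \<in> V" and emb: "\<And>U W. U \<subseteq> V \<inter> (B - A) \<and> compactin X U \<and> openin T W \<and> p \<in> W \<Longrightarrow>
        \<exists>h. continuous_map (subtopology X U) T h \<and> inj_on h U \<and> h ` U \<subseteq> P \<inter> W"
      by blast
    have "\<exists>h. continuous_map (subtopology X U) T h \<and> inj_on h U \<and>
             (\<forall>u\<in>U. \<exists>n\<in>N k. h u = f a \<otimes> n) \<and> h ` U \<inter> f ` A = {}"
      if U: "U \<subseteq> V \<inter> (B - A)" "compactin X U" and a: "a \<in> A" for U a k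
    proof -
      obtain j0 where j0: "\<And>j. j0 \<le> j \<Longrightarrow> t j \<in> O'"
        using t(1) O unfolding limitin_sequentially by blast
      define j where "j = max j0 k"
      have tj: "t j \<in> O'" "k \<le> j" using j0[of j] by (auto simp: j_def)
      obtain R where R: "openin T R" "R \<inter> P = cyl \<psi> P k p" using coded_openin_cyl[OF coK, of k p] .
      have op1: "openin T (O' - Q)" using O(1) Q by (rule openin_Diff_compactin)
      \<comment> \<open>Near \<open>p\<close> the translated copy lands in \<open>O' - Q\<close>,
        because \<open>t j\<close> itself lies there.\<close>
      define W where "W = {w \<in> carrier G. inv p \<otimes> w \<in> {v \<in> carrier G. t j \<otimes> v \<in> O' - Q}} \<inter> R"
      have "openin T W"
        unfolding W_def using op1 R(1) pc t(2) by (intro openin_Int openin_translate_preimage) auto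
      moreover have "p \<in> W"
        unfolding W_def using pc t(2,3) tj(1) R(2) cyl_self[OF p, of \<psi> k] by auto
      ultimately obtain h where h: "continuous_map (subtopology X U) T h" "inj_on h U" "h ` U \<subseteq> P \<inter> W"
        using emb[of U W] U by auto
      have fa: "f a \<in> carrier G" using fAc a by blast
      let ?h = "\<lambda>u. f a \<otimes> (t j \<otimes> (inv p \<otimes> h u))"
      have hu: "h u \<in> P" "h u \<in> W" "h u \<in> carrier G" if "u \<in> U" for u
        using h(3) that Kc by blast+
      have ht: "t j \<otimes> (inv p \<otimes> h u) \<in> O' - Q" if "u \<in> U" for u
        using hu(2)[OF that] unfolding W_def by simp
      have "continuous_map (subtopology X U) T ?h"
        using fa t(2)[of j] pc by (intro continuous_map_mult continuous_map_constI h(1)) auto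
      moreover have "inj_on ?h U"
      proof (rule inj_onI)
        fix u v assume uv: "u \<in> U" "v \<in> U" "?h u = ?h v"
        then have "h u = h v" using fa t(2)[of j] pc hu(3) by simp
        then show "u = v" using h(2) uv(1,2) by (simp add: inj_on_eq_iff)
      qed
      moreover have "\<forall>u\<in>U. \<exists>n\<in>N k. ?h u = f a \<otimes> n"
      proof
        fix u assume u: "u \<in> U"
        have "h u \<in> cyl \<psi> P k p" using hu[OF u] R(2) unfolding W_def by blast
        then have "t j \<otimes> (inv p \<otimes> h u) \<in> N k" using ht[OF u] tj(2) unfolding N_def by blast
        then show "\<exists>n\<in>N k. ?h u = f a \<otimes> n" by blast
      qed
      moreover have "?h u \<noteq> f b" if u: "u \<in> U" and b: "b \<in> A" for u b
      proof
        assume eq: "?h u = f b"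
        have "inv (f a) \<otimes> f b = t j \<otimes> (inv p \<otimes> h u)"
          unfolding eq[symmetric] using fa t(2)[of j] pc hu(3)[OF u] by simp
        moreover have "inv (f a) \<otimes> f b \<in> Q" unfolding Q_def using a b by auto
        ultimately show False using ht[OF u] by simp
      qed
      ultimately show ?thesis by (intro exI[of _ ?h] conjI) auto
    qed
    then show "\<exists>V. openin X V \<and> x \<in> V \<and>
      (\<forall>U a k. U \<subseteq> V \<inter> (B - A) \<and> compactin X U \<and> a \<in> A \<longrightarrow>
        (\<exists>h. continuous_map (subtopology X U) T h \<and> inj_on h U \<and>
             (\<forall>u\<in>U. \<exists>n\<in>N k. h u = f a \<otimes> n) \<and> h ` U \<inter> f ` A = {}))"
      using V by (intro exI[of _ V]) simp
  qed
  then obtain g where g: "continuous_map (subtopology X B) T g" "inj_on g B" "\<forall>x\<in>A. g x = f x"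
      "\<forall>x\<in>B. g x \<in> f ` A \<or> (\<exists>a\<in>A. \<exists>n\<in>N 0. g x = f a \<otimes> n)"
    by (elim exE conjE)
  have "\<forall>x\<in>B. g x \<in> f ` A \<or> (\<exists>a\<in>A. \<exists>n\<in>O'. g x = f a \<otimes> n)"
    using g(4) N0 by (meson subsetD)
  then show ?thesis using g(1-3) by (intro exI[of _ g] conjI)
qed

lemma extend_perfect:
  fixes X :: "'x topology"
  assumes X: "Hausdorff_space X" and co: "coded X B \<phi>"
    and A: "A \<subseteq> B" "compactin X A" "A \<noteq> {}"
    and f: "continuous_map (subtopology X A) T f" "inj_on f A"
    and P: "coded T P \<psi>" "dense_in_itself T P" "P \<noteq> {}" and O: "openin T O'" "\<one> \<in> O'"
  shows "\<exists>g. continuous_map (subtopology X B) T g \<and> inj_on g B \<and> (\<forall>x\<in>A. g x = f x) \<and>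
    (\<forall>x\<in>B. g x \<in> f ` A \<or> (\<exists>a\<in>A. \<exists>n\<in>O'. g x = f a \<otimes> n))"
proof -
  obtain p where p: "p \<in> P" using P(3) by blast
  show ?thesis
  proof (rule extend_by_copies[OF X co A f P(1) p O])
    fix x assume x: "x \<in> B - A"
    have "\<exists>h. continuous_map (subtopology X U) T h \<and> inj_on h U \<and> h ` U \<subseteq> P \<inter> W"
      if U: "U \<subseteq> B - A" "compactin X U" and W: "openin T W" "p \<in> W" for U W
    proof -
      have "coded X U \<phi>" using coded_subset[OF co U(2)] U(1) by blast
      from embed_perfect[OF P(1,2) p W this] show ?thesis by metis
    qed
    moreover have "x \<in> topspace X" using x coded_imp_subset[OF co] by blast
    ultimately show "\<exists>V. openin X V \<and> x \<in> V \<and>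
      (\<forall>U W. U \<subseteq> V \<inter> (B - A) \<and> compactin X U \<and> openin T W \<and> p \<in> W \<longrightarrow>
        (\<exists>h. continuous_map (subtopology X U) T h \<and> inj_on h U \<and> h ` U \<subseteq> P \<inter> W))"
      by (intro exI[of _ "topspace X"]) simp
  qed
qed

text \<open>Shrinking \<open>V\<close> leaves at most one point of the derived set, as
  \<open>embed_derived\<close> requires. Finiteness is local and off \<open>A\<close> because the
  derived set of a sum of compact sets can accumulate at its limit point, which is put into
  \<open>A\<close>.\<close>

lemma extend_scattered:
  fixes X :: "'x topology" and s :: "'c rel"
  assumes X: "Hausdorff_space X" and co: "coded X B \<phi>"
    and A: "A \<subseteq> B" "compactin X A" "A \<noteq> {}"
    and f: "continuous_map (subtopology X A) T f" "inj_on f A"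
    and P: "coded T P \<psi>" "p \<in> derived T P s" "Well_order s" and O: "openin T O'" "\<one> \<in> O'"
    and fin: "\<And>x. x \<in> B - A \<Longrightarrow> \<exists>V. openin X V \<and> x \<in> V \<and> finite (derived X B s \<inter> V)"
  shows "\<exists>g. continuous_map (subtopology X B) T g \<and> inj_on g B \<and> (\<forall>x\<in>A. g x = f x) \<and>
    (\<forall>x\<in>B. g x \<in> f ` A \<or> (\<exists>a\<in>A. \<exists>n\<in>O'. g x = f a \<otimes> n))"
proof -
  have p: "p \<in> P" using P(2) derived_subset[OF P(3), of T P] by blast
  have BX: "B \<subseteq> topspace X" using co by (rule coded_imp_subset)
  show ?thesis
  proof (rule extend_by_copies[OF X co A f P(1) p O])
    fix x assume "x \<in> B - A"
    from fin[OF this] obtain V where V: "openin X V" "x \<in> V" "finite (derived X B s \<inter> V)"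
      by (elim exE conjE)
    let ?D = "derived X B s \<inter> V - {x}"
    have "?D \<subseteq> topspace X" using derived_subset[OF P(3), of X B] BX by blast
    then have "closedin X ?D"
      using Hausdorff_imp_t1_space[OF X] V(3) unfolding t1_space_closedin_finite by simp
    with V(1) have op: "openin X (V - ?D)" by (rule openin_diff)
    have "\<exists>h. continuous_map (subtopology X U) T h \<and> inj_on h U \<and> h ` U \<subseteq> P \<inter> W"
      if U: "U \<subseteq> (V - ?D) \<inter> (B - A)" "compactin X U" and W: "openin T W" "p \<in> W" for U W
    proof -
      have UB: "U \<subseteq> B" using U(1) by blast
      have "derived X U s \<subseteq> derived X B s" using BX UB P(3) by (rule derived_mono)
      moreover have "derived X U s \<subseteq> V - ?D" using derived_subset[OF P(3), of X U] U(1) by blast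
      ultimately have "derived X U s \<subseteq> {x}" by blast
      then show ?thesis
        using embed_derived[OF X P(1,3) coded_subset[OF co U(2) UB] _ P(2) W] by blast
    qed
    then show "\<exists>V. openin X V \<and> x \<in> V \<and>
      (\<forall>U W. U \<subseteq> V \<inter> (B - A) \<and> compactin X U \<and> openin T W \<and> p \<in> W \<longrightarrow>
        (\<exists>h. continuous_map (subtopology X U) T h \<and> inj_on h U \<and> h ` U \<subseteq> P \<inter> W))"
      using op V(2) by (intro exI[of _ "V - ?D"]) simp
  qed
qed

end

section \<open>Sums of compact sets in the Cantor space\<close>

definition cantor :: "(nat \<Rightarrow> bool) topology" where
  "cantor = product_topology (\<lambda>_. discrete_topology UNIV) UNIV"

lemma topspace_cantor [simp]: "topspace cantor = UNIV"
  by (simp add: cantor_def)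

lemma Hausdorff_cantor: "Hausdorff_space cantor"
  unfolding cantor_def by (simp add: Hausdorff_space_product_topology)

lemma continuous_map_discrete_bool:
  "continuous_map X (discrete_topology (UNIV :: bool set)) f \<longleftrightarrow>
     openin X {x \<in> topspace X. f x} \<and> openin X {x \<in> topspace X. \<not> f x}"
proof
  assume f: "continuous_map X (discrete_topology (UNIV :: bool set)) f"
  then have op: "\<forall>U. openin X {x \<in> topspace X. f x \<in> U}"
    unfolding continuous_map by simp
  show "openin X {x \<in> topspace X. f x} \<and> openin X {x \<in> topspace X. \<not> f x}"
    using op[rule_format, of "{True}"] op[rule_format, of "{False}"] by simp
next
  assume f: "openin X {x \<in> topspace X. f x} \<and> openin X {x \<in> topspace X. \<not> f x}"
  have "openin X {x \<in> topspace X. f x \<in> U}" for U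
  proof -
    have "{x \<in> topspace X. f x \<in> U} =
        (if True \<in> U then {x \<in> topspace X. f x} else {}) \<union> (if False \<in> U then {x \<in> topspace X. \<not> f x} else {})"
      by auto (metis (full_types))+
    then show ?thesis using f by (simp add: openin_Un)
  qed
  then show "continuous_map X (discrete_topology (UNIV :: bool set)) f"
    unfolding continuous_map by simp
qed

lemma coded_cantor_UNIV: "coded cantor UNIV (\<lambda>x. x)"
  unfolding coded_def
proof (intro conjI allI)
  have "compact_space cantor"
    unfolding cantor_def by (simp add: compact_space_product_topology compact_space_discrete_topology)
  then show "compactin cantor UNIV" by (simp add: compact_space_def)
  show "inj_on (\<lambda>x. x) UNIV" by simp
  fix n
  have "continuous_map cantor (discrete_topology UNIV) (\<lambda>x. x n)"
    unfolding cantor_def by (rule continuous_map_product_projection) simp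
  then show "openin (subtopology cantor UNIV) {x \<in> UNIV. x n}" "openin (subtopology cantor UNIV) {x \<in> UNIV. \<not> x n}"
    unfolding continuous_map_discrete_bool by simp_all
qed

lemma coded_cantor: "compactin cantor A \<Longrightarrow> coded cantor A (\<lambda>x. x)"
  by (rule coded_subset[OF coded_cantor_UNIV]) simp_all

text \<open>The prefix of \<open>n\<close> zeros and a one places the \<open>n\<close>-th summand
  into \<open>block n\<close>; these open blocks are disjoint and converge to the zero
  sequence.\<close>

definition sum_code :: "nat \<Rightarrow> (nat \<Rightarrow> bool) \<Rightarrow> nat \<Rightarrow> bool" where
  "sum_code n z i = (if i < n then False else if i = n then True else z (i - Suc n))"

definition block :: "nat \<Rightarrow> (nat \<Rightarrow> bool) set" where
  "block n = {z. (\<forall>i<n. \<not> z i) \<and> z n}"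

lemma sum_code_block: "sum_code n z \<in> block n"
  by (simp add: block_def sum_code_def)

lemma sum_code_inject: "sum_code n z = sum_code n z' \<longleftrightarrow> z = z'"
proof
  assume eq: "sum_code n z = sum_code n z'"
  show "z = z'"
  proof
    fix i
    show "z i = z' i" using fun_cong[OF eq, of "i + Suc n"] by (simp add: sum_code_def)
  qed
qed simp

lemma block_unique: "z \<in> block m \<Longrightarrow> z \<in> block n \<Longrightarrow> m = n"
  unfolding block_def by (cases m n rule: linorder_cases) auto

lemma openin_block: "openin cantor (block n)"
proof -
  have "openin cantor (cyl (\<lambda>x. x) UNIV n (\<lambda>_. False))" "openin cantor {x. x n}"
    using openin_cyl[OF coded_cantor_UNIV, of n "\<lambda>_. False"] coded_cantor_UNIV
    unfolding coded_def by simp_all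
  moreover have "block n = cyl (\<lambda>x. x) UNIV n (\<lambda>_. False) \<inter> {x. x n}"
    by (auto simp: block_def cyl_def agree_def)
  ultimately show ?thesis by (simp add: openin_Int)
qed

lemma in_some_block:
  assumes "z \<noteq> (\<lambda>_. False)"
  obtains n where "z \<in> block n"
proof -
  have ex: "\<exists>i. z i"
  proof (rule ccontr)
    assume "\<nexists>i. z i"
    then have "z = (\<lambda>_. False)" by (simp add: fun_eq_iff)
    then show False using assms by simp
  qed
  define m where "m = (LEAST i. z i)"
  have "z m" unfolding m_def using ex by (rule LeastI_ex)
  moreover have "\<not> z i" if "i < m" for i
    using that unfolding m_def by (rule not_less_Least)
  ultimately have "z \<in> block m" by (simp add: block_def)
  then show ?thesis by (rule that)
qed

text \<open>The disjoint sum of the \<open>Y n\<close>, with the zero sequence as the only point at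
  which the different copies can accumulate.\<close>

definition sum_set :: "(nat \<Rightarrow> 'a \<Rightarrow> nat \<Rightarrow> bool) \<Rightarrow> (nat \<Rightarrow> 'a set) \<Rightarrow> (nat \<Rightarrow> bool) set" where
  "sum_set \<phi> Y = insert (\<lambda>_. False) (\<Union>n. (\<lambda>y. sum_code n (\<phi> n y)) ` Y n)"

locale coded_sequence =
  fixes X :: "'a topology" and Y :: "nat \<Rightarrow> 'a set" and \<phi>
  assumes coded: "\<And>n. coded X (Y n) (\<phi> n)"
begin

abbreviation "e n \<equiv> (\<lambda>y. sum_code n (\<phi> n y))"

lemma continuous_e: "continuous_map (subtopology X (Y n)) cantor (e n)"
  unfolding cantor_def continuous_map_componentwise_UNIV
proof
  fix i
  have top: "topspace (subtopology X (Y n)) = Y n"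
    using coded_imp_subset[OF coded[of n]] by auto
  have Yn: "openin (subtopology X (Y n)) (Y n)"
    using openin_topspace[of "subtopology X (Y n)"] unfolding top .
  have \<phi>: "openin (subtopology X (Y n)) {x \<in> Y n. \<phi> n x m}" "openin (subtopology X (Y n)) {x \<in> Y n. \<not> \<phi> n x m}" for m
    using coded[of n] unfolding coded_def by simp_all
  show "continuous_map (subtopology X (Y n)) (discrete_topology UNIV) (\<lambda>y. e n y i)"
    unfolding continuous_map_discrete_bool top using Yn \<phi>[of "i - Suc n"]
    by (cases i n rule: linorder_cases) (simp_all add: sum_code_def)
qed

lemma inj_e: "inj_on (e n) (Y n)"
  using coded_imp_inj[OF coded[of n]] unfolding inj_on_def sum_code_inject by simp

lemma sum_set_Int_block: "sum_set \<phi> Y \<inter> block n = e n ` Y n"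
proof (intro equalityI subsetI)
  fix z assume z: "z \<in> sum_set \<phi> Y \<inter> block n"
  then have "z \<noteq> (\<lambda>_. False)" by (auto simp: block_def)
  then obtain m y where y: "y \<in> Y m" "z = e m y" using z unfolding sum_set_def by auto
  then have "m = n" using block_unique[of z m n] sum_code_block[of m] z by simp
  then show "z \<in> e n ` Y n" using y by blast
next
  fix z assume "z \<in> e n ` Y n"
  then show "z \<in> sum_set \<phi> Y \<inter> block n"
    using sum_code_block unfolding sum_set_def by auto
qed

lemma compactin_e_image: "compactin cantor (e n ` Y n)"
  by (rule compact_image_of_injective(1)[OF coded_imp_compactin[OF coded] Hausdorff_cantor continuous_e inj_e])

text \<open>Off the zero sequence a point lies in an open block, where the set reduces to the
  compact image of one summand.\<close>

lemma compactin_sum_set: "compactin cantor (sum_set \<phi> Y)"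
proof -
  have "openin cantor (UNIV - sum_set \<phi> Y)"
  proof (subst openin_subopen, intro ballI)
    fix z assume z: "z \<in> UNIV - sum_set \<phi> Y"
    then have "z \<noteq> (\<lambda>_. False)" by (auto simp: sum_set_def)
    then obtain n where n: "z \<in> block n" by (rule in_some_block)
    have "openin cantor (block n - e n ` Y n)"
      using openin_block compactin_imp_closedin[OF Hausdorff_cantor compactin_e_image] by (rule openin_diff)
    moreover have "z \<in> block n - e n ` Y n" using n z sum_set_Int_block[of n] by blast
    moreover have "block n - e n ` Y n \<subseteq> UNIV - sum_set \<phi> Y" using sum_set_Int_block[of n] by blast
    ultimately show "\<exists>V. openin cantor V \<and> z \<in> V \<and> V \<subseteq> UNIV - sum_set \<phi> Y"
      by (intro exI[of _ "block n - e n ` Y n"] conjI)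
  qed
  then have "closedin cantor (sum_set \<phi> Y)" by (simp add: closedin_def)
  moreover have "compactin cantor UNIV" using coded_cantor_UNIV by (rule coded_imp_compactin)
  ultimately show ?thesis by (rule closed_compactin[rotated 2]) simp
qed

text \<open>A nonempty dense-in-itself subset contains more than the zero sequence. Its part in the
  open block of another point is again dense in itself, inside the image of one scattered
  summand.\<close>

lemma scattered_sum_set:
  assumes "\<And>n. scattered_space (subtopology X (Y n))"
  shows "scattered_space (subtopology cantor (sum_set \<phi> Y))"
proof -
  have sub: "sum_set \<phi> Y \<subseteq> topspace cantor" by simp
  show ?thesis
    unfolding scattered_subtopology_iff[OF sub]
  proof (intro allI impI notI)
    fix A assume A: "A \<subseteq> sum_set \<phi> Y \<and> A \<noteq> {}" and dii: "dense_in_itself cantor A"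
    have "\<exists>z\<in>A. z \<noteq> (\<lambda>_. False)"
    proof (rule ccontr)
      assume "\<not> ?thesis"
      then have all: "\<forall>z\<in>A. z = (\<lambda>_. False)" by simp
      have "openin cantor UNIV" using openin_topspace[of cantor] by simp
      moreover obtain a where "a \<in> A" using A by auto
      ultimately obtain y where "y \<in> A" "y \<noteq> a" using dii unfolding dense_in_itself_def by (metis UNIV_I)
      have "y = a"
        using bspec[OF all \<open>y \<in> A\<close>] bspec[OF all \<open>a \<in> A\<close>] by (rule trans[OF _ sym])
      with \<open>y \<noteq> a\<close> show False by (rule notE)
    qed
    then obtain z where z: "z \<in> A" "z \<noteq> (\<lambda>_. False)" ..
    from z(2) obtain n where n: "z \<in> block n" by (rule in_some_block)
    let ?A = "A \<inter> block n"
    have "dense_in_itself cantor ?A"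
      unfolding dense_in_itself_def
    proof (intro ballI allI impI)
      fix x V assume x: "x \<in> ?A" and V: "openin cantor V \<and> x \<in> V"
      have "openin cantor (V \<inter> block n)" using V openin_block by (intro openin_Int) simp_all
      moreover have "x \<in> V \<inter> block n" "x \<in> A" using x V by simp_all
      ultimately obtain y where "y \<in> A" "y \<in> V \<inter> block n" "y \<noteq> x"
        using dii unfolding dense_in_itself_def by blast
      then show "\<exists>y\<in>?A. y \<in> V \<and> y \<noteq> x" by blast
    qed
    moreover have "?A \<subseteq> e n ` Y n" using A sum_set_Int_block[of n] by blast
    moreover have "?A \<noteq> {}" using z(1) n by blast
    moreover have "scattered_space (subtopology cantor (e n ` Y n))"
      by (rule scattered_image[OF coded_imp_compactin[OF coded] assms Hausdorff_cantor continuous_e inj_e])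
    moreover have "e n ` Y n \<subseteq> topspace cantor" by simp
    ultimately show False using scattered_subtopology_iff[of "e n ` Y n" cantor] by simp
  qed
qed

lemma e_derived:
  assumes "Well_order s"
  shows "e n ` derived X (Y n) s \<subseteq> derived cantor (sum_set \<phi> Y) s"
proof -
  have "e n ` derived X (Y n) s \<subseteq> derived cantor (e n ` Y n) s"
    by (rule derived_image[OF coded_imp_subset[OF coded] continuous_e inj_e assms])
  also have "\<dots> \<subseteq> derived cantor (sum_set \<phi> Y) s"
    by (rule derived_mono[OF _ _ assms]) (use sum_set_Int_block[of n] in auto)
  finally show ?thesis .
qed

text \<open>Derived sets are local, so in a block only one summand counts, and the inverse of its
  embedding transports finiteness.\<close>

lemma finite_derived_sum_set:
  assumes s: "Well_order s" and fin: "\<And>n. finite (derived X (Y n) s)" and z: "z \<noteq> (\<lambda>_. False)"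
  shows "\<exists>V. openin cantor V \<and> z \<in> V \<and> finite (derived cantor (sum_set \<phi> Y) s \<inter> V)"
proof -
  obtain n where n: "z \<in> block n" using z by (rule in_some_block)
  note inv = compact_image_of_injective(2)[OF coded_imp_compactin[OF coded] Hausdorff_cantor continuous_e inj_e, of n]
  let ?g = "inv_into (Y n) (e n)"
  have sub: "e n ` Y n \<subseteq> topspace cantor" by simp
  have ig: "inj_on ?g (e n ` Y n)" by (rule inj_on_inv_into) simp
  have "?g ` derived cantor (e n ` Y n) s \<subseteq> derived X (?g ` (e n ` Y n)) s"
    by (rule derived_image[OF sub inv ig s])
  also have "?g ` (e n ` Y n) = Y n" using inj_e by (rule inv_into_image_cancel) simp
  finally have "finite (?g ` derived cantor (e n ` Y n) s)" using fin by (rule finite_subset)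
  moreover have "inj_on ?g (derived cantor (e n ` Y n) s)"
    using ig derived_subset[OF s] by (rule inj_on_subset)
  ultimately have "finite (derived cantor (e n ` Y n) s)" by (rule finite_imageD)
  moreover have "derived cantor (sum_set \<phi> Y) s \<inter> block n \<subseteq> derived cantor (sum_set \<phi> Y \<inter> block n) s"
    by (rule derived_open_subset[OF _ openin_block s]) simp
  ultimately have "finite (derived cantor (sum_set \<phi> Y) s \<inter> block n)"
    unfolding sum_set_Int_block by (rule finite_subset[rotated])
  then show ?thesis using n openin_block by blast
qed

end

section \<open>Compact subsets of punctiform groups\<close>

lemma (in t1_group) open_subgroup_imp_closed:
  assumes H: "subgroup H G" "openin T H"
  shows "closedin T H"
proof -
  have Hc: "H \<subseteq> carrier G" using H(1) by (rule subgroup.subset)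
  have "openin T (carrier G - H)"
  proof (subst openin_subopen, intro ballI)
    fix x assume x: "x \<in> carrier G - H"
    then have xc: "x \<in> carrier G" by simp
    let ?V = "{y \<in> carrier G. inv x \<otimes> y \<in> H}"
    have "openin T ?V" using H(2) xc by (intro openin_translate_preimage) simp_all
    moreover have "x \<in> ?V" using xc subgroup.one_closed[OF H(1)] by simp
    moreover have "?V \<subseteq> carrier G - H"
    proof
      fix y assume y: "y \<in> ?V"
      have "y \<notin> H"
      proof
        assume yH: "y \<in> H"
        have "inv x \<otimes> y \<otimes> inv y \<in> H"
          using y by (intro subgroup.m_closed[OF H(1) _ subgroup.m_inv_closed[OF H(1) yH]]) blast
        moreover have "inv x \<otimes> y \<otimes> inv y = inv x" using y xc by (simp add: m_assoc)
        ultimately have "inv (inv x) \<in> H" using subgroup.m_inv_closed[OF H(1)] by simp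
        then show False using x by simp
      qed
      then show "y \<in> carrier G - H" using y by simp
    qed
    ultimately show "\<exists>V. openin T V \<and> x \<in> V \<and> V \<subseteq> carrier G - H" by (intro exI[of _ ?V] conjI)
  qed
  then show ?thesis using Hc by (simp add: closedin_def)
qed

text \<open>A subgroup with a \<open>k\<^sub>\<omega>\<close>-decomposition \<open>C\<close>; the
  last assumption with the subgroup itself as \<open>U\<close> makes it open.\<close>

locale sigma_compact_subgroup = t1_group G T for G :: "('a, 'm) monoid_scheme" (structure) and T +
  fixes H :: "'a set" and C :: "nat \<Rightarrow> 'a set"
  assumes H: "subgroup H G" and C_cover: "(\<Union>n. C n) = H" and C_compact: "compactin T (C n)"
    and C_openin: "U \<subseteq> H \<Longrightarrow> (\<And>n. openin (subtopology T (C n)) (U \<inter> C n)) \<Longrightarrow> openin T U"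
begin

lemma H_open: "openin T H"
proof (rule C_openin)
  fix n
  have "C n \<subseteq> topspace T" using C_compact by (rule compactin_subset_topspace)
  then have "H \<inter> C n = topspace (subtopology T (C n))" using C_cover by auto
  then show "openin (subtopology T (C n)) (H \<inter> C n)" by (metis openin_topspace)
qed simp

lemma H_closed: "closedin T H"
  using H H_open by (rule open_subgroup_imp_closed)

lemma H_subset: "H \<subseteq> carrier G"
  using H by (rule subgroup.subset)

lemma C_subset: "C n \<subseteq> H"
  using C_cover by blast

lemma compactin_finite_cover_C:
  assumes Q: "compactin T Q" "Q \<subseteq> H"
  shows "\<exists>n. Q \<subseteq> (\<Union>i<n. C i)"
proof (rule compactin_countable_cover[of "subtopology T H"])
  show "t1_space (subtopology T H)" using t1 by (rule t1_space_subtopology)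
  show "(\<Union>n. C n) = topspace (subtopology T H)" using C_cover H_subset by auto
  show "compactin (subtopology T H) Q" using Q by (simp add: compactin_subtopology)
  fix U assume U: "U \<subseteq> topspace (subtopology T H)"
    and op: "\<And>n. openin (subtopology (subtopology T H) (C n)) (U \<inter> C n)"
  have UH: "U \<subseteq> H" using U by auto
  have "subtopology (subtopology T H) (C n) = subtopology T (C n)" for n
    using C_subset[of n] by (simp add: subtopology_subtopology inf.absorb2)
  then have "openin T U" using C_openin[OF UH] op by simp
  then have "openin (subtopology T H) (U \<inter> H)" by (rule openin_subtopology_Int)
  then show "openin (subtopology T H) U" using UH by (simp add: inf.absorb1)
qed

end

lemma (in nonmetrizable_M_omega_grp) sigma_compact_subgroup_exists:
  assumes S: "countable S" "S \<subseteq> carrier G"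
  shows "\<exists>H C. sigma_compact_subgroup G T H C \<and> S \<subseteq> H"
proof -
  obtain H \<C> where H: "subgroup H G" "S \<subseteq> H" and \<C>: "countable \<C>" "\<Union>\<C> = H" "\<And>C. C \<in> \<C> \<Longrightarrow> compactin T C"
    "\<And>U. U \<subseteq> H \<Longrightarrow> (\<And>C. C \<in> \<C> \<Longrightarrow> openin (subtopology T C) (U \<inter> C)) \<Longrightarrow> openin T U"
    using open_sigma_compact_subgroup[OF S] by metis
  have ne: "\<C> \<noteq> {}" using \<C>(2) subgroup.one_closed[OF H(1)] by auto
  have range: "range (from_nat_into \<C>) = \<C>" using ne \<C>(1) by (rule range_from_nat_into)
  have "sigma_compact_subgroup G T H (from_nat_into \<C>)"
  proof (rule sigma_compact_subgroup.intro[OF t1_group_axioms], rule sigma_compact_subgroup_axioms.intro)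
    show "subgroup H G" by (rule H(1))
    show "(\<Union>n. from_nat_into \<C> n) = H" using range \<C>(2) by simp
    show "compactin T (from_nat_into \<C> n)" for n using \<C>(3) from_nat_into[OF ne] by simp
    show "openin T U" if "U \<subseteq> H" "\<And>n. openin (subtopology T (from_nat_into \<C> n)) (U \<inter> from_nat_into \<C> n)" for U
    proof (rule \<C>(4)[OF that(1)])
      fix C assume "C \<in> \<C>"
      then obtain n where "C = from_nat_into \<C> n" using range by (metis imageE)
      then show "openin (subtopology T C) (U \<inter> C)" using that(2)[of n] by simp
    qed
  qed
  then show ?thesis using H(2) by blast
qed

section \<open>Scattered and perfect compact sets, and the rank\<close>

locale punctiform_M_omega_grp = nonmetrizable_M_omega_grp +
  assumes punctiform: "punctiform_space T"
begin

lemma compactin_imp_coded: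
  assumes Q: "compactin T Q"
  obtains \<phi> where "coded T Q \<phi>"
proof -
  obtain n where n: "Q \<subseteq> (\<Union>i<n. K i)" using compactin_imp_finite_cover[OF Q] ..
  have eq: "Q = (\<Union>i\<in>{..<n}. Q \<inter> K i)" using n by blast
  show ?thesis
  proof (rule punctiform_compact_coded[OF Hausdorff punctiform Q _ eq])
    show "finite {..<n}" by simp
    show "compactin T (Q \<inter> K i)" for i using Q K_closed by (rule compact_Int_closedin)
    show "metrizable_space (subtopology T (Q \<inter> K i))" for i
    proof -
      have "subtopology T (Q \<inter> K i) = subtopology (subtopology T (K i)) Q"
        by (simp add: subtopology_subtopology inf_commute)
      then show ?thesis using metrizable_space_subtopology[OF K_metrizable] by simp
    qed
  qed (rule that)
qed

text \<open>Sum countably many copies of \<open>Q\<close>. Each copy carries a point of the finite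
  nonempty derived set at the index, so the sum has infinitely many of them. Away from its limit
  point the derived set is locally finite, hence \<open>extend_scattered\<close>, with
  \<open>Q\<close> itself as the model, embeds the sum into the group.\<close>

lemma rank_not_attained_nonempty:
  assumes Q: "compactin T Q" "scattered_space (subtopology T Q)" "Q \<noteq> {}"
  shows "scatteredness_index (subtopology T Q) <o compact_scatteredness_rank T"
proof -
  let ?s = "scatteredness_index (subtopology T Q)"
  note i = scatteredness_index[OF Q(2)]
  have QT: "Q \<subseteq> topspace T" using Q(1) by (rule compactin_subset_topspace)
  have fin: "finite (derived T Q ?s)" unfolding derived_def by (rule i(2))
  have "derived T Q ?s \<noteq> {}"
  proof (rule derived_nonempty[OF Hausdorff Q(1,3) i(1)])
    fix t :: "'a set rel" assume t: "t <o ?s"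
    then have "Well_order t" by (simp add: ordLess_def)
    then show "infinite (derived T Q t)" using infinite_derived_iff[OF QT Q(2)] t by blast
  qed
  then obtain p where p: "p \<in> derived T Q ?s" by blast
  obtain \<psi> where \<psi>: "coded T Q \<psi>" using compactin_imp_coded[OF Q(1)] .
  interpret cs: coded_sequence T "\<lambda>_. Q" "\<lambda>_. \<psi>" by standard (rule \<psi>)
  let ?S = "sum_set (\<lambda>_. \<psi>) (\<lambda>_. Q)" and ?z = "\<lambda>_::nat. False"
  have S: "compactin cantor ?S" by (rule cs.compactin_sum_set)
  have "\<exists>g. continuous_map (subtopology cantor ?S) T g \<and> inj_on g ?S \<and> (\<forall>x\<in>{?z}. g x = \<one>) \<and>
    (\<forall>x\<in>?S. g x \<in> (\<lambda>_. \<one>) ` {?z} \<or> (\<exists>a\<in>{?z}. \<exists>n\<in>carrier G. g x = \<one> \<otimes> n))"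
  proof (rule extend_scattered[OF Hausdorff_cantor coded_cantor[OF S] _ _ _ _ _ \<psi> p i(1)])
    show "{?z} \<subseteq> ?S" by (simp add: sum_set_def)
    show "compactin cantor {?z}" "{?z} \<noteq> {}" "inj_on (\<lambda>_. \<one>) {?z}" "\<one> \<in> carrier G" by simp_all
    show "continuous_map (subtopology cantor {?z}) T (\<lambda>_. \<one>)" by simp
    show "openin T (carrier G)" using openin_topspace[of T] by simp
    fix x assume "x \<in> ?S - {?z}"
    then have "x \<noteq> ?z" by blast
    then show "\<exists>V. openin cantor V \<and> x \<in> V \<and> finite (derived cantor ?S ?s \<inter> V)"
      by (rule cs.finite_derived_sum_set[OF i(1) fin])
  qed
  then obtain g where g: "continuous_map (subtopology cantor ?S) T g" "inj_on g ?S"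
    by (elim exE conjE)
  have sc: "scattered_space (subtopology cantor ?S)" by (rule cs.scattered_sum_set[OF Q(2)])
  have "inj (\<lambda>n. cs.e n p)"
  proof (rule injI)
    fix m n assume "cs.e m p = cs.e n p"
    then have "cs.e m p \<in> block n" using sum_code_block[of n "\<psi> p"] by simp
    then show "m = n" using sum_code_block by (rule block_unique[rotated])
  qed
  then have "infinite (range (\<lambda>n. cs.e n p))" by (rule range_inj_infinite)
  moreover have "range (\<lambda>n. cs.e n p) \<subseteq> derived cantor ?S ?s"
    using cs.e_derived[OF i(1)] p by blast
  ultimately have inf: "infinite (derived cantor ?S ?s)" by (meson finite_subset)
  have "inj_on g (derived cantor ?S ?s)"
    using g(2) derived_subset[OF i(1)] by (rule inj_on_subset)
  then have "infinite (g ` derived cantor ?S ?s)" using inf by (meson finite_imageD)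
  moreover have "g ` derived cantor ?S ?s \<subseteq> derived T (g ` ?S) ?s"
    by (rule derived_image[OF _ g i(1)]) simp
  ultimately have "infinite (derived T (g ` ?S) ?s)" by (meson finite_subset)
  moreover have "compactin T (g ` ?S)" by (rule compact_image_of_injective(1)[OF S Hausdorff g])
  moreover have "scattered_space (subtopology T (g ` ?S))" by (rule scattered_image[OF S sc Hausdorff g])
  ultimately show ?thesis unfolding ordLess_rank_iff[OF i(1)] by (intro exI[of _ "g ` ?S"] conjI)
qed

lemma rank_not_attained:
  assumes Q: "compactin T Q" "scattered_space (subtopology T Q)"
  shows "scatteredness_index (subtopology T Q) <o compact_scatteredness_rank T"
proof (cases "Q = {}")
  case True
  \<comment> \<open>The index of the empty set is at most that of a singleton, to which the nonempty
    case applies.\<close>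
  have one: "compactin T {\<one>}" by simp
  have "scattered_space (subtopology T {\<one>})"
  proof -
    have sub: "{\<one>} \<subseteq> topspace T" by simp
    show ?thesis
      unfolding scattered_subtopology_iff[OF sub]
    proof (intro allI impI notI)
      fix A assume "A \<subseteq> {\<one>} \<and> A \<noteq> {}" "dense_in_itself T A"
      then have "dense_in_itself T {\<one>}" by (metis subset_singletonD)
      then show False
        using openin_topspace[of T] unfolding dense_in_itself_def by auto
    qed
  qed
  note one = one this
  note less = rank_not_attained_nonempty[OF one]
  have wo: "Well_order (scatteredness_index (subtopology T {\<one>}))" by (rule scatteredness_index(1)[OF one(2)])
  have "derived T Q (scatteredness_index (subtopology T {\<one>})) \<subseteq> {}"
    using derived_subset[OF wo, of T Q] True by simp
  then have "scatteredness_index (subtopology T Q) \<le>o scatteredness_index (subtopology T {\<one>})"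
    by (intro scatteredness_index(3)[OF Q(2) wo]) (simp add: derived_def)
  then show ?thesis using less by (meson ordLeq_ordLess_trans insert_not_empty)
qed (rule rank_not_attained_nonempty[OF Q])

text \<open>The infinite derived set accumulates at some \<open>q\<close> of the compact set;
  translating \<open>q\<close> to the unit brings infinitely many of its points into
  \<open>H\<close>. This reduces questions about the rank to compact subsets of an open
  subgroup.\<close>

lemma infinite_derived_near_one:
  assumes Q: "compactin T Q" and s: "Well_order s" and inf: "infinite (derived T Q s)" and H: "openin T H" "\<one> \<in> H"
  obtains q where "q \<in> carrier G" "infinite (derived T ((\<lambda>x. inv q \<otimes> x) ` Q \<inter> H) s)"
proof -
  have QT: "Q \<subseteq> topspace T" using Q by (rule compactin_subset_topspace)
  have "Q \<inter> T derived_set_of (derived T Q s) \<noteq> {}"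
    using compactin_imp_Bolzano_Weierstrass[OF Q] inf derived_subset[OF s, of T Q] by blast
  then obtain q where q: "q \<in> Q" "q \<in> T derived_set_of (derived T Q s)" by blast
  have qc: "q \<in> carrier G" using q(1) QT by auto
  let ?l = "\<lambda>x. inv q \<otimes> x"
  have l: "continuous_map (subtopology T Q) T ?l" "inj_on ?l Q"
  proof -
    have "continuous_map (subtopology T Q) T (\<lambda>x. x)"
      using continuous_map_from_subtopology[OF continuous_map_id, of T Q] by (simp add: id_def)
    then show "continuous_map (subtopology T Q) T ?l"
      using qc by (intro continuous_map_mult continuous_map_constI) simp_all
    show "inj_on ?l Q" using QT qc by (intro inj_onI) (auto simp: subset_iff)
  qed
  let ?V = "{x \<in> carrier G. inv q \<otimes> x \<in> H}"
  have "openin T ?V" using H(1) qc by (intro openin_translate_preimage) simp_all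
  moreover have "q \<in> ?V" using qc H(2) by simp
  ultimately have "infinite (derived T Q s \<inter> ?V)"
  proof -
    assume V: "openin T ?V" "q \<in> ?V"
    show ?thesis
    proof
      assume fin: "finite (derived T Q s \<inter> ?V)"
      let ?D = "derived T Q s \<inter> ?V - {q}"
      have "?D \<subseteq> topspace T" by auto
      then have "closedin T ?D" using t1 fin unfolding t1_space_closedin_finite by simp
      with V(1) have op: "openin T (?V - ?D)" by (rule openin_diff)
      define W where "W = ?V - ?D"
      have W: "q \<in> W \<and> openin T W" using qc H(2) op unfolding W_def by simp
      have "\<forall>V. q \<in> V \<and> openin T V \<longrightarrow> (\<exists>y\<noteq>q. y \<in> derived T Q s \<and> y \<in> V)"
        using q(2) unfolding derived_set_of_def by simp
      from mp[OF spec[OF this] W] obtain y where "y \<noteq> q" "y \<in> derived T Q s" "y \<in> W" by blast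
      then have "y \<in> ?D" "y \<in> ?V - ?D" unfolding W_def by auto
      then show False by blast
    qed
  qed
  moreover have "inj_on ?l (derived T Q s \<inter> ?V)"
    using l(2) by (rule inj_on_subset) (use derived_subset[OF s, of T Q] in blast)
  ultimately have "infinite (?l ` (derived T Q s \<inter> ?V))" by (meson finite_imageD)
  moreover have "?l ` (derived T Q s \<inter> ?V) \<subseteq> derived T (?l ` Q \<inter> H) s"
  proof -
    have "?l ` derived T Q s \<subseteq> derived T (?l ` Q) s" by (rule derived_image[OF QT l s])
    moreover have "derived T (?l ` Q) s \<inter> H \<subseteq> derived T (?l ` Q \<inter> H) s"
      using QT qc by (intro derived_open_subset[OF _ H(1) s]) auto
    ultimately show ?thesis by blast
  qed
  ultimately have "infinite (derived T (?l ` Q \<inter> H) s)" by (meson finite_subset)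
  with qc show ?thesis by (rule that)
qed

lemma compactin_left_translate:
  assumes "compactin T Q" "q \<in> carrier G"
  shows "compactin T ((\<lambda>x. q \<otimes> x) ` Q)"
  using assms(2) continuous_map_id[of T]
  by (intro image_compactin[OF assms(1)] continuous_map_mult continuous_map_constI) (simp_all add: id_def)

text \<open>The closure of a dense-in-itself set is dense in itself, and inside \<open>Q\<close> it
  is compact.\<close>

lemma scattered_compactI:
  assumes no_perfect: "\<And>P. compactin T P \<Longrightarrow> P \<noteq> {} \<Longrightarrow> \<not> dense_in_itself T P" and Q: "compactin T Q"
  shows "scattered_space (subtopology T Q)"
proof -
  have QT: "Q \<subseteq> topspace T" using Q by (rule compactin_subset_topspace)
  show ?thesis
    unfolding scattered_subtopology_iff[OF QT]
  proof (intro allI impI notI)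
    fix A assume A: "A \<subseteq> Q \<and> A \<noteq> {}" and dii: "dense_in_itself T A"
    let ?P = "T closure_of A"
    have PQ: "?P \<subseteq> Q" using A compactin_imp_closedin[OF Hausdorff Q] by (intro closure_of_minimal) simp_all
    have P: "compactin T ?P" using Q PQ closedin_closure_of by (rule closed_compactin)
    have AP: "A \<subseteq> ?P" using A QT by (intro closure_of_subset) blast
    have "dense_in_itself T ?P"
      unfolding dense_in_itself_def
    proof (intro ballI allI impI)
      fix x V assume x: "x \<in> ?P" and V: "openin T V \<and> x \<in> V"
      show "\<exists>y\<in>?P. y \<in> V \<and> y \<noteq> x"
      proof (cases "x \<in> A")
        case True
        then obtain y where "y \<in> A" "y \<in> V" "y \<noteq> x" using dii V unfolding dense_in_itself_def by blast
        then show ?thesis using AP by blast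
      next
        case False
        obtain y where "y \<in> A" "y \<in> V" using x V unfolding in_closure_of by blast
        then show ?thesis using AP False by blast
      qed
    qed
    then show False using no_perfect[OF P] A AP by blast
  qed
qed

text \<open>
  The sum of the members of a \<open>k\<^sub>\<omega>\<close>-decomposition is a scattered compact set whose index bounds the
  rank of a group without perfect compact subsets.
\<close>

lemma scattered_compact_bounding_rank:
  assumes no_perfect: "\<And>P. compactin T P \<Longrightarrow> P \<noteq> {} \<Longrightarrow> \<not> dense_in_itself T P"
  obtains L where "compactin cantor L" "scattered_space (subtopology cantor L)"
    "\<And>Q (s :: 'c rel). compactin T Q \<Longrightarrow> Well_order s \<Longrightarrow> infinite (derived T Q s) \<Longrightarrow> infinite (derived cantor L s)"
proof -
  obtain H C where "sigma_compact_subgroup G T H C"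
    using sigma_compact_subgroup_exists[of "{}"] by auto
  then interpret sc: sigma_compact_subgroup G T H C .
  \<comment> \<open>Increasing unions, so that each compact subset of \<open>H\<close> lies in a
    single summand.\<close>
  define E where "E n = (\<Union>i<n. C i)" for n
  have E: "compactin T (E n)" for n
    unfolding E_def using sc.C_compact by (intro compactin_Union) auto
  have "\<forall>n. \<exists>\<phi>. coded T (E n) \<phi>"
  proof
    show "\<exists>\<phi>. coded T (E n) \<phi>" for n by (rule compactin_imp_coded[OF E[of n]]) (rule exI)
  qed
  from choice[OF this] obtain \<phi> where \<phi>: "\<forall>n. coded T (E n) (\<phi> n)" ..
  interpret cs: coded_sequence T E \<phi> by standard (use \<phi> in simp)
  show ?thesis
  proof (rule that[of "sum_set \<phi> E"])
    show "compactin cantor (sum_set \<phi> E)" by (rule cs.compactin_sum_set)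
    show "scattered_space (subtopology cantor (sum_set \<phi> E))"
      by (rule cs.scattered_sum_set[OF scattered_compactI[OF no_perfect E]])
    fix Q and s :: "'c rel"
    assume Q: "compactin T Q" and s: "Well_order s" and inf: "infinite (derived T Q s)"
    obtain q where q: "q \<in> carrier G" "infinite (derived T ((\<lambda>x. inv q \<otimes> x) ` Q \<inter> H) s)"
      using infinite_derived_near_one[OF Q s inf sc.H_open subgroup.one_closed[OF sc.H]] .
    let ?Q = "(\<lambda>x. inv q \<otimes> x) ` Q \<inter> H"
    have "compactin T ?Q"
      using compactin_left_translate[OF Q, of "inv q"] q(1) sc.H_closed by (intro compact_Int_closedin) simp_all
    then obtain n where n: "?Q \<subseteq> E n" using sc.compactin_finite_cover_C[of ?Q] unfolding E_def by auto
    have "derived T ?Q s \<subseteq> derived T (E n) s"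
      using compactin_subset_topspace[OF E] n s by (rule derived_mono)
    then have "infinite (derived T (E n) s)" using q(2) by (meson finite_subset)
    moreover have "inj_on (cs.e n) (derived T (E n) s)"
      using cs.inj_e derived_subset[OF s] by (rule inj_on_subset)
    ultimately have "infinite (cs.e n ` derived T (E n) s)" by (meson finite_imageD)
    then show "infinite (derived cantor (sum_set \<phi> E) s)"
      using cs.e_derived[OF s, of n] by (meson finite_subset)
  qed
qed

text \<open>\<open>L\<close> embeds into the perfect set \<open>P\<close>, and the index of its
  image is below the rank, which is never attained. For an \<open>L\<close> that bounds the rank of
  a group without perfect compact sets, this shows that the two ranks differ.\<close>

lemma perfect_rank_exceeds:
  assumes P: "compactin T P" "P \<noteq> {}" "dense_in_itself T P"
    and L: "compactin cantor L" "scattered_space (subtopology cantor L)"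
  obtains s :: "'a set rel" where "Well_order s" "s <o compact_scatteredness_rank T" "finite (derived cantor L s)"
proof -
  obtain p where p: "p \<in> P" using P(2) by blast
  obtain \<psi> where \<psi>: "coded T P \<psi>" using compactin_imp_coded[OF P(1)] .
  have top: "openin T (topspace T)" "p \<in> topspace T"
    using p compactin_subset_topspace[OF P(1)] openin_topspace[of T] by auto
  obtain h where h: "continuous_map (subtopology cantor L) T h" "inj_on h L"
    using embed_perfect[OF \<psi> P(3) p top coded_cantor[OF L(1)]] by metis
  let ?s = "scatteredness_index (subtopology T (h ` L))"
  have cpt: "compactin T (h ` L)" by (rule compact_image_of_injective(1)[OF L(1) Hausdorff h])
  have sc: "scattered_space (subtopology T (h ` L))" by (rule scattered_image[OF L Hausdorff h])
  note i = scatteredness_index[OF sc]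
  have "h ` derived cantor L ?s \<subseteq> derived T (h ` L) ?s"
    by (rule derived_image[OF _ h i(1)]) simp
  moreover have "finite (derived T (h ` L) ?s)" unfolding derived_def by (rule i(2))
  ultimately have "finite (h ` derived cantor L ?s)" by (meson finite_subset)
  moreover have "inj_on h (derived cantor L ?s)" using h(2) derived_subset[OF i(1)] by (rule inj_on_subset)
  ultimately have "finite (derived cantor L ?s)" by (rule finite_imageD)
  then show ?thesis using that i(1) rank_not_attained[OF cpt sc] by blast
qed

end

section \<open>The back-and-forth construction\<close>

text \<open>A perfect compact set in the target accommodates every piece. Without one, equality of
  ranks excludes perfect compact sets from the source as well, so \<open>B\<close> is scattered with
  index below the common rank, and some compact set of the target has points in its derived set at
  that index. Taking the factors \<open>n\<close> from \<open>H'\<close> keeps the image in the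
  subgroup.\<close>

lemma extend_into_open_subgroup:
  fixes G :: "('a, 'm) monoid_scheme" and T :: "'a topology"
    and G' :: "('b, 'n) monoid_scheme" and T' :: "'b topology"
  assumes "punctiform_M_omega_grp G T K" "punctiform_M_omega_grp G' T' K'"
    and rank: "compact_scatteredness_rank T =o compact_scatteredness_rank T'"
    and H': "subgroup H' G'" "openin T' H'"
    and B: "compactin T B" and A: "A \<subseteq> B" "compactin T A" "A \<noteq> {}"
    and f: "continuous_map (subtopology T A) T' f" "inj_on f A" "f ` A \<subseteq> H'"
  shows "\<exists>g. continuous_map (subtopology T B) T' g \<and> inj_on g B \<and> (\<forall>x\<in>A. g x = f x) \<and> g ` B \<subseteq> H'"
proof -
  interpret G1: punctiform_M_omega_grp G T K by fact
  interpret G2: punctiform_M_omega_grp G' T' K' by fact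
  obtain \<phi> where \<phi>: "coded T B \<phi>" using G1.compactin_imp_coded[OF B] .
  have one: "\<one>\<^bsub>G'\<^esub> \<in> H'" using H'(1) by (rule subgroup.one_closed)
  have "\<exists>g. continuous_map (subtopology T B) T' g \<and> inj_on g B \<and> (\<forall>x\<in>A. g x = f x) \<and>
    (\<forall>x\<in>B. g x \<in> f ` A \<or> (\<exists>a\<in>A. \<exists>n\<in>H'. g x = f a \<otimes>\<^bsub>G'\<^esub> n))"
  proof (cases "\<exists>P. compactin T' P \<and> P \<noteq> {} \<and> dense_in_itself T' P")
    case True
    then obtain P where P: "compactin T' P" "P \<noteq> {}" "dense_in_itself T' P" by (elim exE conjE)
    obtain \<psi> where "coded T' P \<psi>" using G2.compactin_imp_coded[OF P(1)] .
    then show ?thesis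
      by (rule G2.extend_perfect[OF G1.Hausdorff \<phi> A f(1,2) _ P(3,2) H'(2) one])
  next
    case False
    have no_perfect': "\<not> dense_in_itself T' P" if "compactin T' P" "P \<noteq> {}" for P
      using False that by blast
    \<comment> \<open>A perfect set would give an ordinal below the common rank at which the derived
      set of \<open>L\<close> is finite, whereas \<open>L\<close> has infinite derived sets at all
      ordinals below the rank of the target.\<close>
    have no_perfect: "\<not> dense_in_itself T P" if P: "compactin T P" "P \<noteq> {}" for P
    proof
      assume dii: "dense_in_itself T P"
      show False
      proof (rule G2.scattered_compact_bounding_rank[OF no_perfect'])
        fix L
        assume L: "compactin cantor L" "scattered_space (subtopology cantor L)"
          and bound: "\<And>Q (s :: 'a set rel). compactin T' Q \<Longrightarrow> Well_order s \<Longrightarrow> infinite (derived T' Q s) \<Longrightarrow> infinite (derived cantor L s)"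
        obtain s :: "'a set rel" where s: "Well_order s" "s <o compact_scatteredness_rank T" "finite (derived cantor L s)"
          by (rule G1.perfect_rank_exceeds[OF P dii L])
        have "s <o compact_scatteredness_rank T'" using s(2) rank by (rule ordLess_ordIso_trans)
        then obtain Q where "compactin T' Q" "infinite (derived T' Q s)"
          unfolding ordLess_rank_iff[OF s(1)] by (elim exE conjE)
        then show False using bound[OF _ s(1)] s(3) by simp
      qed simp_all
    qed
    have scB: "scattered_space (subtopology T B)" using no_perfect B by (rule G1.scattered_compactI)
    let ?s = "scatteredness_index (subtopology T B)"
    note i = scatteredness_index[OF scB]
    have "?s <o compact_scatteredness_rank T'"
      using G1.rank_not_attained[OF B scB] rank by (rule ordLess_ordIso_trans)
    then obtain Q where Q: "compactin T' Q" "infinite (derived T' Q ?s)"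
      unfolding ordLess_rank_iff[OF i(1)] by (elim exE conjE)
    then obtain p where p: "p \<in> derived T' Q ?s" by (metis ex_in_conv finite.emptyI)
    obtain \<psi> where \<psi>: "coded T' Q \<psi>" using G2.compactin_imp_coded[OF Q(1)] .
    show ?thesis
    proof (rule G2.extend_scattered[OF G1.Hausdorff \<phi> A f(1,2) \<psi> p i(1) H'(2) one])
      fix x assume "x \<in> B - A"
      then have "x \<in> topspace T" using compactin_subset_topspace[OF B] by auto
      moreover have "finite (derived T B ?s \<inter> topspace T)"
        using i(2) unfolding derived_def by simp
      ultimately show "\<exists>V. openin T V \<and> x \<in> V \<and> finite (derived T B ?s \<inter> V)"
        using openin_topspace[of T] by (intro exI[of _ "topspace T"] conjI)
    qed
  qed
  then obtain g where g: "continuous_map (subtopology T B) T' g" "inj_on g B" "\<forall>x\<in>A. g x = f x"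
    "\<forall>x\<in>B. g x \<in> f ` A \<or> (\<exists>a\<in>A. \<exists>n\<in>H'. g x = f a \<otimes>\<^bsub>G'\<^esub> n)" by (elim exE conjE)
  have "g x \<in> H'" if x: "x \<in> B" for x
  proof -
    consider "g x \<in> f ` A" | a n where "a \<in> A" "n \<in> H'" "g x = f a \<otimes>\<^bsub>G'\<^esub> n"
      using bspec[OF g(4) x] by blast
    then show ?thesis
    proof cases
      case 1
      then show ?thesis using f(3) by auto
    next
      case 2
      then show ?thesis using f(3) subgroup.m_closed[OF H'(1)] by auto
    qed
  qed
  then show ?thesis using g(1-3) by (intro exI[of _ g] conjI) auto
qed

lemma (in sigma_compact_subgroup) continuous_map_subgroupI:
  assumes "\<And>n. continuous_map (subtopology T (C n)) Y F"
  shows "continuous_map (subtopology T H) Y F"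
proof -
  have top: "topspace (subtopology T H) = H" "topspace (subtopology T (C n)) = C n" for n
    using H_subset C_subset[of n] by auto
  have FY: "F x \<in> topspace Y" if "x \<in> H" for x
  proof -
    obtain n where "x \<in> C n" using \<open>x \<in> H\<close> C_cover by auto
    then show ?thesis using assms[of n] unfolding continuous_map top by auto
  qed
  have "openin (subtopology T H) {x \<in> H. F x \<in> V}" if V: "openin Y V" for V
  proof -
    have "openin T {x \<in> H. F x \<in> V}"
    proof (rule C_openin)
      fix n
      have "{x \<in> H. F x \<in> V} \<inter> C n = {x \<in> C n. F x \<in> V}" using C_subset[of n] by auto
      then show "openin (subtopology T (C n)) ({x \<in> H. F x \<in> V} \<inter> C n)"
        using assms[of n] V unfolding continuous_map top by simp
    qed auto
    then have "openin (subtopology T H) ({x \<in> H. F x \<in> V} \<inter> H)" by (rule openin_subtopology_Int)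
    moreover have "{x \<in> H. F x \<in> V} \<inter> H = {x \<in> H. F x \<in> V}" by auto
    ultimately show ?thesis by simp
  qed
  then show ?thesis using FY unfolding continuous_map top by auto
qed

text \<open>A stage is a compact subset of \<open>H\<close> with an embedding into
  \<open>H'\<close>. Going forth puts \<open>C n\<close> into the domain, going back puts
  \<open>C' n\<close> into the image. The union of the embeddings is a homeomorphism because
  \<open>C\<close> and \<open>C'\<close> determine the topologies of \<open>H\<close> and
  \<open>H'\<close>.\<close>

lemma homeomorphic_open_subgroups:
  fixes G :: "('a, 'm) monoid_scheme" and T :: "'a topology"
    and G' :: "('b, 'n) monoid_scheme" and T' :: "'b topology"
  assumes 1: "punctiform_M_omega_grp G T K" and 2: "punctiform_M_omega_grp G' T' K'"
    and rank: "compact_scatteredness_rank T =o compact_scatteredness_rank T'"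
    and "sigma_compact_subgroup G T H C" "sigma_compact_subgroup G' T' H' C'"
  shows "subtopology T H homeomorphic_space subtopology T' H'"
proof -
  interpret G1: punctiform_M_omega_grp G T K by fact
  interpret G2: punctiform_M_omega_grp G' T' K' by fact
  interpret S1: sigma_compact_subgroup G T H C by fact
  interpret S2: sigma_compact_subgroup G' T' H' C' by fact
  have rank': "compact_scatteredness_rank T' =o compact_scatteredness_rank T"
    using rank by (rule ordIso_symmetric)
  define ok where "ok q \<longleftrightarrow> compactin T (fst q) \<and> fst q \<noteq> {} \<and> fst q \<subseteq> H \<and>
    continuous_map (subtopology T (fst q)) T' (snd q) \<and> inj_on (snd q) (fst q) \<and> snd q ` fst q \<subseteq> H'" for q
  define next_ok where "next_ok n q q' \<longleftrightarrow> ok q' \<and> fst q \<subseteq> fst q' \<and> C n \<subseteq> fst q' \<and> C' n \<subseteq> snd q' ` fst q' \<and>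
    (\<forall>x\<in>fst q. snd q' x = snd q x)" for n q q'
  have step: "\<exists>q'. next_ok n q q'" if q: "ok q" for n q
  proof -
    let ?A = "fst q" and ?f = "snd q"
    have A: "compactin T ?A" "?A \<noteq> {}" "?A \<subseteq> H" and f: "continuous_map (subtopology T ?A) T' ?f" "inj_on ?f ?A" "?f ` ?A \<subseteq> H'"
      using q unfolding ok_def by simp_all
    let ?B = "?A \<union> C n"
    have B: "compactin T ?B" "?A \<subseteq> ?B" "?B \<subseteq> H"
      using A S1.C_compact[of n] S1.C_subset[of n] by (auto intro: compactin_Un)
    obtain g where g: "continuous_map (subtopology T ?B) T' g" "inj_on g ?B" "\<forall>x\<in>?A. g x = ?f x" "g ` ?B \<subseteq> H'"
      using extend_into_open_subgroup[OF 1 2 rank S2.H S2.H_open B(1,2) A(1,2) f] by (elim exE conjE)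
    let ?D = "g ` ?B" and ?i = "inv_into ?B g"
    note D = compact_image_of_injective[OF B(1) G2.Hausdorff g(1,2)]
    have i_inj: "inj_on ?i ?D" by (rule inj_on_inv_into) simp
    have i_im: "?i ` ?D = ?B" using g(2) by (rule inv_into_image_cancel) simp
    \<comment> \<open>Going back, the inverse of \<open>g\<close> is extended over
      \<open>C' n\<close>; the inverse of the extension \<open>k\<close> is the new
      embedding.\<close>
    let ?E = "?D \<union> C' n"
    have E: "compactin T' ?E" "?D \<subseteq> ?E" "?E \<subseteq> H'"
      using D(1) g(4) S2.C_compact[of n] S2.C_subset[of n] by (auto intro: compactin_Un)
    have "?D \<noteq> {}" using A(2) by simp
    then obtain k where k: "continuous_map (subtopology T' ?E) T k" "inj_on k ?E" "\<forall>y\<in>?D. k y = ?i y" "k ` ?E \<subseteq> H"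
      using extend_into_open_subgroup[OF 2 1 rank' S1.H S1.H_open E(1,2) D(1) _ D(2) i_inj] i_im B(3)
      by (auto simp del: image_Un)
    note A' = compact_image_of_injective[OF E(1) G1.Hausdorff k(1,2)]
    let ?f' = "inv_into ?E k"
    have f'_im: "?f' ` (k ` ?E) = ?E" using k(2) by (rule inv_into_image_cancel) simp
    have kD: "k ` ?D = ?B" using k(3) i_im by (metis image_cong)
    have B_sub: "?B \<subseteq> k ` ?E" using kD E(2) by blast
    have "next_ok n q (k ` ?E, ?f')"
      unfolding next_ok_def ok_def fst_conv snd_conv
    proof (intro conjI ballI)
      show "compactin T (k ` ?E)" by (rule A'(1))
      show "k ` ?E \<noteq> {}" using \<open>?D \<noteq> {}\<close> by blast
      show "k ` ?E \<subseteq> H" by (rule k(4))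
      show "continuous_map (subtopology T (k ` ?E)) T' ?f'" by (rule A'(2))
      show "inj_on ?f' (k ` ?E)" by (rule inj_on_inv_into) simp
      show "?f' ` (k ` ?E) \<subseteq> H'" using f'_im E(3) by simp
      show "?A \<subseteq> k ` ?E" "C n \<subseteq> k ` ?E" using B_sub by simp_all
      show "C' n \<subseteq> ?f' ` (k ` ?E)" unfolding f'_im by blast
      fix x assume x: "x \<in> ?A"
      then have gx: "g x \<in> ?D" by blast
      have "k (g x) = x" using bspec[OF k(3) gx] inv_into_f_f[OF g(2), of x] x by simp
      moreover have "?f' (k (g x)) = g x" using k(2) by (rule inv_into_f_f) (use gx in blast)
      ultimately show "?f' x = ?f x" using g(3) x by simp
    qed
    then show ?thesis ..
  qed
  have "\<forall>p. \<exists>q'. ok (snd p) \<longrightarrow> next_ok (fst p) (snd p) q'" using step by blast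
  from choice[OF this] obtain nx where nx: "\<forall>p. ok (snd p) \<longrightarrow> next_ok (fst p) (snd p) (nx p)" ..
  \<comment> \<open>The units are matched first, since the extension lemma starts from a nonempty
    set.\<close>
  define st where "st = rec_nat ({\<one>\<^bsub>G\<^esub>}, \<lambda>_. \<one>\<^bsub>G'\<^esub>) (\<lambda>n q. nx (n, q))"
  have st_Suc: "st (Suc n) = nx (n, st n)" for n by (simp add: st_def)
  have ok0: "ok (st 0)"
    using subgroup.one_closed[OF S1.H] subgroup.one_closed[OF S2.H] by (simp add: st_def ok_def)
  have ok_st: "ok (st n)" for n
  proof (induction n)
    case (Suc n)
    then have "next_ok n (st n) (st (Suc n))" using nx[rule_format, of "(n, st n)"] unfolding st_Suc by simp
    then show ?case by (simp add: next_ok_def)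
  qed (rule ok0)
  have next_st: "next_ok n (st n) (st (Suc n))" for n
    using nx[rule_format, of "(n, st n)"] ok_st[of n] unfolding st_Suc by simp
  define A where "A n = fst (st n)" for n
  define f where "f n = snd (st n)" for n
  have A: "compactin T (A n)" "A n \<subseteq> H" "continuous_map (subtopology T (A n)) T' (f n)" "inj_on (f n) (A n)" "f n ` A n \<subseteq> H'" for n
    using ok_st[of n] unfolding ok_def A_def f_def by simp_all
  have nA: "A n \<subseteq> A (Suc n)" "C n \<subseteq> A (Suc n)" "C' n \<subseteq> f (Suc n) ` A (Suc n)" "\<And>x. x \<in> A n \<Longrightarrow> f (Suc n) x = f n x" for n
    using next_st[of n] unfolding next_ok_def A_def f_def by simp_all
  have A_mono: "A m \<subseteq> A n" if "m \<le> n" for m n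
    using that by (rule lift_Suc_mono_le[of A, OF nA(1)])
  have f_ext: "f n x = f m x" if x: "x \<in> A m" and "m \<le> n" for m n x
    using \<open>m \<le> n\<close>
  proof (induction n rule: dec_induct)
    case (step n)
    have "x \<in> A n" using x A_mono[OF step(1)] by blast
    then show ?case using nA(4) step by simp
  qed simp
  have H_A: "\<exists>n. x \<in> A n" if "x \<in> H" for x
  proof -
    obtain n where "x \<in> C n" using \<open>x \<in> H\<close> S1.C_cover by auto
    then show ?thesis using nA(2)[of n] by blast
  qed
  define F where "F x = f (LEAST n. x \<in> A n) x" for x
  have F_f: "F x = f n x" if "x \<in> A n" for n x
  proof -
    have "x \<in> A (LEAST n. x \<in> A n)" using that by (rule LeastI)
    moreover have "(LEAST n. x \<in> A n) \<le> n" using that by (rule Least_le)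
    ultimately show ?thesis unfolding F_def by (rule f_ext[symmetric])
  qed
  have F_H: "F x \<in> H'" if x: "x \<in> H" for x
  proof -
    obtain n where "x \<in> A n" using H_A[OF x] ..
    then show ?thesis using F_f A(5)[of n] by auto
  qed
  have F_inj: "inj_on F H"
  proof (rule inj_onI)
    fix x y assume xy: "x \<in> H" "y \<in> H" "F x = F y"
    obtain m n where "x \<in> A m" "y \<in> A n" using H_A xy(1,2) by metis
    then have "x \<in> A (max m n)" "y \<in> A (max m n)"
      using A_mono[of m "max m n"] A_mono[of n "max m n"] by auto
    then show "x = y" using inj_onD[OF A(4)] xy(3) F_f by simp
  qed
  have F_C': "\<exists>x. x \<in> A (Suc n) \<and> y = f (Suc n) x" if "y \<in> C' n" for y n
    using nA(3)[of n] that by blast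
  have inv_F: "inv_into H F y = inv_into (A (Suc n)) (f (Suc n)) y" if y: "y \<in> C' n" for y n
  proof -
    obtain x where x: "x \<in> A (Suc n)" "y = f (Suc n) x" using F_C'[OF y] by (elim exE conjE)
    have "inv_into (A (Suc n)) (f (Suc n)) y = x" unfolding x(2) using A(4) x(1) by (rule inv_into_f_f)
    moreover have "x \<in> H" using x(1) A(2)[of "Suc n"] by blast
    then have "inv_into H F (F x) = x" by (rule inv_into_f_f[OF F_inj])
    ultimately show ?thesis using F_f[OF x(1)] x(2) by simp
  qed
  have F_surj: "y \<in> F ` H" if "y \<in> H'" for y
  proof -
    obtain n where "y \<in> C' n" using \<open>y \<in> H'\<close> S2.C_cover by auto
    then obtain x where x: "x \<in> A (Suc n)" "y = f (Suc n) x" using F_C' by metis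
    then have "y = F x" using F_f by simp
    moreover have "x \<in> H" using x(1) A(2)[of "Suc n"] by blast
    ultimately show ?thesis by blast
  qed
  have top: "topspace (subtopology T H) = H" "topspace (subtopology T' H') = H'"
    using S1.H_subset S2.H_subset by auto
  have contF: "continuous_map (subtopology T H) T' F"
  proof (rule S1.continuous_map_subgroupI)
    fix n
    have "continuous_map (subtopology T (C n)) T' (f (Suc n))"
      using A(3) nA(2) by (rule continuous_map_from_subtopology_mono)
    then show "continuous_map (subtopology T (C n)) T' F"
    proof (rule continuous_map_eq)
      fix x assume "x \<in> topspace (subtopology T (C n))"
      then have "x \<in> A (Suc n)" using nA(2)[of n] by auto
      then show "f (Suc n) x = F x" using F_f by simp
    qed
  qed
  have contI: "continuous_map (subtopology T' H') T (inv_into H F)"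
  proof (rule S2.continuous_map_subgroupI)
    fix n
    have "continuous_map (subtopology T' (f (Suc n) ` A (Suc n))) T (inv_into (A (Suc n)) (f (Suc n)))"
      by (rule compact_image_of_injective(2)[OF A(1) G2.Hausdorff A(3,4)])
    then have "continuous_map (subtopology T' (C' n)) T (inv_into (A (Suc n)) (f (Suc n)))"
      using nA(3) by (rule continuous_map_from_subtopology_mono)
    then show "continuous_map (subtopology T' (C' n)) T (inv_into H F)"
    proof (rule continuous_map_eq)
      fix y assume "y \<in> topspace (subtopology T' (C' n))"
      then have "y \<in> C' n" by auto
      then show "inv_into (A (Suc n)) (f (Suc n)) y = inv_into H F y" using inv_F by simp
    qed
  qed
  have "homeomorphic_maps (subtopology T H) (subtopology T' H') F (inv_into H F)"
    unfolding homeomorphic_maps_def top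
  proof (intro conjI ballI)
    show "continuous_map (subtopology T H) (subtopology T' H') F"
      unfolding continuous_map_in_subtopology using contF F_H top by auto
    show "continuous_map (subtopology T' H') (subtopology T H) (inv_into H F)"
      unfolding continuous_map_in_subtopology using contI F_surj top by (auto intro: inv_into_into)
    show "inv_into H F (F x) = x" if "x \<in> H" for x using F_inj that by (rule inv_into_f_f)
    show "F (inv_into H F y) = y" if "y \<in> H'" for y using F_surj[OF that] by (rule f_inv_into_f)
  qed
  then show ?thesis unfolding homeomorphic_space_def by blast
qed

section \<open>Cosets of an open subgroup and density\<close>

context t1_group
begin

definition coset :: "'a set \<Rightarrow> 'a \<Rightarrow> 'a set" where
  "coset H x = {y \<in> carrier G. y \<otimes> inv x \<in> H}"

definition cosets :: "'a set \<Rightarrow> 'a set set" where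
  "cosets H = coset H ` carrier G"

context
  fixes H assumes H: "subgroup H G" "openin T H"
begin

lemma coset_self: "x \<in> carrier G \<Longrightarrow> x \<in> coset H x"
  using subgroup.one_closed[OF H(1)] by (simp add: coset_def)

lemma coset_eq:
  assumes x: "x \<in> carrier G" and y: "y \<in> coset H x"
  shows "coset H y = coset H x"
proof -
  have yc: "y \<in> carrier G" and yx: "y \<otimes> inv x \<in> H" using y by (auto simp: coset_def)
  have xy: "x \<otimes> inv y \<in> H"
    using subgroup.m_inv_closed[OF H(1) yx] x yc by (simp add: inv_mult_group)
  have "z \<otimes> inv y \<in> H \<longleftrightarrow> z \<otimes> inv x \<in> H" if z: "z \<in> carrier G" for z
  proof
    assume "z \<otimes> inv y \<in> H"
    from subgroup.m_closed[OF H(1) this yx] show "z \<otimes> inv x \<in> H"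
      using x yc z by (simp add: m_assoc)
  next
    assume "z \<otimes> inv x \<in> H"
    from subgroup.m_closed[OF H(1) this xy] show "z \<otimes> inv y \<in> H"
      using x yc z by (simp add: m_assoc)
  qed
  then show ?thesis unfolding coset_def by auto
qed

lemma openin_coset: "x \<in> carrier G \<Longrightarrow> openin T (coset H x)"
  unfolding coset_def using H(2) by (intro openin_right_translate_preimage) simp_all

definition rep :: "'a set \<Rightarrow> 'a" where
  "rep c = (SOME y. y \<in> c)"

lemma rep_coset:
  assumes x: "x \<in> carrier G"
  shows "rep (coset H x) \<in> carrier G" "coset H (rep (coset H x)) = coset H x" "x \<otimes> inv (rep (coset H x)) \<in> H"
proof -
  have r: "rep (coset H x) \<in> coset H x"
    unfolding rep_def using coset_self[OF x] by (rule someI)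
  then show "rep (coset H x) \<in> carrier G" by (simp add: coset_def)
  show eq: "coset H (rep (coset H x)) = coset H x" using x r by (rule coset_eq)
  have "x \<in> coset H (rep (coset H x))" unfolding eq using x by (rule coset_self)
  then show "x \<otimes> inv (rep (coset H x)) \<in> H" by (simp add: coset_def)
qed

text \<open>Cosets are open, so the choice of representatives is locally constant; \<open>x\<close>
  corresponds to its coset together with \<open>x \<otimes> inv r\<close>, where \<open>r\<close>
  represents the coset.\<close>

lemma homeomorphic_prod_cosets:
  "T homeomorphic_space prod_topology (subtopology T H) (discrete_topology (cosets H))"
proof -
  let ?q = "coset H"
  let ?Y = "prod_topology (subtopology T H) (discrete_topology (cosets H))"
  have Hc: "H \<subseteq> carrier G" using H(1) by (rule subgroup.subset)
  have c1: "continuous_map T T (\<lambda>x. x \<otimes> inv (rep (?q x)))"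
  proof -
    have "continuous_map (subtopology T (topspace T)) T (\<lambda>x. x \<otimes> inv (rep (?q x)))"
    proof (rule continuous_map_subtopology_pointwiseI)
      show "x \<otimes> inv (rep (?q x)) \<in> topspace T" if "x \<in> topspace T" for x
        using that rep_coset(1)[of x] by simp
      fix x V assume "x \<in> topspace T" and V: "openin T V" "x \<otimes> inv (rep (?q x)) \<in> V"
      then have x: "x \<in> carrier G" by simp
      let ?W = "{y \<in> carrier G. y \<otimes> inv (rep (?q x)) \<in> V} \<inter> ?q x"
      have "openin T ?W"
        using V(1) rep_coset(1)[OF x] openin_coset[OF x]
        by (intro openin_Int openin_right_translate_preimage) simp_all
      moreover have "x \<in> ?W" using x V(2) coset_self by simp
      moreover have "\<forall>y\<in>topspace T. y \<in> ?W \<longrightarrow> y \<otimes> inv (rep (?q y)) \<in> V"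
        using coset_eq[OF x] by simp
      ultimately show "\<exists>W. openin T W \<and> x \<in> W \<and> (\<forall>y\<in>topspace T. y \<in> W \<longrightarrow> y \<otimes> inv (rep (?q y)) \<in> V)"
        by (intro exI[of _ ?W] conjI)
    qed simp
    then show ?thesis by (simp only: subtopology_topspace)
  qed
  have c2: "continuous_map T (discrete_topology (cosets H)) ?q"
    unfolding continuous_map
  proof (intro conjI allI impI)
    show "?q ` topspace T \<subseteq> topspace (discrete_topology (cosets H))" by (simp add: cosets_def)
    fix U
    show "openin T {x \<in> topspace T. ?q x \<in> U}"
    proof (subst openin_subopen, intro ballI)
      fix x assume x: "x \<in> {x \<in> topspace T. ?q x \<in> U}"
      then have xc: "x \<in> carrier G" by simp
      have "?q x \<subseteq> {x \<in> topspace T. ?q x \<in> U}"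
        using coset_eq[OF xc] x by (auto simp: coset_def)
      then show "\<exists>V. openin T V \<and> x \<in> V \<and> V \<subseteq> {x \<in> topspace T. ?q x \<in> U}"
        using openin_coset[OF xc] coset_self[OF xc] by (intro exI[of _ "?q x"] conjI)
    qed
  qed
  have c3: "continuous_map ?Y T (\<lambda>z. fst z \<otimes> rep (snd z))"
  proof (rule continuous_map_mult)
    show "continuous_map ?Y T fst"
      using continuous_map_fst[of "subtopology T H" "discrete_topology (cosets H)"]
      unfolding continuous_map_in_subtopology by simp
    have rc: "rep c \<in> carrier G" if "c \<in> cosets H" for c
      using that rep_coset(1) unfolding cosets_def by auto
    have "continuous_map (discrete_topology (cosets H)) T rep"
      unfolding continuous_map using rc by auto
    from continuous_map_compose[OF continuous_map_snd this]
    show "continuous_map ?Y T (\<lambda>z. rep (snd z))" by (simp add: o_def)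
  qed
  have "homeomorphic_maps T ?Y (\<lambda>x. (x \<otimes> inv (rep (?q x)), ?q x)) (\<lambda>z. fst z \<otimes> rep (snd z))"
    unfolding homeomorphic_maps_def
  proof (intro conjI ballI)
    have "continuous_map T (subtopology T H) (\<lambda>x. x \<otimes> inv (rep (?q x)))"
      unfolding continuous_map_in_subtopology using c1 rep_coset(3) by auto
    then show "continuous_map T ?Y (\<lambda>x. (x \<otimes> inv (rep (?q x)), ?q x))"
      using c2 by (rule continuous_map_pairedI)
    show "continuous_map ?Y T (\<lambda>z. fst z \<otimes> rep (snd z))" by (rule c3)
    show "fst (x \<otimes> inv (rep (?q x)), ?q x) \<otimes> rep (snd (x \<otimes> inv (rep (?q x)), ?q x)) = x" if "x \<in> topspace T" for x
      using that rep_coset(1)[of x] by (simp add: m_assoc)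
    fix z assume "z \<in> topspace ?Y"
    then obtain h x where z: "z = (h, ?q x)" and h: "h \<in> H" and x: "x \<in> carrier G"
      by (auto simp: cosets_def)
    let ?r = "rep (?q x)"
    have hc: "h \<in> carrier G" using h Hc by blast
    have r: "?r \<in> carrier G" "?q ?r = ?q x" using rep_coset[OF x] by simp_all
    have "h \<otimes> ?r \<in> ?q ?r" using h hc r(1) by (simp add: coset_def m_assoc)
    from coset_eq[OF r(1) this] r(2) have "?q (h \<otimes> ?r) = ?q x" by (rule trans)
    then show "(fst z \<otimes> rep (snd z) \<otimes> inv (rep (?q (fst z \<otimes> rep (snd z)))), ?q (fst z \<otimes> rep (snd z))) = z"
      unfolding z using hc r(1) by (simp add: m_assoc)
  qed
  then show ?thesis unfolding homeomorphic_space_def by (intro exI)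
qed

text \<open>A dense set meets each of the open cosets.\<close>

lemma card_cosets_le_density: "|cosets H| \<le>o space_density T"
proof (rule space_density[of T])
  fix D assume D: "dense_in T D" "space_density T = |D|"
  have DT: "D \<subseteq> carrier G" using D(1) by (simp add: dense_in_def)
  have "cosets H \<subseteq> coset H ` D"
  proof
    fix c assume "c \<in> cosets H"
    then obtain x where x: "x \<in> carrier G" "c = coset H x" by (auto simp: cosets_def)
    have "x \<in> T closure_of D" using D(1) x(1) by (simp add: dense_in_def)
    then obtain d where d: "d \<in> D" "d \<in> coset H x"
      using openin_coset[OF x(1)] coset_self[OF x(1)] unfolding in_closure_of by blast
    then have "c = coset H d" using coset_eq[OF x(1)] x(2) by simp
    then show "c \<in> coset H ` D" using d(1) by blast
  qed
  then have "|cosets H| \<le>o |coset H ` D|" by (rule card_of_mono1)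
  then show ?thesis unfolding D(2) using card_of_image by (rule ordLeq_transitive)
qed

lemma dense_in_translates:
  assumes E: "E \<subseteq> H" "H \<subseteq> T closure_of E"
  shows "dense_in T ((\<lambda>(c, h). h \<otimes> rep c) ` (cosets H \<times> E))"
proof -
  let ?D = "(\<lambda>(c, h). h \<otimes> rep c) ` (cosets H \<times> E)"
  have Hc: "H \<subseteq> carrier G" using H(1) by (rule subgroup.subset)
  have Dc: "?D \<subseteq> carrier G"
    using rep_coset(1) E(1) Hc unfolding cosets_def by auto
  have "x \<in> T closure_of ?D" if x: "x \<in> carrier G" for x
    unfolding in_closure_of
  proof (intro conjI allI impI)
    show "x \<in> topspace T" using x by simp
    fix V assume V: "x \<in> V \<and> openin T V"
    let ?r = "rep (coset H x)"
    have r: "?r \<in> carrier G" "x \<otimes> inv ?r \<in> H" using rep_coset[OF x] by simp_all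
    define W where "W = {y \<in> carrier G. y \<otimes> ?r \<in> V}"
    have "openin T W"
      unfolding W_def using V r(1) by (intro openin_right_translate_preimage) simp_all
    moreover have "x \<otimes> inv ?r \<in> W" using V x r(1) unfolding W_def by (simp add: m_assoc)
    ultimately have W: "x \<otimes> inv ?r \<in> W \<and> openin T W" by simp
    have "x \<otimes> inv ?r \<in> T closure_of E" using r(2) E(2) by (rule subsetD[rotated])
    then have "\<forall>V. x \<otimes> inv ?r \<in> V \<and> openin T V \<longrightarrow> (\<exists>y. y \<in> E \<and> y \<in> V)"
      unfolding in_closure_of by (rule conjunct2)
    from mp[OF spec[OF this] W] obtain h where h: "h \<in> E" "h \<in> W" by (elim exE conjE)
    have "coset H x \<in> cosets H" unfolding cosets_def using x by (rule imageI)
    with h(1) have "(coset H x, h) \<in> cosets H \<times> E" by simp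
    then have "(\<lambda>(c, h). h \<otimes> rep c) (coset H x, h) \<in> ?D" by (rule imageI)
    moreover have "h \<otimes> ?r \<in> V" using h(2) unfolding W_def by simp
    ultimately show "\<exists>y. y \<in> ?D \<and> y \<in> V" by (intro exI[of _ "h \<otimes> ?r"] conjI) (simp_all only: split)
  qed
  then have "T closure_of ?D = topspace T"
    using closure_of_subset_topspace[of T ?D] by (intro equalityI) auto
  then show ?thesis unfolding dense_in_def using Dc by simp
qed

end

end

section \<open>Separability and the number of cosets\<close>

lemma countable_iff_card_le_nat: "countable D \<longleftrightarrow> |D| \<le>o |UNIV :: nat set|"
  unfolding card_of_ordLeq[symmetric] countable_def by simp

definition separable :: "'a topology \<Rightarrow> bool" where
  "separable X \<longleftrightarrow> (\<exists>D. countable D \<and> dense_in X D)"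

text \<open>Separability thus depends on the density alone and passes from one group to the
  other.\<close>

lemma separable_iff_density: "separable X \<longleftrightarrow> space_density X \<le>o |UNIV :: nat set|"
proof
  assume "separable X"
  then obtain D where D: "countable D" "dense_in X D" unfolding separable_def by (elim exE conjE)
  have "space_density X \<le>o |D|"
  proof (rule space_density[of X])
    fix E assume "\<And>E'. dense_in X E' \<Longrightarrow> space_density X \<le>o |E'|"
    then show ?thesis using D(2) .
  qed
  then show "space_density X \<le>o |UNIV :: nat set|"
    using D(1) unfolding countable_iff_card_le_nat by (rule ordLeq_transitive)
next
  assume le: "space_density X \<le>o |UNIV :: nat set|"
  show "separable X"
  proof (rule space_density[of X])
    fix D assume "dense_in X D" "space_density X = |D|"
    then show ?thesis using le unfolding separable_def countable_iff_card_le_nat by auto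
  qed
qed

context punctiform_M_omega_grp
begin

lemma sigma_compact_subgroup_separable:
  assumes "sigma_compact_subgroup G T H C"
  obtains E where "countable E" "E \<subseteq> H" "H \<subseteq> T closure_of E"
proof -
  interpret S: sigma_compact_subgroup G T H C by fact
  have "\<forall>n. \<exists>D. countable D \<and> D \<subseteq> C n \<and> C n \<subseteq> T closure_of D"
  proof
    fix n
    obtain \<phi> where "coded T (C n) \<phi>" using compactin_imp_coded[OF S.C_compact[of n]] .
    then show "\<exists>D. countable D \<and> D \<subseteq> C n \<and> C n \<subseteq> T closure_of D"
      by (rule coded_separable) (intro exI conjI)
  qed
  from choice[OF this] obtain D where D: "\<forall>n. countable (D n) \<and> D n \<subseteq> C n \<and> C n \<subseteq> T closure_of (D n)" ..
  show ?thesis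
  proof (rule that[of "\<Union>n. D n"])
    show "countable (\<Union>n. D n)" using D by simp
    show "(\<Union>n. D n) \<subseteq> H" using D S.C_cover by auto
    show "H \<subseteq> T closure_of (\<Union>n. D n)"
    proof
      fix x assume "x \<in> H"
      then obtain n where "x \<in> C n" using S.C_cover by auto
      then have "x \<in> T closure_of (D n)" using D by auto
      moreover have "T closure_of (D n) \<subseteq> T closure_of (\<Union>n. D n)" by (rule closure_of_mono) auto
      ultimately show "x \<in> T closure_of (\<Union>n. D n)" by blast
    qed
  qed
qed

text \<open>Translates of a countable dense subset of \<open>H\<close> bound the density by the
  number of cosets times a countable cardinal. That number is infinite, since otherwise the group
  would be separable. In a separable group the equality can fail, as \<open>H\<close> may be the
  whole group.\<close>

lemma density_eq_card_cosets:
  assumes S: "sigma_compact_subgroup G T H C" and sep: "\<not> separable T"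
  shows "space_density T =o |cosets H|"
proof -
  interpret S: sigma_compact_subgroup G T H C by fact
  obtain E where E: "countable E" "E \<subseteq> H" "H \<subseteq> T closure_of E"
    by (rule sigma_compact_subgroup_separable[OF S])
  let ?D = "(\<lambda>(c, h). h \<otimes> rep c) ` (cosets H \<times> E)"
  have dense: "dense_in T ?D" using S.H S.H_open E(2,3) by (rule dense_in_translates)
  have "space_density T \<le>o |?D|"
  proof (rule space_density[of T])
    fix D' assume "\<And>E'. dense_in T E' \<Longrightarrow> space_density T \<le>o |E'|"
    then show ?thesis using dense .
  qed
  then have le: "space_density T \<le>o |cosets H \<times> E|" using card_of_image by (rule ordLeq_transitive)
  have inf: "infinite (cosets H)"
  proof
    assume "finite (cosets H)"
    then have "countable ?D" using E(1) by (simp add: countable_finite)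
    then show False using sep dense unfolding separable_def by blast
  qed
  have nat: "|E| \<le>o |cosets H|"
  proof (rule ordLeq_transitive)
    show "|E| \<le>o |UNIV :: nat set|" using E(1) unfolding countable_iff_card_le_nat .
    show "|UNIV :: nat set| \<le>o |cosets H|" using inf unfolding infinite_iff_card_of_nat .
  qed
  have "|cosets H \<times> E| \<le>o |cosets H|"
    using card_of_mono1[OF subset_refl] nat by (intro card_of_Sigma_ordLeq_infinite[OF inf] ballI)
  then have "space_density T \<le>o |cosets H|" using le by (rule ordLeq_transitive[rotated])
  then show ?thesis
    unfolding ordIso_iff_ordLeq using card_cosets_le_density[OF S.H S.H_open] by (rule conjI)
qed

text \<open>The constructed subgroup can be made to contain a countable dense set, and open
  subgroups are closed.\<close>

lemma separable_imp_sigma_compact: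
  assumes "separable T"
  obtains C where "sigma_compact_subgroup G T (carrier G) C"
proof -
  obtain D where D: "countable D" "dense_in T D" using assms unfolding separable_def by (elim exE conjE)
  have "D \<subseteq> carrier G" using D(2) by (simp add: dense_in_def)
  from sigma_compact_subgroup_exists[OF D(1) this] obtain H C where S: "sigma_compact_subgroup G T H C" and DH: "D \<subseteq> H"
    by (elim exE conjE)
  interpret S: sigma_compact_subgroup G T H C by (rule S)
  have "T closure_of D \<subseteq> H" using DH S.H_closed by (rule closure_of_minimal)
  then have "H = carrier G" using D(2) S.H_subset by (simp add: dense_in_def)
  then show ?thesis using that S by simp
qed

end

lemma homeomorphic_discrete_topology:
  assumes "|A| =o |B|"
  shows "discrete_topology A homeomorphic_space discrete_topology B"
proof -
  obtain f where f: "bij_betw f A B" using assms unfolding card_of_ordIso[symmetric] by (elim exE)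
  have "homeomorphic_maps (discrete_topology A) (discrete_topology B) f (inv_into A f)"
    unfolding homeomorphic_maps_def continuous_map
    using f bij_betw_inv_into[OF f] by (auto simp: bij_betw_def inv_into_f_f f_inv_into_f)
  then show ?thesis unfolding homeomorphic_space_def by (intro exI)
qed

lemma M_omega_group_imp_punctiform_M_omega_grp:
  assumes "M_omega_group G T" "\<not> metrizable_space T" "punctiform_space T"
  obtains K where "punctiform_M_omega_grp G T K"
proof -
  obtain K where "M_omega_grp G T K" by (rule M_omega_group_imp_M_omega_grp[OF assms(1)])
  then have "punctiform_M_omega_grp G T K"
    using assms(2,3)
    by (intro punctiform_M_omega_grp.intro nonmetrizable_M_omega_grp.intro
        nonmetrizable_M_omega_grp_axioms.intro punctiform_M_omega_grp_axioms.intro)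
  then show ?thesis by (rule that)
qed

theorem mainTheorem1:
  fixes G :: "('a, 'm) monoid_scheme" and TG :: "'a topology"
    and H :: "('b, 'n) monoid_scheme" and TH :: "'b topology"
  assumes "M_omega_group G TG" and "M_omega_group H TH"
    and "\<not> metrizable_space TG" and "\<not> metrizable_space TH"
    and "punctiform_space TG" and "punctiform_space TH"
  shows "TG homeomorphic_space TH \<longleftrightarrow>
           space_density TG =o space_density TH \<and>
           compact_scatteredness_rank TG =o compact_scatteredness_rank TH"
proof -
  obtain K where 1: "punctiform_M_omega_grp G TG K"
    by (rule M_omega_group_imp_punctiform_M_omega_grp[OF assms(1,3,5)])
  obtain K' where 2: "punctiform_M_omega_grp H TH K'"
    by (rule M_omega_group_imp_punctiform_M_omega_grp[OF assms(2,4,6)])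
  interpret G1: punctiform_M_omega_grp G TG K by (rule 1)
  interpret G2: punctiform_M_omega_grp H TH K' by (rule 2)
  show ?thesis
  proof (intro iffI conjI)
    assume homeo: "TG homeomorphic_space TH"
    then show "space_density TG =o space_density TH" by (rule homeomorphic_imp_density_eq)
    show "compact_scatteredness_rank TG =o compact_scatteredness_rank TH"
      using homeo G1.Hausdorff G2.Hausdorff by (rule homeomorphic_imp_rank_eq)
  next
    assume eq: "space_density TG =o space_density TH \<and>
      compact_scatteredness_rank TG =o compact_scatteredness_rank TH"
    have sep: "separable TG \<longleftrightarrow> separable TH"
      unfolding separable_iff_density
      using ordIso_ordLeq_trans[OF conjunct1[OF eq]] ordIso_ordLeq_trans[OF ordIso_symmetric[OF conjunct1[OF eq]]]
      by (rule iffI[rotated])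
    \<comment> \<open>In the separable case the whole group serves as the open subgroup; otherwise
      the number of cosets equals the density, so the discrete factors agree.\<close>
    show "TG homeomorphic_space TH"
    proof (cases "separable TG")
      case True
      obtain C where C: "sigma_compact_subgroup G TG (carrier G) C"
        by (rule G1.separable_imp_sigma_compact[OF True])
      have "separable TH" using True sep by simp
      then obtain C' where C': "sigma_compact_subgroup H TH (carrier H) C'"
        by (rule G2.separable_imp_sigma_compact)
      have "subtopology TG (topspace TG) homeomorphic_space subtopology TH (topspace TH)"
        unfolding G1.topspace_eq G2.topspace_eq
        by (rule homeomorphic_open_subgroups[OF 1 2 conjunct2[OF eq] C C'])
      then show ?thesis by (simp only: subtopology_topspace)
    next
      case False
      then have False': "\<not> separable TH" using sep by simp
      have "\<exists>A C. sigma_compact_subgroup G TG A C \<and> {} \<subseteq> A"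
        by (rule G1.sigma_compact_subgroup_exists) simp_all
      then obtain A C where C: "sigma_compact_subgroup G TG A C" by (elim exE conjE)
      have "\<exists>A C. sigma_compact_subgroup H TH A C \<and> {} \<subseteq> A"
        by (rule G2.sigma_compact_subgroup_exists) simp_all
      then obtain A' C' where C': "sigma_compact_subgroup H TH A' C'" by (elim exE conjE)
      interpret S1: sigma_compact_subgroup G TG A C by (rule C)
      interpret S2: sigma_compact_subgroup H TH A' C' by (rule C')
      have "|G1.cosets A| =o space_density TG"
        by (rule ordIso_symmetric[OF G1.density_eq_card_cosets[OF C False]])
      also have "space_density TG =o space_density TH" using eq ..
      also have "space_density TH =o |G2.cosets A'|"
        by (rule G2.density_eq_card_cosets[OF C' False'])
      finally have "discrete_topology (G1.cosets A) homeomorphic_space discrete_topology (G2.cosets A')"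
        by (rule homeomorphic_discrete_topology)
      moreover have "subtopology TG A homeomorphic_space subtopology TH A'"
        by (rule homeomorphic_open_subgroups[OF 1 2 conjunct2[OF eq] C C'])
      ultimately have "prod_topology (subtopology TG A) (discrete_topology (G1.cosets A)) homeomorphic_space
          prod_topology (subtopology TH A') (discrete_topology (G2.cosets A'))"
        by (intro homeomorphic_space_prod_topology)
      with G1.homeomorphic_prod_cosets[OF S1.H S1.H_open]
      have "TG homeomorphic_space prod_topology (subtopology TH A') (discrete_topology (G2.cosets A'))"
        by (rule homeomorphic_space_trans)
      then show ?thesis
        using G2.homeomorphic_prod_cosets[OF S2.H S2.H_open, unfolded homeomorphic_space_sym[of TH]]
        by (rule homeomorphic_space_trans)
    qed
  qed
qed

end
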